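(* Let $X=(0,\infty)$ and let $L_{(0,\infty),D}f=-f''$ on $X$ with Dirichlet boundary condition at $x=0$. If $f\in H^1_{L_{(0,\infty),D}}(X)$, then there exist scalars $\lambda_k$, functions $a_k$ and intervals $B_k\subseteq(0,\infty)$ such that $f=\sum_k\lambda_ka_k$, $\sum_k|\lambda_k|\simeq\|f\|_{H^1_{L_{(0,\infty),D}}(X)}$ and, for each $k$, $$\operatorname{supp}a_k\subseteq B_k,\qquad \left(\int_{B_k}|a_k(x)|^2\frac{dx}{x}\right)^{1/2}\le\left(\int_{B_k}x\,dx\right)^{-1/2},\qquad \int_{B_k}a_k(x)\,x\,dx=0.$$
   Context: $(0,\infty)$ carries the Euclidean distance and Lebesgue measure. The semigroup generated by $L=L_{(0,\infty),D}$, $T_t=\exp(-tL)$, has integral kernel $$T_t(x,y)=(4\pi t)^{-1/2}\left(e^{-(x-y)^2/(4t)}-e^{-(x+y)^2/(4t)}\right),\quad x,y,t>0.$$ $H^1_L(X)$ is the completion (realized in $L^1(0,\infty)$) of $\{f\in L^2(0,\infty):\|\sup_{t>0}|T_tf|\|_{L^1}<\infty\}$ with respect to the norm $\|f\|_{H^1_L(X)}=\|\sup_{t>0}|T_tf|\|_{L^1}$. The series $\sum_k\lambda_ka_k$ converges in $L^1(0,\infty)$ and a.e. $A\simeq B$ means $C^{-1}A\le B\le CA$ with $C>0$ independent of $f$. *)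

theory Defs
  imports "HOL-Analysis.Analysis"
begin

text \<open>Functions on the half-line are total functions whose values on \<open>{..0}\<close> are irrelevant.\<close>

definition half_line :: "real measure" where
  "half_line = restrict_space lborel {0<..}"

text \<open>
  The kernel of \<open>exp (- t L)\<close>, where \<open>L f = - f''\<close> on \<open>(0, \<infinity>)\<close> with Dirichlet condition at \<open>0\<close>:
  the Gauss kernel of the real line, made odd by reflection. The semigroup is
  defined through this kernel, so that it acts on \<open>L\<^sup>2\<close> and on \<open>L\<^sup>1\<close>.
\<close>

definition dirichlet_kernel :: "real \<Rightarrow> real \<Rightarrow> real \<Rightarrow> real" where
  "dirichlet_kernel t x y =
     (4 * pi * t) powr (-1/2) * (exp (- (x - y)\<^sup>2 / (4 * t)) - exp (- (x + y)\<^sup>2 / (4 * t)))"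

definition dirichlet_semigroup :: "real \<Rightarrow> (real \<Rightarrow> complex) \<Rightarrow> real \<Rightarrow> complex" where
  "dirichlet_semigroup t f x = (LINT y|half_line. complex_of_real (dirichlet_kernel t x y) * f y)"

lemma dirichlet_kernel_boundary: "dirichlet_kernel t 0 y = 0"
  by (simp add: dirichlet_kernel_def)

lemma dirichlet_kernel_heat_equation:
  assumes "0 < t"
  shows "((\<lambda>s. dirichlet_kernel s x y) has_real_derivative
            deriv (deriv (\<lambda>z. dirichlet_kernel t z y)) x) (at t)"
proof -
  define c where "c = (4 * pi * t) powr (-1/2)"
  define g where "g = (\<lambda>v z. exp (- (z + v)\<^sup>2 / (4 * t)))"
  define g1 where "g1 = (\<lambda>v z. g v z * (- (z + v) / (2 * t)))"
  define g2 where "g2 = (\<lambda>v z. g v z * ((z + v)\<^sup>2 / (4 * t\<^sup>2) - 1 / (2 * t)))"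
  have dg: "(g v has_real_derivative g1 v z) (at z)" for v z
  proof -
    have "((\<lambda>z. - (z + v)\<^sup>2 / (4 * t)) has_real_derivative - (z + v) / (2 * t)) (at z)"
      using assms by (auto intro!: derivative_eq_intros simp: field_simps)
    from DERIV_chain2[OF DERIV_exp this] show ?thesis
      by (simp add: g_def g1_def)
  qed
  have dg1: "(g1 v has_real_derivative g2 v z) (at z)" for v z
  proof -
    have "((\<lambda>z. - (z + v) / (2 * t)) has_real_derivative - 1 / (2 * t)) (at z)"
      using assms by (auto intro!: derivative_eq_intros simp: field_simps)
    from DERIV_mult[OF dg[of v z] this] show ?thesis
      unfolding g1_def g2_def
      by (rule DERIV_cong) (simp add: field_simps power2_eq_square)
  qed
  have "(\<lambda>z. dirichlet_kernel t z y) = (\<lambda>z. c * (g (- y) z - g y z))"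
    by (simp add: dirichlet_kernel_def c_def g_def)
  then have "deriv (\<lambda>z. dirichlet_kernel t z y) = (\<lambda>z. c * (g1 (- y) z - g1 y z))"
    by (auto intro!: DERIV_imp_deriv DERIV_cmult DERIV_diff dg)
  then have d2: "deriv (deriv (\<lambda>z. dirichlet_kernel t z y)) x = c * (g2 (- y) x - g2 y x)"
    by (auto intro!: DERIV_imp_deriv DERIV_cmult DERIV_diff dg1)
  have p: "((\<lambda>s. (4 * pi * s) powr (-1/2)) has_real_derivative - c / (2 * t)) (at t)"
  proof -
    have "((\<lambda>s. 4 * pi * s) has_real_derivative 4 * pi) (at t)"
      by (auto intro!: derivative_eq_intros)
    moreover have "c = (4 * pi * t) * (4 * pi * t) powr (-3/2)"
      using assms powr_mult_base[of "4 * pi * t" "-3/2"] by (simp add: c_def)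
    ultimately show ?thesis
      using assms DERIV_fun_powr[of "\<lambda>s. 4 * pi * s" "4 * pi" t "-1/2"]
      by (auto elim!: DERIV_cong simp: field_simps)
  qed
  have e: "((\<lambda>s. exp (- u / (4 * s))) has_real_derivative exp (- u / (4 * t)) * (u / (4 * t\<^sup>2))) (at t)"
    for u :: real
  proof -
    have "((\<lambda>s. - u / (4 * s)) has_real_derivative u / (4 * t\<^sup>2)) (at t)"
      using assms by (auto intro!: derivative_eq_intros simp: field_simps power2_eq_square)
    from DERIV_chain2[OF DERIV_exp this] show ?thesis .
  qed
  have "((\<lambda>s. dirichlet_kernel s x y) has_real_derivative c * (g2 (- y) x - g2 y x)) (at t)"
    unfolding dirichlet_kernel_def
    by (rule DERIV_cong[OF DERIV_mult[OF p DERIV_diff[OF e e]]])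
       (simp add: g2_def g_def c_def algebra_simps)
  then show ?thesis
    by (simp add: d2)
qed

definition maximal_function :: "(real \<Rightarrow> complex) \<Rightarrow> real \<Rightarrow> ennreal" where
  "maximal_function f x = (SUP t\<in>{0<..}. ennreal (norm (dirichlet_semigroup t f x)))"

definition hardy_norm :: "(real \<Rightarrow> complex) \<Rightarrow> ennreal" where
  "hardy_norm f = (\<integral>\<^sup>+x. maximal_function f x \<partial>half_line)"

definition pre_hardy_space :: "(real \<Rightarrow> complex) set" where
  "pre_hardy_space = {f \<in> borel_measurable half_line.
     integrable half_line (\<lambda>x. (norm (f x))\<^sup>2) \<and> hardy_norm f < \<infinity>}"

text \<open>
  The completion of \<open>pre_hardy_space\<close>, realized in \<open>L\<^sup>1\<close>: the \<open>L\<^sup>1\<close>-limits of the sequences that are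
  Cauchy for \<open>hardy_norm\<close>. By Fatou's lemma such a sequence also converges to its limit in
  \<open>hardy_norm\<close>, so the norm of the completion is again given by \<open>hardy_norm\<close>.
\<close>

definition hardy_space :: "(real \<Rightarrow> complex) set" where
  "hardy_space = {f. integrable half_line f \<and>
     (\<exists>F. (\<forall>n. F n \<in> pre_hardy_space) \<and>
          (\<forall>e>0. \<exists>N::nat. \<forall>m\<ge>N. \<forall>n\<ge>N. hardy_norm (\<lambda>x. F m x - F n x) < ennreal e) \<and>
          (\<lambda>n. \<integral>\<^sup>+x. ennreal (norm (F n x - f x)) \<partial>half_line) \<longlonglongrightarrow> 0)}"

text \<open>
  The support is taken relative to \<open>(0, \<infinity>)\<close>. Boundedness and nonempty interior of \<open>B\<close> make
  \<open>\<integral>\<^sub>B x dx\<close> finite and positive; the integrability conditions exclude the convention that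
  non-integrable functions have integral \<open>0\<close>.
\<close>

definition atom_on :: "real set \<Rightarrow> (real \<Rightarrow> complex) \<Rightarrow> bool" where
  "atom_on B a \<longleftrightarrow>
     is_interval B \<and> B \<subseteq> {0<..} \<and> bounded B \<and> interior B \<noteq> {} \<and>
     a \<in> borel_measurable half_line \<and>
     closure {x \<in> {0<..}. a x \<noteq> 0} \<inter> {0<..} \<subseteq> B \<and>
     set_integrable lborel B (\<lambda>x. (norm (a x))\<^sup>2 / x) \<and>
     (LINT x:B|lborel. (norm (a x))\<^sup>2 / x) powr (1/2) \<le> (LINT x:B|lborel. x) powr (-1/2) \<and>
     set_integrable lborel B (\<lambda>x. a x * complex_of_real x) \<and>
     (LINT x:B|lborel. a x * complex_of_real x) = 0"

end

theory Submission
  imports Defs "HOL-Complex_Analysis.Complex_Analysis"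
begin

text \<open>
  Let \<open>u\<close> be the harmonic extension to the upper half-plane of the odd extension of \<open>f\<close>, that is,
  its Poisson integral. The decomposition is built from level sets of a function \<open>N\<close> that controls
  \<open>u\<close> in cones, and it rests on three observations.

  First, the Poisson semigroup is an average of the heat semigroup over times (subordination), so
  \<open>\<bar>u(x, t)\<bar> \<le> 2 h(x)\<close> for all \<open>t\<close>, where \<open>h\<close> is the maximal function of \<open>f\<close>
  (\<open>poisson_le_maximal_function\<close>). This is a bound along vertical lines. Harmonic functions upgrade it
  to a bound in cones: although \<open>\<bar>u\<bar>\<^sup>p\<close> need not be subharmonic for \<open>p < 1\<close>, the square root
  \<open>\<bar>u(z)\<bar>\<^sup>1\<^sup>/\<^sup>2\<close> is still bounded by a multiple of the average of \<open>h\<^sup>1\<^sup>/\<^sup>2\<close> over an interval around \<open>Re z\<close>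
  of length comparable with \<open>Im z\<close> (\<open>sqrt_Re_le_average\<close>). Hence \<open>\<bar>u\<bar> \<le> N(x)\<close> in the cone with vertex
  \<open>x\<close>, where \<open>N\<close> is a multiple of the square of the Hardy--Littlewood maximal function of \<open>h\<^sup>1\<^sup>/\<^sup>2\<close>. The
  \<open>L\<^sup>2\<close> bound of that maximal function (\<open>hl_maximal_L2\<close>) gives \<open>\<integral>N \<le> C \<integral>h\<close>.

  Second, the moment \<open>\<integral>\<^sub>a\<^sup>b x f(x) dx\<close> is controlled by \<open>N(a)\<close> and \<open>N(b)\<close> alone. The function \<open>w = x y\<close> is
  harmonic, vanishes on the real axis, and has normal derivative \<open>x\<close> there, so Green's formula
  moves the integral to a contour above \<open>[a, b]\<close> that stays inside the cones with vertices \<open>a\<close>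
  and \<open>b\<close>. There \<open>\<bar>u\<bar>\<close> and \<open>y\<bar>\<nabla>u\<bar>\<close> are bounded by \<open>N\<close> (\<open>moment_on_interval\<close>, \<open>moment_le\<close>).
  For \<open>a = 0\<close> the vertical leg of the contour contributes nothing, because \<open>u\<close> and \<open>w\<close> vanish on the
  imaginary axis.

  Third, the natural level sets are those of \<open>N(x) / x\<close> with respect to \<open>x dx\<close>. Let \<open>\<Omega>\<^sub>k\<close> be the open set
  where \<open>N(x) > 2\<^sup>k x\<close>. Let \<open>g\<^sub>k\<close> agree with \<open>f\<close> off \<open>\<Omega>\<^sub>k\<close>, and on each component \<open>I\<close> of \<open>\<Omega>\<^sub>k\<close> let it be the
  multiple of \<open>x\<close> with the same moment as \<open>f\<close>. The end points of \<open>I\<close> lie outside \<open>\<Omega>\<^sub>k\<close>, so the second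
  observation yields \<open>\<bar>g\<^sub>k(x)\<bar> \<le> C 2\<^sup>k x\<close>. Therefore \<open>f\<close> is the sum over \<open>k\<close> of \<open>g\<^sub>k\<^sub>+\<^sub>1 - g\<^sub>k\<close>. This difference
  lives on \<open>\<Omega>\<^sub>k\<close>, is bounded by \<open>C 2\<^sup>k x\<close>, and has moment zero on each component of \<open>\<Omega>\<^sub>k\<close>: it splits into
  multiples of atoms. The coefficients add up to a multiple of \<open>\<Sum>\<^sub>k 2\<^sup>k \<integral>\<^bsub>\<Omega>\<^sub>k\<^esub> x dx \<le> 2 \<integral>N\<close>
  (\<open>moment_control.atomic_decomposition\<close>).
\<close>

section \<open>Functions on the half-line and the Dirichlet heat semigroup\<close>

lemma borel_measurable_if_open_greater:
  fixes F :: "real \<Rightarrow> ennreal"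
  assumes "\<And>c. open {x. c < F x}"
  shows "F \<in> borel_measurable borel"
  by (rule borel_measurableI_greater) (use assms in auto)

text \<open>
  Integrals over the half-line become integrals over the line, where affine substitutions are
  available.
\<close>

definition zero_ext :: "(real \<Rightarrow> complex) \<Rightarrow> real \<Rightarrow> complex" where
  "zero_ext f x = indicator {0<..} x *\<^sub>R f x"

lemma integrable_zero_ext: "integrable lborel (zero_ext f) \<longleftrightarrow> integrable half_line f"
  unfolding half_line_def zero_ext_def[abs_def] by (subst integrable_restrict_space) auto

lemma nn_integral_half_line: "(\<integral>\<^sup>+x. F x \<partial>half_line) = (\<integral>\<^sup>+x\<in>{0<..}. F x \<partial>lborel)"
  unfolding half_line_def by (subst nn_integral_restrict_space) auto

lemma AE_half_line: "(AE x in half_line. P x) \<longleftrightarrow> (AE x in lborel. 0 < x \<longrightarrow> P x)"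
  unfolding half_line_def by (subst AE_restrict_space_iff) auto

lemma dirichlet_semigroup_zero_ext:
  "dirichlet_semigroup t f x = (LINT y|lborel. complex_of_real (dirichlet_kernel t x y) * zero_ext f y)"
  unfolding dirichlet_semigroup_def half_line_def zero_ext_def
  by (subst integral_restrict_space) (auto intro!: Bochner_Integration.integral_cong simp: indicator_def)

lemma dirichlet_kernel_measurable [measurable]: "(\<lambda>y. dirichlet_kernel t x y) \<in> borel_measurable borel"
  unfolding dirichlet_kernel_def by measurable

text \<open>
  Both exponentials lie in \<open>(0, 1]\<close>, so their difference is at most one in absolute value.
\<close>

lemma abs_dirichlet_kernel_le:
  assumes "0 < t"
  shows "\<bar>dirichlet_kernel t x y\<bar> \<le> (4 * pi * t) powr (-1/2)"
proof -
  have "exp (- (x - y)\<^sup>2 / (4 * t)) \<le> 1" "exp (- (x + y)\<^sup>2 / (4 * t)) \<le> 1" using assms by auto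
  then have "\<bar>exp (- (x - y)\<^sup>2 / (4 * t)) - exp (- (x + y)\<^sup>2 / (4 * t))\<bar> \<le> 1"
    using exp_gt_zero[of "- (x - y)\<^sup>2 / (4 * t)"] exp_gt_zero[of "- (x + y)\<^sup>2 / (4 * t)"] by linarith
  then have "(4 * pi * t) powr (-1/2) * \<bar>exp (- (x - y)\<^sup>2 / (4 * t)) - exp (- (x + y)\<^sup>2 / (4 * t))\<bar> \<le> (4 * pi * t) powr (-1/2) * 1"
    by (intro mult_left_mono) auto
  then show ?thesis by (simp add: dirichlet_kernel_def abs_mult)
qed

lemma integrable_dirichlet_kernel:
  assumes "0 < t" and f: "integrable half_line f"
  shows "integrable lborel (\<lambda>y. complex_of_real (dirichlet_kernel t x y) * zero_ext f y)"
proof (rule Bochner_Integration.integrable_bound)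
  have f0: "integrable lborel (zero_ext f)" using f by (simp add: integrable_zero_ext)
  then show "integrable lborel (\<lambda>y. (4 * pi * t) powr (-1/2) * norm (zero_ext f y))"
    by (intro integrable_mult_right integrable_norm)
  show "(\<lambda>y. complex_of_real (dirichlet_kernel t x y) * zero_ext f y) \<in> borel_measurable lborel"
    using borel_measurable_integrable[OF f0] by measurable
  show "AE y in lborel. norm (complex_of_real (dirichlet_kernel t x y) * zero_ext f y) \<le> norm ((4 * pi * t) powr (-1/2) * norm (zero_ext f y))"
    using abs_dirichlet_kernel_le[OF assms(1)] by (intro AE_I2) (auto simp: norm_mult intro!: mult_right_mono)
qed

lemma norm_dirichlet_semigroup_le:
  assumes "0 < t" and f: "integrable half_line f"
  shows "norm (dirichlet_semigroup t f x) \<le> (4 * pi * t) powr (-1/2) * (LINT y|lborel. norm (zero_ext f y))"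
proof -
  have f0: "integrable lborel (zero_ext f)" using f by (simp add: integrable_zero_ext)
  have "norm (dirichlet_semigroup t f x) \<le> (LINT y|lborel. norm (complex_of_real (dirichlet_kernel t x y) * zero_ext f y))"
    unfolding dirichlet_semigroup_zero_ext by (rule integral_norm_bound)
  also have "\<dots> \<le> (LINT y|lborel. (4 * pi * t) powr (-1/2) * norm (zero_ext f y))"
    using abs_dirichlet_kernel_le[OF assms(1)]
    by (intro integral_mono integrable_norm integrable_dirichlet_kernel assms integrable_mult_right f0)
       (auto simp: norm_mult intro!: mult_right_mono)
  also have "\<dots> = (4 * pi * t) powr (-1/2) * (LINT y|lborel. norm (zero_ext f y))"
    by (rule integral_mult_right_zero)
  finally show ?thesis .
qed

lemma zero_ext_diff: "zero_ext (\<lambda>x. f x - g x) = (\<lambda>x. zero_ext f x - zero_ext g x)"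
  by (auto simp: zero_ext_def algebra_simps)

lemma dirichlet_semigroup_diff:
  assumes "0 < t" "integrable half_line f" "integrable half_line g"
  shows "dirichlet_semigroup t (\<lambda>x. f x - g x) x = dirichlet_semigroup t f x - dirichlet_semigroup t g x"
  unfolding dirichlet_semigroup_zero_ext zero_ext_diff right_diff_distrib
  by (intro Bochner_Integration.integral_diff integrable_dirichlet_kernel assms)

lemma continuous_dirichlet_semigroup:
  assumes t: "0 < t" and f: "integrable half_line f"
  shows "continuous_on UNIV (dirichlet_semigroup t f)"
proof (rule continuous_at_imp_continuous_on, rule ballI)
  fix x :: real
  have f0: "integrable lborel (zero_ext f)" using f by (simp add: integrable_zero_ext)
  note [measurable] = borel_measurable_integrable[OF f0]
  show "isCont (dirichlet_semigroup t f) x"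
    unfolding continuous_at_sequentially
  proof (intro allI impI)
    fix u :: "nat \<Rightarrow> real" assume u: "u \<longlonglongrightarrow> x"
    show "(dirichlet_semigroup t f \<circ> u) \<longlonglongrightarrow> dirichlet_semigroup t f x"
      unfolding o_def dirichlet_semigroup_zero_ext
    proof (rule integral_dominated_convergence)
      show "integrable lborel (\<lambda>y. (4 * pi * t) powr (-1/2) * norm (zero_ext f y))"
        by (intro integrable_mult_right integrable_norm f0)
      show "AE y in lborel. (\<lambda>n. complex_of_real (dirichlet_kernel t (u n) y) * zero_ext f y) \<longlonglongrightarrow> complex_of_real (dirichlet_kernel t x y) * zero_ext f y"
        unfolding dirichlet_kernel_def using t by (intro AE_I2 tendsto_intros u) auto
      show "AE y in lborel. norm (complex_of_real (dirichlet_kernel t (u n) y) * zero_ext f y) \<le> (4 * pi * t) powr (-1/2) * norm (zero_ext f y)" for n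
        using abs_dirichlet_kernel_le[OF t] by (intro AE_I2) (auto simp: norm_mult intro!: mult_right_mono)
    qed measurable
  qed
qed

text \<open>
  A supremum of uncountably many functions; it is measurable because each of them is continuous, so
  that the supremum is lower semicontinuous.
\<close>

lemma maximal_function_measurable:
  assumes f: "integrable half_line f"
  shows "maximal_function f \<in> borel_measurable borel"
proof (rule borel_measurable_if_open_greater)
  fix c
  have "open {x. c < ennreal (norm (dirichlet_semigroup t f x))}" if "0 < t" for t
    using continuous_dirichlet_semigroup[OF that f]
    by (intro open_Collect_less continuous_on_ennreal continuous_on_norm continuous_on_const)
  then have "open (\<Union>t\<in>{0<..}. {x. c < ennreal (norm (dirichlet_semigroup t f x))})" by auto
  also have "(\<Union>t\<in>{0<..}. {x. c < ennreal (norm (dirichlet_semigroup t f x))}) = {x. c < maximal_function f x}"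
    by (auto simp: maximal_function_def less_SUP_iff)
  finally show "open {x. c < maximal_function f x}" .
qed

lemma norm_dirichlet_semigroup_le_maximal:
  "0 < t \<Longrightarrow> ennreal (norm (dirichlet_semigroup t f x)) \<le> maximal_function f x"
  unfolding maximal_function_def by (rule SUP_upper) simp

text \<open>
  Convergence in \<open>L\<^sup>1\<close> implies pointwise convergence of the semigroup, hence the maximal function of
  the limit is at most the lower limit of the maximal functions, and Fatou's lemma applies. The Cauchy
  condition bounds the Hardy norms of the approximating sequence.
\<close>

lemma hardy_norm_finite:
  assumes "f \<in> hardy_space"
  shows "integrable half_line f" "hardy_norm f < \<infinity>"
proof -
  show f: "integrable half_line f" using assms by (simp add: hardy_space_def)
  obtain F where F: "\<And>n. F n \<in> pre_hardy_space"
    "\<And>e. 0 < e \<Longrightarrow> \<exists>N::nat. \<forall>m\<ge>N. \<forall>n\<ge>N. hardy_norm (\<lambda>x. F m x - F n x) < ennreal e"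
    "(\<lambda>n. \<integral>\<^sup>+x. ennreal (norm (F n x - f x)) \<partial>half_line) \<longlonglongrightarrow> 0"
    using assms by (auto simp: hardy_space_def)
  let ?d = "\<lambda>n. (\<integral>\<^sup>+x. ennreal (norm (F n x - f x)) \<partial>half_line)"
  have [measurable]: "F n \<in> borel_measurable half_line" for n using F(1)[of n] by (simp add: pre_hardy_space_def)
  note [measurable] = borel_measurable_integrable[OF f]
  obtain N where N: "\<And>m n. N \<le> m \<Longrightarrow> N \<le> n \<Longrightarrow> hardy_norm (\<lambda>x. F m x - F n x) < ennreal 1"
    using F(2)[of 1] by auto
  have "eventually (\<lambda>n. (?d n) < 1) sequentially"
    using F(3) by (rule order_tendstoD) simp
  then obtain N' where N': "\<And>n. N' \<le> n \<Longrightarrow> (?d n) < 1"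
    by (auto simp: eventually_sequentially)
  define m where "m = max N N'"
  have d: "integrable half_line (\<lambda>x. F n x - f x)" if "m \<le> n" for n
  proof (rule integrableI_bounded)
    show "(?d n) < \<infinity>"
      using N'[of n] that by (auto simp: m_def intro: less_trans)
  qed measurable
  have Fi: "integrable half_line (F n)" if "m \<le> n" for n
    using Bochner_Integration.integrable_add[OF d[OF that] f] by simp
  have bound: "hardy_norm (F n) \<le> 1 + hardy_norm (F m)" if n: "m \<le> n" for n
  proof -
    have i: "integrable half_line (\<lambda>x. F n x - F m x)" using Fi[OF n] Fi[of m] by simp
    have "maximal_function (F n) x \<le> maximal_function (\<lambda>x. F n x - F m x) x + maximal_function (F m) x" for x
      unfolding maximal_function_def[of "F n"]
    proof (rule SUP_least)
      fix t :: real assume "t \<in> {0<..}"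
      then have t: "0 < t" by simp
      have "norm (dirichlet_semigroup t (F n) x) \<le> norm (dirichlet_semigroup t (\<lambda>x. F n x - F m x) x) + norm (dirichlet_semigroup t (F m) x)"
        unfolding dirichlet_semigroup_diff[OF t Fi[OF n] Fi[OF order_refl]] by (metis diff_add_cancel norm_triangle_ineq)
      then have "ennreal (norm (dirichlet_semigroup t (F n) x)) \<le> ennreal (norm (dirichlet_semigroup t (\<lambda>x. F n x - F m x) x)) + ennreal (norm (dirichlet_semigroup t (F m) x))"
        by (simp add: ennreal_leI flip: ennreal_plus)
      also have "\<dots> \<le> maximal_function (\<lambda>x. F n x - F m x) x + maximal_function (F m) x"
        by (intro add_mono norm_dirichlet_semigroup_le_maximal t)
      finally show "ennreal (norm (dirichlet_semigroup t (F n) x)) \<le> maximal_function (\<lambda>x. F n x - F m x) x + maximal_function (F m) x" .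
    qed
    then have "hardy_norm (F n) \<le> (\<integral>\<^sup>+x. maximal_function (\<lambda>x. F n x - F m x) x + maximal_function (F m) x \<partial>half_line)"
      unfolding hardy_norm_def by (intro nn_integral_mono)
    also have "\<dots> = hardy_norm (\<lambda>x. F n x - F m x) + hardy_norm (F m)"
      unfolding hardy_norm_def half_line_def
      using maximal_function_measurable[OF i] maximal_function_measurable[OF Fi[OF order_refl]]
      by (intro nn_integral_add measurable_restrict_space1) auto
    also have "\<dots> \<le> 1 + hardy_norm (F m)"
      using N[of n m] n by (intro add_right_mono less_imp_le) (auto simp: m_def)
    finally show ?thesis .
  qed
  have lim: "(\<lambda>n. dirichlet_semigroup t (F n) x) \<longlonglongrightarrow> dirichlet_semigroup t f x" if t: "0 < t" for t x
  proof (rule LIM_zero_cancel, rule Lim_null_comparison)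
    let ?L = "\<lambda>n. LINT y|lborel. norm (zero_ext (\<lambda>x. F n x - f x) y)"
    have "ennreal (?L n) = (?d n)" if "m \<le> n" for n
    proof -
      have "ennreal (?L n) = (\<integral>\<^sup>+y. ennreal (norm (zero_ext (\<lambda>x. F n x - f x) y)) \<partial>lborel)"
        using d[OF that] by (intro nn_integral_eq_integral[symmetric] integrable_norm) (auto simp: integrable_zero_ext)
      also have "\<dots> = (?d n)"
        unfolding nn_integral_half_line by (intro nn_integral_cong) (auto simp: zero_ext_def indicator_def)
      finally show ?thesis .
    qed
    then have "eventually (\<lambda>n. (?d n) = ennreal (?L n)) sequentially"
      by (intro eventually_sequentiallyI[of m]) simp
    from Lim_transform_eventually[OF F(3) this] have "(\<lambda>n. ennreal (?L n)) \<longlonglongrightarrow> ennreal 0" by simp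
    then have "?L \<longlonglongrightarrow> 0" by (rule tendsto_ennrealD) (auto intro!: always_eventually)
    then show "(\<lambda>n. (4 * pi * t) powr (-1/2) * ?L n) \<longlonglongrightarrow> 0" by (rule tendsto_mult_right_zero)
    have "norm (dirichlet_semigroup t (F n) x - dirichlet_semigroup t f x) \<le> (4 * pi * t) powr (-1/2) * ?L n" if "m \<le> n" for n
      using norm_dirichlet_semigroup_le[OF t d[OF that], of x] by (simp add: dirichlet_semigroup_diff[OF t Fi[OF that] f])
    then show "eventually (\<lambda>n. norm (dirichlet_semigroup t (F n) x - dirichlet_semigroup t f x) \<le> (4 * pi * t) powr (-1/2) * ?L n) sequentially"
      by (rule eventually_sequentiallyI)
  qed
  have "maximal_function f x \<le> liminf (\<lambda>n. maximal_function (F (n + m)) x)" for x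
    unfolding maximal_function_def[of f]
  proof (rule SUP_least)
    fix t :: real assume "t \<in> {0<..}"
    then have t: "0 < t" by simp
    have "(\<lambda>n. ennreal (norm (dirichlet_semigroup t (F (n + m)) x))) \<longlonglongrightarrow> ennreal (norm (dirichlet_semigroup t f x))"
      using LIMSEQ_ignore_initial_segment[OF lim[OF t]] by (intro tendsto_ennrealI tendsto_norm)
    then have "ennreal (norm (dirichlet_semigroup t f x)) = liminf (\<lambda>n. ennreal (norm (dirichlet_semigroup t (F (n + m)) x)))"
      by (intro lim_imp_Liminf[symmetric]) auto
    also have "\<dots> \<le> liminf (\<lambda>n. maximal_function (F (n + m)) x)"
      by (intro Liminf_mono always_eventually allI norm_dirichlet_semigroup_le_maximal t)
    finally show "ennreal (norm (dirichlet_semigroup t f x)) \<le> liminf (\<lambda>n. maximal_function (F (n + m)) x)" .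
  qed
  then have "hardy_norm f \<le> (\<integral>\<^sup>+x. liminf (\<lambda>n. maximal_function (F (n + m)) x) \<partial>half_line)"
    unfolding hardy_norm_def by (intro nn_integral_mono)
  also have "\<dots> \<le> liminf (\<lambda>n. hardy_norm (F (n + m)))"
    unfolding hardy_norm_def half_line_def
    by (intro nn_integral_liminf measurable_restrict_space1) (use maximal_function_measurable[OF Fi] in auto)
  also have "\<dots> \<le> 1 + hardy_norm (F m)"
    using bound by (intro Liminf_le) (auto intro!: always_eventually)
  also have "\<dots> < \<infinity>" using F(1)[of m] by (simp add: pre_hardy_space_def)
  finally show "hardy_norm f < \<infinity>" .
qed

section \<open>Poisson integrals as approximate identities\<close>

lemma tendsto_zero_ennrealI:
  fixes u :: "'a \<Rightarrow> ennreal"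
  assumes "\<And>d. 0 < d \<Longrightarrow> eventually (\<lambda>n. u n \<le> ennreal d) F"
  shows "(u \<longlongrightarrow> 0) F"
proof (rule order_tendstoI)
  fix a :: ennreal assume "0 < a"
  then obtain b where b: "0 < b" "b < a" using dense by blast
  then obtain d where d: "b = ennreal d" by (cases b rule: ennreal_cases) auto
  then have "eventually (\<lambda>n. u n \<le> ennreal d) F" using b by (intro assms) simp
  then show "eventually (\<lambda>n. u n < a) F" by eventually_elim (use b d in auto)
qed simp

text \<open>
  The \<open>L\<^sup>1\<close> modulus of continuity of \<open>F\<close>.
\<close>

definition shift_diff :: "(real \<Rightarrow> real) \<Rightarrow> real \<Rightarrow> ennreal" where
  "shift_diff F h = (\<integral>\<^sup>+x. ennreal \<bar>F (x + h) - F x\<bar> \<partial>lborel)"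

lemma nn_integral_shift:
  fixes F :: "real \<Rightarrow> ennreal"
  assumes "F \<in> borel_measurable borel"
  shows "(\<integral>\<^sup>+x. F (x + h) \<partial>lborel) = (\<integral>\<^sup>+x. F x \<partial>lborel)"
  using nn_integral_real_affine[OF assms, of 1 h] by (simp add: add.commute)

lemma shift_diff_le:
  assumes [measurable]: "F \<in> borel_measurable borel"
  shows "shift_diff F h \<le> 2 * (\<integral>\<^sup>+x. ennreal \<bar>F x\<bar> \<partial>lborel)"
proof -
  have "shift_diff F h \<le> (\<integral>\<^sup>+x. ennreal \<bar>F (x + h)\<bar> + ennreal \<bar>F x\<bar> \<partial>lborel)"
    unfolding shift_diff_def by (intro nn_integral_mono) (simp add: ennreal_leI flip: ennreal_plus)
  also have "\<dots> = (\<integral>\<^sup>+x. ennreal \<bar>F (x + h)\<bar> \<partial>lborel) + (\<integral>\<^sup>+x. ennreal \<bar>F x\<bar> \<partial>lborel)"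
    by (rule nn_integral_add) measurable
  also have "(\<integral>\<^sup>+x. ennreal \<bar>F (x + h)\<bar> \<partial>lborel) = (\<integral>\<^sup>+x. ennreal \<bar>F x\<bar> \<partial>lborel)"
    by (rule nn_integral_shift[of "\<lambda>x. ennreal \<bar>F x\<bar>"]) measurable
  finally show ?thesis by (simp add: mult_2)
qed

lemma shift_diff_add_le:
  assumes [measurable]: "F \<in> borel_measurable borel" "G \<in> borel_measurable borel"
  shows "shift_diff (\<lambda>x. F x + G x) h \<le> shift_diff F h + shift_diff G h"
proof -
  have "shift_diff (\<lambda>x. F x + G x) h \<le> (\<integral>\<^sup>+x. ennreal \<bar>F (x + h) - F x\<bar> + ennreal \<bar>G (x + h) - G x\<bar> \<partial>lborel)"
    unfolding shift_diff_def by (intro nn_integral_mono) (simp add: ennreal_leI flip: ennreal_plus)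
  also have "\<dots> = shift_diff F h + shift_diff G h"
    unfolding shift_diff_def by (rule nn_integral_add) measurable
  finally show ?thesis .
qed

text \<open>
  A point of an open set stays in it under small translations, so the part of \<open>U\<close> that leaves \<open>U\<close> under
  translation by \<open>h\<close> has measure tending to zero, by dominated convergence. The part that enters \<open>U\<close> is
  a translate of the part that leaves under translation by \<open>- h\<close>.
\<close>

lemma shift_diff_indicator_open:
  assumes U: "open U" "emeasure lborel U < \<infinity>" and h: "h \<longlonglongrightarrow> (0 :: real)"
  shows "(\<lambda>n. shift_diff (indicator U) (h n)) \<longlonglongrightarrow> 0"
proof -
  have [measurable]: "U \<in> sets borel" using U(1) by (rule borel_open)
  define p where "p h = (\<integral>\<^sup>+x. indicator {x \<in> U. x + h \<notin> U} x \<partial>lborel)" for h :: real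
  have p_lim: "(\<lambda>n. p (h n)) \<longlonglongrightarrow> 0" if h: "h \<longlonglongrightarrow> 0" for h :: "nat \<Rightarrow> real"
  proof -
    have "(\<lambda>n. p (h n)) \<longlonglongrightarrow> (\<integral>\<^sup>+x. 0 \<partial>(lborel :: real measure))"
      unfolding p_def
    proof (rule nn_integral_dominated_convergence)
      show "(\<integral>\<^sup>+x. indicator U x \<partial>lborel) < \<infinity>" using U(2) by simp
      show "AE x in lborel. (\<lambda>n. indicator {x \<in> U. x + h n \<notin> U} x) \<longlonglongrightarrow> (0 :: ennreal)"
      proof (rule AE_I2)
        fix x
        have "eventually (\<lambda>n. x + h n \<in> U) sequentially" if "x \<in> U"
        proof -
          have "(\<lambda>n. x + h n) \<longlonglongrightarrow> x" using tendsto_add[OF tendsto_const h, of x] by simp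
          then show ?thesis using U(1) that by (rule topological_tendstoD)
        qed
        then have "eventually (\<lambda>n. indicator {x \<in> U. x + h n \<notin> U} x = (0 :: ennreal)) sequentially"
          by (cases "x \<in> U") (auto elim: eventually_mono)
        then show "(\<lambda>n. indicator {x \<in> U. x + h n \<notin> U} x) \<longlonglongrightarrow> (0 :: ennreal)" by (rule tendsto_eventually)
      qed
    qed (auto simp: indicator_def)
    then show ?thesis by simp
  qed
  have "shift_diff (indicator U) h = p h + p (- h)" for h
  proof -
    have "shift_diff (indicator U) h = (\<integral>\<^sup>+x. indicator {x \<in> U. x + h \<notin> U} x + indicator {x \<in> U. x - h \<notin> U} (x + h) \<partial>lborel)"
      unfolding shift_diff_def by (intro nn_integral_cong) (auto simp: indicator_def)
    also have "\<dots> = p h + (\<integral>\<^sup>+x. indicator {x \<in> U. x - h \<notin> U} (x + h) \<partial>lborel)"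
      unfolding p_def by (rule nn_integral_add) measurable
    also have "(\<integral>\<^sup>+x. indicator {x \<in> U. x - h \<notin> U} (x + h) \<partial>lborel) = p (- h)"
      unfolding p_def by (subst nn_integral_shift) simp_all
    finally show ?thesis .
  qed
  moreover have "(\<lambda>n. p (h n) + p (- h n)) \<longlonglongrightarrow> 0 + 0"
    using tendsto_minus[OF h] by (intro tendsto_add p_lim h) simp
  ultimately show ?thesis by simp
qed

text \<open>
  Translation is continuous in \<open>L\<^sup>1\<close>. Indicators of Borel sets are handled by approximating the set
  from outside by an open set; the general case follows by linearity and density.
\<close>

lemma shift_diff_tendsto_zero:
  assumes F: "integrable lborel F" and h: "h \<longlonglongrightarrow> 0"
  shows "(\<lambda>n. shift_diff F (h n)) \<longlonglongrightarrow> 0"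
  using F
proof (induction F rule: integrable_induct)
  case (base A c)
  then have [measurable]: "A \<in> sets borel" by simp
  have one: "(\<lambda>n. shift_diff (indicator A) (h n)) \<longlonglongrightarrow> 0"
  proof (rule tendsto_zero_ennrealI)
    fix d :: real assume d: "0 < d"
    obtain U where U: "open U" "A \<subseteq> U" "emeasure lebesgue (U - A) < ennreal (d / 4)"
      using sets_lebesgue_outer_open[of A "d / 4"] d by (metis \<open>A \<in> sets borel\<close> divide_pos_pos sets_completionI_sets sets_lborel zero_less_numeral)
    have [measurable]: "U \<in> sets borel" using U(1) by (rule borel_open)
    have small: "emeasure lborel (U - A) \<le> ennreal (d / 4)" using U(3) by (simp add: less_imp_le)
    have "emeasure lborel U \<le> emeasure lborel A + emeasure lborel (U - A)"
      using U(2) by (intro order_trans[OF emeasure_mono emeasure_subadditive[of A lborel "U - A"]]) auto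
    also have "\<dots> < \<infinity>" using base(2) small by (auto simp: less_top intro: le_less_trans)
    finally have Ufin: "emeasure lborel U < \<infinity>" .
    have "eventually (\<lambda>n. shift_diff (indicator U) (h n) < ennreal (d / 2)) sequentially"
      using shift_diff_indicator_open[OF U(1) Ufin h] by (rule order_tendstoD) (use d in simp)
    then show "eventually (\<lambda>n. shift_diff (indicator A) (h n) \<le> ennreal d) sequentially"
    proof eventually_elim
      case (elim n)
      \<comment> \<open>The two summands are small for different reasons: the first by continuity, the second by its norm.\<close>
      have eq: "indicator A = (\<lambda>x. indicator U x + - indicator (U - A) x :: real)"
        by (rule ext) (use U(2) in \<open>auto simp: indicator_def\<close>)
      have "shift_diff (indicator A) (h n) \<le> shift_diff (indicator U) (h n) + shift_diff (\<lambda>x. - indicator (U - A) x) (h n)"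
        unfolding eq by (rule shift_diff_add_le) measurable
      also have "\<dots> \<le> ennreal (d / 2) + 2 * (\<integral>\<^sup>+x. ennreal \<bar>- indicator (U - A) x\<bar> \<partial>(lborel :: real measure))"
        using elim by (intro add_mono shift_diff_le) (auto simp: less_imp_le)
      also have "(\<integral>\<^sup>+x. ennreal \<bar>- indicator (U - A) x\<bar> \<partial>(lborel :: real measure)) = emeasure lborel (U - A)"
      proof -
        have "(\<integral>\<^sup>+x. ennreal \<bar>- indicator (U - A) x\<bar> \<partial>(lborel :: real measure)) = (\<integral>\<^sup>+x. indicator (U - A) x \<partial>lborel)"
          by (intro nn_integral_cong) (auto simp: indicator_def)
        then show ?thesis by simp
      qed
      also have "ennreal (d / 2) + 2 * emeasure lborel (U - A) \<le> ennreal (d / 2) + 2 * ennreal (d / 4)"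
        using small by (intro add_left_mono mult_left_mono) auto
      also have "\<dots> = ennreal d" using d by (simp add: ennreal_plus[symmetric] mult_2 del: ennreal_plus)
      finally show ?case .
    qed
  qed
  have "shift_diff (\<lambda>x. indicator A x *\<^sub>R c) k = ennreal \<bar>c\<bar> * shift_diff (indicator A) k" for k
  proof -
    have "ennreal \<bar>indicator A (x + k) *\<^sub>R c - indicator A x *\<^sub>R c\<bar> = ennreal \<bar>c\<bar> * ennreal \<bar>indicator A (x + k) - indicator A x\<bar>" for x
    proof -
      have "indicator A (x + k) *\<^sub>R c - indicator A x *\<^sub>R c = c * (indicator A (x + k) - indicator A x)"
        by (simp add: algebra_simps)
      then show ?thesis by (simp only: abs_mult ennreal_mult abs_ge_zero)
    qed
    then have "shift_diff (\<lambda>x. indicator A x *\<^sub>R c) k = (\<integral>\<^sup>+x. ennreal \<bar>c\<bar> * ennreal \<bar>indicator A (x + k) - indicator A x\<bar> \<partial>lborel)"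
      unfolding shift_diff_def by (rule nn_integral_cong)
    also have "\<dots> = ennreal \<bar>c\<bar> * shift_diff (indicator A) k"
      unfolding shift_diff_def by (rule nn_integral_cmult) measurable
    finally show ?thesis .
  qed
  then show ?case using ennreal_tendsto_cmult[OF _ one, of "ennreal \<bar>c\<bar>"] by simp
next
  case (add f g)
  have le: "shift_diff (\<lambda>x. f x + g x) (h n) \<le> shift_diff f (h n) + shift_diff g (h n)" for n
    using borel_measurable_integrable[OF add.hyps(1)] borel_measurable_integrable[OF add.hyps(2)]
    by (intro shift_diff_add_le) simp_all
  have lim: "(\<lambda>n. shift_diff f (h n) + shift_diff g (h n)) \<longlonglongrightarrow> 0" using tendsto_add[OF add.IH] by simp
  show ?case
    by (rule tendsto_sandwich[OF _ _ tendsto_const lim]) (simp_all add: le)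
next
  case (lim f s)
  have [measurable]: "f \<in> borel_measurable borel" "s i \<in> borel_measurable borel" for i
    using lim by (auto dest: borel_measurable_integrable)
  have conv: "(\<lambda>i. \<integral>\<^sup>+x. ennreal (norm (f x - s i x)) \<partial>lborel) \<longlonglongrightarrow> 0"
  proof (rule nn_integral_dominated_convergence_norm)
    show "(\<integral>\<^sup>+x. ennreal (2 * norm (f x)) \<partial>lborel) < \<infinity>"
    proof -
      have "(\<integral>\<^sup>+x. ennreal (2 * norm (f x)) \<partial>lborel) = 2 * (\<integral>\<^sup>+x. ennreal (norm (f x)) \<partial>lborel)"
        by (subst nn_integral_cmult[symmetric]) (auto simp: ennreal_mult)
      then show ?thesis using lim.hyps(4) by (simp add: integrable_iff_bounded ennreal_mult_less_top)
    qed
  qed (use lim in auto)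
  show ?case
  proof (rule tendsto_zero_ennrealI)
    fix d :: real assume d: "0 < d"
    have "eventually (\<lambda>i. (\<integral>\<^sup>+x. ennreal (norm (f x - s i x)) \<partial>lborel) < ennreal (d / 4)) sequentially"
      using conv by (rule order_tendstoD) (use d in simp)
    then obtain i where i: "(\<integral>\<^sup>+x. ennreal (norm (f x - s i x)) \<partial>lborel) < ennreal (d / 4)"
      by (auto simp: eventually_sequentially)
    have "eventually (\<lambda>n. shift_diff (s i) (h n) < ennreal (d / 2)) sequentially"
      using lim.IH by (rule order_tendstoD) (use d in simp)
    then show "eventually (\<lambda>n. shift_diff f (h n) \<le> ennreal d) sequentially"
    proof eventually_elim
      case (elim n)
      have "shift_diff f (h n) \<le> shift_diff (s i) (h n) + shift_diff (\<lambda>x. f x - s i x) (h n)"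
        using shift_diff_add_le[of "s i" "\<lambda>x. f x - s i x" "h n"] by simp
      also have "\<dots> \<le> ennreal (d / 2) + 2 * (\<integral>\<^sup>+x. ennreal \<bar>f x - s i x\<bar> \<partial>lborel)"
        using elim by (intro add_mono shift_diff_le) (auto simp: less_imp_le)
      also have "\<dots> \<le> ennreal (d / 2) + 2 * ennreal (d / 4)"
        using i by (intro add_left_mono mult_left_mono) (auto simp: less_imp_le)
      also have "\<dots> = ennreal d" using d by (simp add: ennreal_plus[symmetric] mult_2 del: ennreal_plus)
      finally show ?case .
    qed
  qed
qed

definition poisson_kernel :: "real \<Rightarrow> real \<Rightarrow> real" where
  "poisson_kernel t x = t / (pi * (t\<^sup>2 + x\<^sup>2))"

lemma poisson_kernel_measurable [measurable]: "poisson_kernel t \<in> borel_measurable borel"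
  unfolding poisson_kernel_def[abs_def] by measurable

lemma poisson_kernel_pos: "0 < t \<Longrightarrow> 0 < poisson_kernel t x"
  unfolding poisson_kernel_def by (intro divide_pos_pos mult_pos_pos add_pos_nonneg) auto

lemma poisson_kernel_le: "0 < t \<Longrightarrow> poisson_kernel t x \<le> 1 / (pi * t)"
proof -
  assume t: "0 < t"
  have "poisson_kernel t x \<le> t / (pi * t\<^sup>2)"
    unfolding poisson_kernel_def using t by (intro divide_left_mono mult_left_mono mult_pos_pos add_pos_nonneg) auto
  then show ?thesis using t by (simp add: power2_eq_square)
qed

lemma poisson_kernel_minus [simp]: "poisson_kernel t (- x) = poisson_kernel t x"
  by (simp add: poisson_kernel_def)

lemma nn_integral_arctan: "(\<integral>\<^sup>+x. ennreal (1 / (1 + x\<^sup>2)) * indicator {0..} x \<partial>lborel) = ennreal (pi / 2)"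
  using nn_integral_FTC_atLeast[of "\<lambda>x. 1 / (1 + x\<^sup>2)" 0 arctan "pi / 2"] tendsto_arctan_at_top
  by (simp add: DERIV_arctan[unfolded inverse_eq_divide])

text \<open>
  The primitive is the arc tangent; symmetry reduces the claim to the positive half-line.
\<close>

lemma nn_integral_poisson_kernel: "(\<integral>\<^sup>+x. ennreal (poisson_kernel 1 x) \<partial>lborel) = 1"
proof -
  let ?g = "\<lambda>x :: real. ennreal (1 / (1 + x\<^sup>2))"
  have "(\<integral>\<^sup>+x. ?g x \<partial>lborel) = (\<integral>\<^sup>+x. ?g x * indicator {0..} x + ?g x * indicator {..<0} x \<partial>lborel)"
    by (intro nn_integral_cong) (auto simp: indicator_def)
  also have "\<dots> = (\<integral>\<^sup>+x. ?g x * indicator {0..} x \<partial>lborel) + (\<integral>\<^sup>+x. ?g x * indicator {..<0} x \<partial>lborel)"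
    by (rule nn_integral_add) measurable
  also have "(\<integral>\<^sup>+x. ?g x * indicator {..<0} x \<partial>lborel) = (\<integral>\<^sup>+x. ?g (- x) * indicator {..<0} (- x) \<partial>lborel)"
    by (subst nn_integral_real_affine[where c = "-1" and t = 0]) auto
  also have "\<dots> = (\<integral>\<^sup>+x. ?g x * indicator {0..} x \<partial>lborel)"
  proof (rule nn_integral_cong_AE)
    have "AE x in lborel. x \<noteq> (0 :: real)" by (rule AE_lborel_singleton)
    then show "AE x in lborel. ?g (- x) * indicator {..<0} (- x) = ?g x * indicator {0..} x"
      by eventually_elim (auto simp: indicator_def)
  qed
  finally have "(\<integral>\<^sup>+x. ?g x \<partial>lborel) = ennreal pi"
    unfolding nn_integral_arctan by (simp flip: ennreal_plus)
  moreover have "(\<integral>\<^sup>+x. ennreal (poisson_kernel 1 x) \<partial>lborel) = (\<integral>\<^sup>+x. ennreal (1 / pi) * ?g x \<partial>lborel)"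
    by (intro nn_integral_cong) (simp add: poisson_kernel_def flip: ennreal_mult)
  moreover have "\<dots> = ennreal (1 / pi) * (\<integral>\<^sup>+x. ?g x \<partial>lborel)" by (rule nn_integral_cmult) measurable
  ultimately show ?thesis by (simp flip: ennreal_mult)
qed

definition poisson :: "(real \<Rightarrow> real) \<Rightarrow> real \<Rightarrow> real \<Rightarrow> real" where
  "poisson F t x = (LINT y|lborel. F y * poisson_kernel t (x - y))"

lemma integrable_mult_bounded:
  fixes F :: "real \<Rightarrow> 'a :: {real_normed_algebra, banach, second_countable_topology}"
  assumes F: "integrable lborel F" and [measurable]: "k \<in> borel_measurable borel" and k: "\<And>y. norm (k y) \<le> M"
  shows "integrable lborel (\<lambda>y. F y * k y)"
proof (rule Bochner_Integration.integrable_bound[OF integrable_mult_right[OF integrable_norm[OF F], of M]])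
  show "(\<lambda>y. F y * k y) \<in> borel_measurable lborel" using borel_measurable_integrable[OF F] by measurable
  have "norm (F y * k y) \<le> norm (F y) * M" for y
    using k by (intro order_trans[OF norm_mult_ineq] mult_left_mono) auto
  then show "AE y in lborel. norm (F y * k y) \<le> norm (M * norm (F y))"
    by (intro AE_I2) (metis abs_ge_self mult.commute order_trans real_norm_def)
qed

text \<open>
  In this form the kernel no longer depends on \<open>t\<close>, and \<open>t\<close> only enters through the size of the
  translation.
\<close>

lemma poisson_dilate:
  assumes t: "0 < t"
  shows "poisson F t x = (LINT s|lborel. F (x + - t * s) * poisson_kernel 1 s)"
proof -
  have "poisson F t x = \<bar>- t\<bar> *\<^sub>R (LINT s|lborel. F (x + - t * s) * poisson_kernel t (x - (x + - t * s)))"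
    unfolding poisson_def using t by (intro lborel_integral_real_affine) simp
  also have "\<dots> = (LINT s|lborel. t * (F (x + - t * s) * poisson_kernel t (x - (x + - t * s))))"
    using t by (simp add: integral_mult_right_zero)
  also have "\<dots> = (LINT s|lborel. F (x + - t * s) * poisson_kernel 1 s)"
  proof (rule Bochner_Integration.integral_cong[OF refl])
    fix s
    have "t\<^sup>2 + (t * s)\<^sup>2 = t\<^sup>2 * (1 + s\<^sup>2)" by (simp add: algebra_simps power_mult_distrib)
    then have "t * poisson_kernel t (t * s) = poisson_kernel 1 s"
      using t by (simp add: poisson_kernel_def power2_eq_square)
    then show "t * (F (x + - t * s) * poisson_kernel t (x - (x + - t * s))) = F (x + - t * s) * poisson_kernel 1 s"
      by (simp add: mult.left_commute)
  qed
  finally show ?thesis .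
qed

text \<open>
  The difference is an average of \<open>F(x - e s) - F(x)\<close> against a fixed probability density in \<open>s\<close>, so
  its \<open>L\<^sup>1\<close> norm is at most the corresponding average of the modulus of continuity.
\<close>

theorem poisson_L1_convergence:
  assumes F: "integrable lborel F" and e: "\<And>n. 0 < e n" "e \<longlonglongrightarrow> 0"
  shows "(\<lambda>n. \<integral>\<^sup>+x. ennreal \<bar>poisson F (e n) x - F x\<bar> \<partial>lborel) \<longlonglongrightarrow> 0"
proof (rule tendsto_sandwich[OF _ _ tendsto_const])
  let ?G = "\<lambda>n x s. F (x + - e n * s)"
  note [measurable] = borel_measurable_integrable[OF F, simplified]
  let ?I = "\<lambda>n. \<integral>\<^sup>+s. ennreal (poisson_kernel 1 s) * shift_diff F (- e n * s) \<partial>lborel"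
  have P1: "integrable lborel (poisson_kernel 1)"
    using nn_integral_poisson_kernel poisson_kernel_pos[of 1] by (intro integrableI_bounded) (auto simp: abs_of_pos)
  have P1i: "(LINT s|lborel. poisson_kernel 1 s) = 1"
    using nn_integral_poisson_kernel poisson_kernel_pos[of 1] P1
    by (subst (asm) nn_integral_eq_integral) (auto simp: less_imp_le)
  have "(\<integral>\<^sup>+x. ennreal \<bar>poisson F (e n) x - F x\<bar> \<partial>lborel) \<le> ?I n" for n
  proof -
    have "ennreal \<bar>poisson F (e n) x - F x\<bar> \<le> (\<integral>\<^sup>+s. ennreal (poisson_kernel 1 s) * ennreal \<bar>?G n x s - F x\<bar> \<partial>lborel)" for x
    proof -
      have i: "integrable lborel (\<lambda>s. ?G n x s * poisson_kernel 1 s)"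
        using lborel_integrable_real_affine[OF F, of "- e n" x] e(1)[of n] poisson_kernel_le[of 1] poisson_kernel_pos[of 1]
        by (intro integrable_mult_bounded[where M = "1 / (pi * 1)"]) (auto simp: abs_of_pos)
      have j: "integrable lborel (\<lambda>s. F x * poisson_kernel 1 s)" using P1 by simp
      have "poisson F (e n) x - F x = (LINT s|lborel. ?G n x s * poisson_kernel 1 s) - (LINT s|lborel. F x * poisson_kernel 1 s)"
        using poisson_dilate[OF e(1)] P1i by simp
      also have "\<dots> = (LINT s|lborel. ?G n x s * poisson_kernel 1 s - F x * poisson_kernel 1 s)"
        by (rule Bochner_Integration.integral_diff[OF i j, symmetric])
      finally have eq: "poisson F (e n) x - F x = (LINT s|lborel. ?G n x s * poisson_kernel 1 s - F x * poisson_kernel 1 s)" .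
      have "ennreal (norm (poisson F (e n) x - F x)) \<le> (\<integral>\<^sup>+s. ennreal (norm (?G n x s * poisson_kernel 1 s - F x * poisson_kernel 1 s)) \<partial>lborel)"
        unfolding eq by (intro integral_norm_bound_ennreal Bochner_Integration.integrable_diff i j)
      also have "\<dots> = (\<integral>\<^sup>+s. ennreal (poisson_kernel 1 s) * ennreal \<bar>?G n x s - F x\<bar> \<partial>lborel)"
      proof (rule nn_integral_cong)
        fix s
        have "norm (?G n x s * poisson_kernel 1 s - F x * poisson_kernel 1 s) = poisson_kernel 1 s * \<bar>?G n x s - F x\<bar>"
          using poisson_kernel_pos[of 1 s] by (simp add: abs_mult flip: left_diff_distrib)
        then show "ennreal (norm (?G n x s * poisson_kernel 1 s - F x * poisson_kernel 1 s)) = ennreal (poisson_kernel 1 s) * ennreal \<bar>?G n x s - F x\<bar>"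
          using poisson_kernel_pos[of 1 s] by (simp add: ennreal_mult)
      qed
      finally show ?thesis by simp
    qed
    then have "(\<integral>\<^sup>+x. ennreal \<bar>poisson F (e n) x - F x\<bar> \<partial>lborel)
        \<le> (\<integral>\<^sup>+x. (\<integral>\<^sup>+s. ennreal (poisson_kernel 1 s) * ennreal \<bar>?G n x s - F x\<bar> \<partial>lborel) \<partial>lborel)"
      by (intro nn_integral_mono)
    also have "\<dots> = (\<integral>\<^sup>+s. (\<integral>\<^sup>+x. ennreal (poisson_kernel 1 s) * ennreal \<bar>?G n x s - F x\<bar> \<partial>lborel) \<partial>lborel)"
      by (rule lborel_pair.Fubini') measurable
    also have "\<dots> = ?I n"
      unfolding shift_diff_def by (intro nn_integral_cong nn_integral_cmult) measurable
    finally show ?thesis .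
  qed
  then show "\<forall>\<^sub>F n in sequentially. (\<integral>\<^sup>+x. ennreal \<bar>poisson F (e n) x - F x\<bar> \<partial>lborel) \<le> ?I n"
    by (rule always_eventually[OF allI])
  have "?I \<longlonglongrightarrow> (\<integral>\<^sup>+s. 0 \<partial>(lborel :: real measure))"
  proof (rule nn_integral_dominated_convergence)
    let ?M = "2 * (\<integral>\<^sup>+x. ennreal \<bar>F x\<bar> \<partial>lborel)"
    show "(\<lambda>s. ennreal (poisson_kernel 1 s) * shift_diff F (- e n * s)) \<in> borel_measurable lborel" for n
      unfolding shift_diff_def by measurable
    show "AE s in lborel. ennreal (poisson_kernel 1 s) * shift_diff F (- e n * s) \<le> ennreal (poisson_kernel 1 s) * ?M" for n
      by (intro AE_I2 mult_left_mono shift_diff_le) auto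
    show "(\<integral>\<^sup>+s. ennreal (poisson_kernel 1 s) * ?M \<partial>lborel) < \<infinity>"
      using F by (subst nn_integral_multc) (auto simp: nn_integral_poisson_kernel integrable_iff_bounded ennreal_mult_less_top)
    show "AE s in lborel. (\<lambda>n. ennreal (poisson_kernel 1 s) * shift_diff F (- e n * s)) \<longlonglongrightarrow> 0"
    proof (rule AE_I2)
      fix s
      have "(\<lambda>n. - e n * s) \<longlonglongrightarrow> 0" using tendsto_mult_left_zero[OF tendsto_minus[OF e(2), simplified]] by simp
      from shift_diff_tendsto_zero[OF F this]
      show "(\<lambda>n. ennreal (poisson_kernel 1 s) * shift_diff F (- e n * s)) \<longlonglongrightarrow> 0"
        using ennreal_tendsto_cmult[of "ennreal (poisson_kernel 1 s)"] by force
    qed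
  qed measurable
  then show "?I \<longlonglongrightarrow> 0" by simp
qed auto

section \<open>Cauchy transforms and subordination\<close>

text \<open>
  Its real part is the Poisson integral of \<open>F\<close>, which makes the Cauchy integral theorem available for
  harmonic extensions.
\<close>

definition cauchy_transform :: "(real \<Rightarrow> real) \<Rightarrow> complex \<Rightarrow> complex" where
  "cauchy_transform F z = (LINT y|lborel. of_real (F y) * (\<i> / (of_real pi * (z - of_real y))))"

lemma Im_le_cmod_diff_of_real: "Im z \<le> cmod (z - of_real y)"
  using abs_Im_le_cmod[of "z - of_real y"] by simp

lemma integrable_of_real_mult_bounded:
  fixes F :: "real \<Rightarrow> real"
  assumes F: "integrable lborel F" and k: "k \<in> borel_measurable borel" "\<And>y. cmod (k y) \<le> M"
  shows "integrable lborel (\<lambda>y. complex_of_real (F y) * k y)"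
proof -
  have "integrable lborel (\<lambda>y. complex_of_real (F y))" using F by simp
  then show ?thesis using k by (rule integrable_mult_bounded)
qed

lemma integrable_cauchy_transform:
  assumes F: "integrable lborel F" and z: "0 < Im z"
  shows "integrable lborel (\<lambda>y. complex_of_real (F y) * (\<i> / (of_real pi * (z - of_real y))))"
proof (rule integrable_of_real_mult_bounded[OF F])
  show "cmod (\<i> / (of_real pi * (z - of_real y))) \<le> 1 / (pi * Im z)" for y
  proof -
    have "pi * Im z \<le> pi * cmod (z - of_real y)" by (intro mult_left_mono Im_le_cmod_diff_of_real) simp
    then have "1 / (pi * cmod (z - of_real y)) \<le> 1 / (pi * Im z)" using z by (intro frac_le) auto
    then show ?thesis by (simp add: norm_divide norm_mult)
  qed
qed measurable

text \<open>
  The error of the difference quotient of the Cauchy kernel, in a form that shows that it is of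
  order \<open>h\<close> uniformly in the integration variable.
\<close>

lemma cauchy_kernel_quotient:
  fixes a w h p :: complex
  assumes "w \<noteq> 0" "w + h \<noteq> 0" "h \<noteq> 0" "p \<noteq> 0"
  shows "(a * (\<i> / (p * (w + h))) - a * (\<i> / (p * w))) / h - a * (- \<i> / (p * w\<^sup>2))
    = a * (\<i> / p) * (h / ((w + h) * w\<^sup>2))"
proof -
  have "1 / (w + h) - 1 / w = - (h / ((w + h) * w))" using assms by (simp add: divide_simps)
  then have 1: "(1 / (w + h) - 1 / w) / h = - (1 / ((w + h) * w))" using assms(3) by simp
  have 2: "1 / w\<^sup>2 = (w + h) / ((w + h) * w\<^sup>2)" "1 / ((w + h) * w) = w / ((w + h) * w\<^sup>2)"
    using assms by (simp_all add: power2_eq_square)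
  have "(1 / (w + h) - 1 / w) / h + 1 / w\<^sup>2 = h / ((w + h) * w\<^sup>2)"
  proof -
    have "- (w / X) + (w + h) / X = h / X" for X by (simp add: add_divide_distrib)
    then show ?thesis unfolding 1 2 .
  qed
  moreover have "(a * (\<i> / (p * (w + h))) - a * (\<i> / (p * w))) / h - a * (- \<i> / (p * w\<^sup>2))
      = a * (\<i> / p) * ((1 / (w + h) - 1 / w) / h + 1 / w\<^sup>2)"
  proof -
    have A: "a * (\<i> / (p * X)) = a * (\<i> / p) * (1 / X)" "a * (- \<i> / (p * X)) = - (a * (\<i> / p) * (1 / X))" for X
      by simp_all
    have "(c * u - c * v) / h - - (c * s) = c * ((u - v) / h + s)" for c u v s
      by (simp add: distrib_left right_diff_distrib diff_divide_distrib)
    then show ?thesis unfolding A .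
  qed
  ultimately show ?thesis by simp
qed

lemma holomorphic_cauchy_transform:
  assumes F: "integrable lborel F"
  shows "cauchy_transform F holomorphic_on {z. 0 < Im z}"
proof -
  have "\<exists>D. (cauchy_transform F has_field_derivative D) (at z)" if z: "0 < Im z" for z
  proof -
    define \<eta> where "\<eta> = Im z"
    have \<eta>: "0 < \<eta>" using z by (simp add: \<eta>_def)
    define D where "D = (LINT y|lborel. complex_of_real (F y) * (- \<i> / (of_real pi * (z - of_real y)\<^sup>2)))"
    define K where "K = 2 / (pi * \<eta> ^ 3) * (LINT y|lborel. \<bar>F y\<bar>)"
  let ?Q = "\<lambda>h. (cauchy_transform F (z + h) - cauchy_transform F z) / h"
    have w: "\<eta> \<le> cmod (z - of_real y)" for y using Im_le_cmod_diff_of_real[of z y] by (simp add: \<eta>_def)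
    have iD: "integrable lborel (\<lambda>y. complex_of_real (F y) * (- \<i> / (of_real pi * (z - of_real y)\<^sup>2)))"
    proof (rule integrable_of_real_mult_bounded[OF F])
      show "cmod (- \<i> / (of_real pi * (z - of_real y)\<^sup>2)) \<le> 1 / (pi * \<eta>\<^sup>2)" for y
      proof -
        have "pi * \<eta>\<^sup>2 \<le> pi * (cmod (z - of_real y))\<^sup>2" using \<eta> w[of y] by (intro mult_left_mono power_mono) auto
        then have "1 / (pi * (cmod (z - of_real y))\<^sup>2) \<le> 1 / (pi * \<eta>\<^sup>2)" using \<eta> by (intro frac_le) auto
        then show ?thesis by (simp add: norm_divide norm_mult norm_power)
      qed
    qed measurable
    have "cmod (?Q h - D) \<le> K * cmod h"
      if h: "h \<noteq> 0" "cmod h < \<eta> / 2" for h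
    proof -
      have zh: "0 < Im (z + h)" using h(2) abs_Im_le_cmod[of h] \<eta> by (simp add: \<eta>_def)
      have wh: "\<eta> / 2 \<le> cmod (z + h - of_real y)" for y
        using Im_le_cmod_diff_of_real[of "z + h" y] h(2) abs_Im_le_cmod[of h] by (simp add: \<eta>_def)
      note i = integrable_cauchy_transform[OF F zh] integrable_cauchy_transform[OF F z]
      let ?q = "\<lambda>y. (complex_of_real (F y) * (\<i> / (of_real pi * (z + h - of_real y))) - complex_of_real (F y) * (\<i> / (of_real pi * (z - of_real y)))) / h
          - complex_of_real (F y) * (- \<i> / (of_real pi * (z - of_real y)\<^sup>2))"
      have iq: "integrable lborel ?q"
        by (intro Bochner_Integration.integrable_diff integrable_divide i iD)
      have eq: "?Q h - D = (LINT y|lborel. ?q y)"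
        unfolding cauchy_transform_def D_def
        by (simp only: Bochner_Integration.integral_diff[OF integrable_divide[OF Bochner_Integration.integrable_diff[OF i]] iD]
            integral_divide_zero Bochner_Integration.integral_diff[OF i])
      have "cmod (?Q h - D) \<le> (LINT y|lborel. cmod (?q y))"
        unfolding eq by (rule integral_norm_bound)
      also have "\<dots> \<le> (LINT y|lborel. (2 / (pi * \<eta> ^ 3) * cmod h) * \<bar>F y\<bar>)"
      proof (rule integral_mono)
        show "integrable lborel (\<lambda>y. cmod (?q y))" by (rule integrable_norm[OF iq])
        show "integrable lborel (\<lambda>y. (2 / (pi * \<eta> ^ 3) * cmod h) * \<bar>F y\<bar>)"
          by (rule integrable_mult_right[OF integrable_abs[OF F]])
        fix y
        let ?w = "z - of_real y"
        have e: "z + h - of_real y = ?w + h" by simp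
        have pos: "0 < cmod ?w" "0 < cmod (?w + h)" using w[of y] wh[of y] \<eta> unfolding e by linarith+
        then have nz: "?w \<noteq> 0" "?w + h \<noteq> 0" by auto
        have "?q y = of_real (F y) * (\<i> / of_real pi) * (h / ((?w + h) * ?w\<^sup>2))"
          unfolding e by (rule cauchy_kernel_quotient) (use nz h(1) in auto)
        then have "cmod (?q y) = \<bar>F y\<bar> * (1 / pi) * (cmod h / (cmod (?w + h) * (cmod ?w)\<^sup>2))"
          by (simp add: norm_mult norm_divide norm_power)
        also have "\<dots> \<le> \<bar>F y\<bar> * (1 / pi) * (cmod h / (\<eta> / 2 * \<eta>\<^sup>2))"
        proof (rule mult_left_mono[OF frac_le])
          show "\<eta> / 2 * \<eta>\<^sup>2 \<le> cmod (?w + h) * (cmod ?w)\<^sup>2"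
            using wh[of y] w[of y] \<eta> unfolding e by (intro mult_mono power_mono) auto
        qed (use \<eta> in auto)
        also have "\<dots> = (2 / (pi * \<eta> ^ 3) * cmod h) * \<bar>F y\<bar>" by (simp add: power2_eq_square power3_eq_cube mult_ac)
        finally show "cmod (?q y) \<le> (2 / (pi * \<eta> ^ 3) * cmod h) * \<bar>F y\<bar>" .
      qed
      also have "\<dots> = K * cmod h" by (simp add: K_def)
      finally show ?thesis .
    qed
    then have ev: "eventually (\<lambda>h. cmod (?Q h - D) \<le> K * cmod h) (at 0)"
      unfolding eventually_at using \<eta> by (intro exI[of _ "\<eta> / 2"]) (auto simp: dist_norm)
    have "((\<lambda>h. K * cmod h) \<longlongrightarrow> 0) (at 0)"
      by (intro tendsto_mult_right_zero tendsto_norm_zero tendsto_ident_at)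
    from Lim_null_comparison[OF ev this]
    have "((\<lambda>h. ?Q h) \<longlongrightarrow> D) (at 0)"
      by (rule LIM_zero_cancel)
    then show ?thesis unfolding DERIV_def by blast
  qed
  then show ?thesis
    by (intro holomorphic_onI) (auto simp: field_differentiable_def intro: has_field_derivative_at_within)
qed

lemma Re_cauchy_transform:
  assumes F: "integrable lborel F" and z: "0 < Im z"
  shows "Re (cauchy_transform F z) = poisson F (Im z) (Re z)"
proof -
  have "Re (cauchy_transform F z) = (LINT y|lborel. Re (of_real (F y) * (\<i> / (of_real pi * (z - of_real y)))))"
    unfolding cauchy_transform_def by (rule integral_Re[symmetric]) (rule integrable_cauchy_transform[OF assms])
  also have "\<dots> = poisson F (Im z) (Re z)"
    unfolding poisson_def
  proof (rule Bochner_Integration.integral_cong[OF refl])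
    fix y
    have "\<i> / (of_real pi * (z - of_real y)) = (\<i> / (z - of_real y)) / of_real pi" by simp
    moreover have "Re (\<i> / (z - of_real y)) = Im z / ((Im z)\<^sup>2 + (Re z - y)\<^sup>2)"
      by (simp add: Re_divide cmod_power2 add.commute power2_eq_square)
    ultimately have "Re (\<i> / (of_real pi * (z - of_real y))) = poisson_kernel (Im z) (Re z - y)"
      by (simp only: Re_divide_of_real) (simp add: poisson_kernel_def mult.commute)
    then show "Re (of_real (F y) * (\<i> / (of_real pi * (z - of_real y)))) = F y * poisson_kernel (Im z) (Re z - y)"
      by (simp only: times_complex.sel Re_complex_of_real Im_complex_of_real mult_zero_left diff_zero)
  qed
  finally show ?thesis .
qed

text \<open>
  For \<open>c = 1 + x\<^sup>2 / t\<^sup>2\<close> these functions of \<open>r\<close> integrate to the Poisson kernel, while pointwise they are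
  Gaussian weights times the Gauss kernel at time \<open>t\<^sup>2 / (4 r\<^sup>2)\<close>. This is the subordination formula
  after the substitution that makes the weight Gaussian.
\<close>

definition subordinator :: "real \<Rightarrow> real \<Rightarrow> real \<Rightarrow> real" where
  "subordinator t c r = indicator {0..} r * (2 * r / (pi * t) * exp (- c * r\<^sup>2))"

lemma subordinator_measurable [measurable]: "(\<lambda>(c, r). subordinator t c r) \<in> borel_measurable (borel \<Otimes>\<^sub>M borel)"
  unfolding subordinator_def by measurable

lemma has_bochner_integral_subordinator:
  assumes t: "0 < t" and c: "0 < c"
  shows "has_bochner_integral lborel (subordinator t c) (1 / (pi * t * c))"
proof (rule has_bochner_integral_nn_integral)
  show "subordinator t c \<in> borel_measurable lborel" unfolding subordinator_def by measurable
  show "AE r in lborel. 0 \<le> subordinator t c r"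
    using t by (intro AE_I2) (auto simp: subordinator_def indicator_def)
  show "0 \<le> 1 / (pi * t * c)" using t c by simp
  have lim: "((\<lambda>r. - exp (- c * r\<^sup>2) / (pi * t * c)) \<longlongrightarrow> 0) at_top"
  proof -
    have "filterlim (\<lambda>r :: real. r\<^sup>2) at_top at_top" by (rule filterlim_pow_at_top) (auto intro: filterlim_ident)
    then have "filterlim (\<lambda>r. - c * r\<^sup>2) at_bot at_top"
      using c by (intro filterlim_tendsto_neg_mult_at_bot[OF tendsto_const]) auto
    then have "((\<lambda>r. exp (- c * r\<^sup>2)) \<longlongrightarrow> 0) at_top" by (rule filterlim_compose[OF exp_at_bot])
    then have "((\<lambda>r. exp (- c * r\<^sup>2) * (- 1 / (pi * t * c))) \<longlongrightarrow> 0) at_top" by (rule tendsto_mult_left_zero)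
    then show ?thesis by simp
  qed
  have "(\<integral>\<^sup>+r. ennreal (2 * r / (pi * t) * exp (- c * r\<^sup>2)) * indicator {0..} r \<partial>lborel) = 0 - (- exp (- c * 0\<^sup>2) / (pi * t * c))"
  proof (rule nn_integral_FTC_atLeast[OF _ _ _ lim])
    fix r :: real
    show "((\<lambda>r. - exp (- c * r\<^sup>2) / (pi * t * c)) has_real_derivative 2 * r / (pi * t) * exp (- c * r\<^sup>2)) (at r)"
      using c t by (auto intro!: derivative_eq_intros simp: field_simps)
    show "0 \<le> 2 * r / (pi * t) * exp (- c * r\<^sup>2)" if "0 \<le> r" using that t by simp
  qed measurable
  moreover have "(\<integral>\<^sup>+r. ennreal (subordinator t c r) \<partial>lborel) = (\<integral>\<^sup>+r. ennreal (2 * r / (pi * t) * exp (- c * r\<^sup>2)) * indicator {0..} r \<partial>lborel)"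
    by (intro nn_integral_cong) (auto simp: subordinator_def indicator_def)
  ultimately show "(\<integral>\<^sup>+r. ennreal (subordinator t c r) \<partial>lborel) = ennreal (1 / (pi * t * c))" by simp
qed

lemma poisson_kernel_eq_subordinator:
  assumes t: "0 < t"
  shows "poisson_kernel t x = (LINT r|lborel. subordinator t (1 + x\<^sup>2 / t\<^sup>2) r)"
proof -
  have "0 < 1 + x\<^sup>2 / t\<^sup>2" by (simp add: add_pos_nonneg)
  from has_bochner_integral_integral_eq[OF has_bochner_integral_subordinator[OF t this]]
  have "(LINT r|lborel. subordinator t (1 + x\<^sup>2 / t\<^sup>2) r) = 1 / (pi * t * (1 + x\<^sup>2 / t\<^sup>2))" .
  also have "t * (1 + x\<^sup>2 / t\<^sup>2) = (t\<^sup>2 + x\<^sup>2) / t" using t by (simp add: field_simps power2_eq_square)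
  then have "1 / (pi * t * (1 + x\<^sup>2 / t\<^sup>2)) = poisson_kernel t x"
    by (simp add: poisson_kernel_def mult.assoc)
  finally show ?thesis by simp
qed

text \<open>
  The difference of two Gauss kernels is the Dirichlet heat kernel.
\<close>

lemma subordinator_dirichlet_kernel:
  assumes t: "0 < t" and r: "0 < r"
  shows "subordinator t (1 + (x - y)\<^sup>2 / t\<^sup>2) r - subordinator t (1 + (x + y)\<^sup>2 / t\<^sup>2) r
    = 2 / sqrt pi * exp (- r\<^sup>2) * dirichlet_kernel (t\<^sup>2 / (4 * r\<^sup>2)) x y"
proof -
  have e: "exp (- (1 + a / t\<^sup>2) * r\<^sup>2) = exp (- r\<^sup>2) * exp (- a / (4 * (t\<^sup>2 / (4 * r\<^sup>2))))" for a
    using t r by (simp add: field_simps flip: exp_add)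
  have p1: "4 * pi * (t\<^sup>2 / (4 * r\<^sup>2)) = pi * (t / r)\<^sup>2" using r by (simp add: power_divide)
  have "(pi * (t / r)\<^sup>2) powr (-1/2) = 1 / sqrt (pi * (t / r)\<^sup>2)"
    using t r by (simp add: powr_minus_divide powr_half_sqrt)
  also have "\<dots> = r / (sqrt pi * t)" using t r by (simp add: real_sqrt_mult)
  finally have p: "(4 * pi * (t\<^sup>2 / (4 * r\<^sup>2))) powr (-1/2) = r / (sqrt pi * t)" unfolding p1 .
  have q: "2 * r / (pi * t) = 2 / sqrt pi * (r / (sqrt pi * t))" using t by (simp add: field_simps)
  show ?thesis
    unfolding subordinator_def dirichlet_kernel_def p e q using r by (simp add: algebra_simps)
qed

text \<open>
  The exact value is one, but comparison of \<open>exp (- r\<^sup>2)\<close> with \<open>1 / (1 + r\<^sup>2)\<close> is simpler and sufficient.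
\<close>

lemma nn_integral_gauss_le: "(\<integral>\<^sup>+r. ennreal (2 / sqrt pi * exp (- r\<^sup>2)) * indicator {0..} r \<partial>lborel) \<le> 2"
proof -
  have "exp (- r\<^sup>2) \<le> 1 / (1 + r\<^sup>2)" for r :: real
    using exp_ge_add_one_self[of "r\<^sup>2"] by (simp add: exp_minus divide_simps add_pos_nonneg)
  then have "ennreal (2 / sqrt pi * exp (- r\<^sup>2)) \<le> ennreal (2 / sqrt pi) * ennreal (1 / (1 + r\<^sup>2))" for r :: real
    by (subst ennreal_mult[symmetric]) (auto intro!: ennreal_leI mult_left_mono simp del: times_divide_eq_left times_divide_eq_right)
  then have "(\<integral>\<^sup>+r. ennreal (2 / sqrt pi * exp (- r\<^sup>2)) * indicator {0..} r \<partial>lborel)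
      \<le> (\<integral>\<^sup>+r. ennreal (2 / sqrt pi) * (ennreal (1 / (1 + r\<^sup>2)) * indicator {0..} r) \<partial>lborel)"
    by (intro nn_integral_mono) (simp only: mult.assoc[symmetric] mult_right_mono zero_le)
  also have "\<dots> = ennreal (2 / sqrt pi) * (\<integral>\<^sup>+r. ennreal (1 / (1 + r\<^sup>2)) * indicator {0..} r \<partial>lborel)"
    by (rule nn_integral_cmult) measurable
  also have "\<dots> = ennreal (sqrt pi)"
    unfolding nn_integral_arctan by (simp add: real_div_sqrt flip: ennreal_mult)
  also have "\<dots> \<le> ennreal 2"
    using pi_less_4 real_sqrt_le_mono[of pi 4] by (intro ennreal_leI) simp
  finally show ?thesis by simp
qed

text \<open>
  By subordination the Poisson integral of the odd extension is a Gaussian average of values of the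
  heat semigroup at the same point \<open>x\<close>, each of which is at most the maximal function.
\<close>

theorem poisson_le_maximal_function:
  assumes f: "integrable half_line f" and t: "0 < t"
  shows "ennreal (norm (LINT y|lborel. of_real (poisson_kernel t (x - y) - poisson_kernel t (x + y)) * zero_ext f y)) \<le> 2 * maximal_function f x"
proof -
  let ?k = "\<lambda>y. of_real (poisson_kernel t (x - y) - poisson_kernel t (x + y))"
  let ?w = "\<lambda>r. 2 / sqrt pi * exp (- r\<^sup>2)"
  have f0: "integrable lborel (zero_ext f)" using f by (simp add: integrable_zero_ext)
  note [measurable] = borel_measurable_integrable[OF f0, simplified]
  let ?c1 = "\<lambda>y. 1 + (x - y)\<^sup>2 / t\<^sup>2" and ?c2 = "\<lambda>y. 1 + (x + y)\<^sup>2 / t\<^sup>2"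
  let ?d = "\<lambda>y r. subordinator t (?c1 y) r - subordinator t (?c2 y) r"
  let ?g = "\<lambda>y r. of_real (?d y r) * zero_ext f y"
  have c: "0 < ?c1 y" "0 < ?c2 y" for y by (simp_all add: add_pos_nonneg)
  have isub: "integrable lborel (subordinator t (?c1 y))" "integrable lborel (subordinator t (?c2 y))" for y
    using has_bochner_integral_subordinator[OF t c(1)] has_bochner_integral_subordinator[OF t c(2)]
    by (auto simp: has_bochner_integral_iff)
  have id: "integrable lborel (?d y)" for y by (intro Bochner_Integration.integrable_diff isub)
  have ig: "integrable lborel (?g y)" for y
    using id[of y] by (intro integrable_mult_left integrable_of_real)
  have Pd: "poisson_kernel t (x - y) - poisson_kernel t (x + y) = (LINT r|lborel. ?d y r)" for y
    unfolding poisson_kernel_eq_subordinator[OF t] by (rule Bochner_Integration.integral_diff[symmetric]) (rule isub)+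
  have int_abs: "(LINT r|lborel. \<bar>?d y r\<bar>) \<le> 2 / (pi * t)" for y
  proof -
    have nn: "0 \<le> subordinator t k r" for k r using t by (auto simp: subordinator_def indicator_def)
    have le: "(LINT r|lborel. subordinator t (1 + a\<^sup>2 / t\<^sup>2) r) \<le> 1 / (pi * t)" for a
      unfolding poisson_kernel_eq_subordinator[OF t, symmetric] by (rule poisson_kernel_le[OF t])
    have "(LINT r|lborel. \<bar>?d y r\<bar>) \<le> (LINT r|lborel. subordinator t (?c1 y) r + subordinator t (?c2 y) r)"
      using nn[of "?c1 y"] nn[of "?c2 y"]
      by (intro integral_mono integrable_abs id Bochner_Integration.integrable_add isub) (smt (verit))
    also have "\<dots> = (LINT r|lborel. subordinator t (?c1 y) r) + (LINT r|lborel. subordinator t (?c2 y) r)"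
      by (rule Bochner_Integration.integral_add) (rule isub)+
    finally show ?thesis using le[of "x - y"] le[of "x + y"] by simp
  qed
  have prod: "integrable (lborel \<Otimes>\<^sub>M lborel) (\<lambda>(y, r). ?g y r)"
  proof (rule lborel_pair.Fubini_integrable)
    show "(\<lambda>(y, r). ?g y r) \<in> borel_measurable (lborel \<Otimes>\<^sub>M lborel)" by measurable
    show "AE y in lborel. integrable lborel (\<lambda>r. case (y, r) of (y, r) \<Rightarrow> ?g y r)" using ig by simp
    show "integrable lborel (\<lambda>y. LINT r|lborel. norm (case (y, r) of (y, r) \<Rightarrow> ?g y r))"
    proof (rule Bochner_Integration.integrable_bound[OF integrable_mult_right[OF integrable_norm[OF f0], of "2 / (pi * t)"]])
      show "(\<lambda>y. LINT r|lborel. norm (case (y, r) of (y, r) \<Rightarrow> ?g y r)) \<in> borel_measurable lborel" by measurable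
      have "norm (LINT r|lborel. norm (?g y r)) \<le> norm (2 / (pi * t) * norm (zero_ext f y))" for y
      proof -
        have "(LINT r|lborel. norm (?g y r)) = (LINT r|lborel. \<bar>?d y r\<bar>) * norm (zero_ext f y)"
          by (simp add: norm_mult flip: of_real_diff)
        also have "\<dots> \<le> 2 / (pi * t) * norm (zero_ext f y)" by (intro mult_right_mono int_abs) simp
        finally have "(LINT r|lborel. norm (?g y r)) \<le> 2 / (pi * t) * norm (zero_ext f y)" .
        moreover have "0 \<le> (LINT r|lborel. norm (?g y r))" by (rule Bochner_Integration.integral_nonneg) simp
        ultimately show ?thesis by (simp only: real_norm_def abs_of_nonneg order_trans[OF _ abs_ge_self])
      qed
      then show "AE y in lborel. norm (LINT r|lborel. norm (case (y, r) of (y, r) \<Rightarrow> ?g y r)) \<le> norm (2 / (pi * t) * norm (zero_ext f y))"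
        by simp
    qed
  qed
  have slice: "(LINT y|lborel. ?g y r) = indicator {0<..} r *\<^sub>R (of_real (?w r) * dirichlet_semigroup (t\<^sup>2 / (4 * r\<^sup>2)) f x)" for r
  proof (cases "0 < r")
    case True
    have "(LINT y|lborel. ?g y r) = (LINT y|lborel. of_real (?w r) * (of_real (dirichlet_kernel (t\<^sup>2 / (4 * r\<^sup>2)) x y) * zero_ext f y))"
      unfolding subordinator_dirichlet_kernel[OF t True] by (simp add: mult.assoc)
    also have "\<dots> = of_real (?w r) * dirichlet_semigroup (t\<^sup>2 / (4 * r\<^sup>2)) f x"
      unfolding dirichlet_semigroup_zero_ext by (rule integral_mult_right_zero)
    finally show ?thesis using True by simp
  next
    case False
    then have "subordinator t k r = 0" for k by (auto simp: subordinator_def indicator_def)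
    then show ?thesis using False by simp
  qed
  have "(LINT y|lborel. ?k y * zero_ext f y) = (LINT y|lborel. (LINT r|lborel. ?g y r))"
  proof (rule Bochner_Integration.integral_cong[OF refl])
    fix y
    have "(LINT r|lborel. ?g y r) = (LINT r|lborel. complex_of_real (?d y r)) * zero_ext f y"
      by (rule integral_mult_left_zero)
    then show "?k y * zero_ext f y = (LINT r|lborel. ?g y r)"
      unfolding Pd by (simp only: integral_complex_of_real)
  qed
  also have "\<dots> = (LINT r|lborel. (LINT y|lborel. ?g y r))"
    using lborel_pair.Fubini_integral[OF prod] by simp
  finally have eq: "(LINT y|lborel. ?k y * zero_ext f y) = (LINT r|lborel. (LINT y|lborel. ?g y r))" .
  have "ennreal (norm (LINT r|lborel. (LINT y|lborel. ?g y r))) \<le> (\<integral>\<^sup>+r. ennreal (norm (LINT y|lborel. ?g y r)) \<partial>lborel)"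
    by (rule integral_norm_bound_ennreal) (use lborel_pair.integrable_snd[OF prod] in simp)
  also have "\<dots> \<le> (\<integral>\<^sup>+r. ennreal (?w r) * indicator {0..} r * maximal_function f x \<partial>lborel)"
  proof (rule nn_integral_mono)
    fix r
    show "ennreal (norm (LINT y|lborel. ?g y r)) \<le> ennreal (?w r) * indicator {0..} r * maximal_function f x"
    proof (cases "0 < r")
      case True
      then have "ennreal (norm (LINT y|lborel. ?g y r)) = ennreal (?w r) * ennreal (norm (dirichlet_semigroup (t\<^sup>2 / (4 * r\<^sup>2)) f x))"
        unfolding slice by (simp add: norm_mult norm_divide flip: ennreal_mult)
      also have "\<dots> \<le> ennreal (?w r) * maximal_function f x"
        using t True by (intro mult_left_mono norm_dirichlet_semigroup_le_maximal) auto
      finally show ?thesis using True by simp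
    qed (unfold slice, simp)
  qed
  also have "\<dots> = (\<integral>\<^sup>+r. ennreal (?w r) * indicator {0..} r \<partial>lborel) * maximal_function f x"
    by (rule nn_integral_multc) measurable
  also have "\<dots> \<le> 2 * maximal_function f x" by (intro mult_right_mono nn_integral_gauss_le) simp
  finally show ?thesis unfolding eq .
qed

section \<open>The Hardy--Littlewood maximal function\<close>

text \<open>
  The uncentred version: it is lower semicontinuous, which makes its superlevel sets open.
\<close>

definition hl_maximal :: "(real \<Rightarrow> ennreal) \<Rightarrow> real \<Rightarrow> ennreal" where
  "hl_maximal \<phi> x = (SUP (y, r) \<in> {(y, r). dist y x < r}. (\<integral>\<^sup>+z\<in>ball y r. \<phi> z \<partial>lborel) / ennreal (2 * r))"

lemma average_le_hl_maximal:
  assumes "dist y x < r"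
  shows "(\<integral>\<^sup>+z\<in>ball y r. \<phi> z \<partial>lborel) / ennreal (2 * r) \<le> hl_maximal \<phi> x"
  unfolding hl_maximal_def using assms by (intro SUP_upper2[of "(y, r)"]) auto

lemma open_hl_maximal_greater: "open {x. c < hl_maximal \<phi> x}"
proof -
  have "{x. c < hl_maximal \<phi> x} =
      (\<Union>(y, r)\<in>{(y, r). c < (\<integral>\<^sup>+z\<in>ball y r. \<phi> z \<partial>lborel) / ennreal (2 * r)}. ball y r)"
    unfolding hl_maximal_def less_SUP_iff by fastforce
  then show ?thesis by (auto intro!: open_UN)
qed

lemma hl_maximal_measurable [measurable]: "hl_maximal \<phi> \<in> borel_measurable borel"
  by (rule borel_measurable_if_open_greater) (rule open_hl_maximal_greater)

lemma emeasure_UN_le_count_space: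
  assumes "countable C" "\<And>j. j \<in> C \<Longrightarrow> A j \<in> sets M"
  shows "emeasure M (\<Union>j\<in>C. A j) \<le> (\<integral>\<^sup>+j. emeasure M (A j) \<partial>count_space C)"
proof (cases "C = {}")
  case False
  define D where "D n = (if n \<in> to_nat_on C ` C then A (from_nat_into C n) else {})" for n
  have U: "(\<Union>j\<in>C. A j) = (\<Union>n. D n)"
    using assms(1) by (force simp: D_def)
  have "emeasure M (\<Union>n. D n) \<le> (\<Sum>n. emeasure M (D n))"
    using assms by (intro emeasure_subadditive_countably) (auto simp: D_def)
  also have "\<dots> = (\<integral>\<^sup>+n. emeasure M (D n) \<partial>count_space UNIV)"
    by (simp add: nn_integral_count_space_nat)
  also have "\<dots> = (\<integral>\<^sup>+n. emeasure M (D n) \<partial>count_space (to_nat_on C ` C))"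
    by (rule nn_integral_count_space_eq) (auto simp: D_def)
  also have "\<dots> = (\<integral>\<^sup>+j. emeasure M (D (to_nat_on C j)) \<partial>count_space C)"
    by (rule nn_integral_bij_count_space[symmetric]) (auto simp: bij_betw_def inj_on_to_nat_on assms(1))
  also have "\<dots> = (\<integral>\<^sup>+j. emeasure M (A j) \<partial>count_space C)"
    by (rule nn_integral_cong) (auto simp: D_def assms(1))
  finally show ?thesis unfolding U .
qed simp

text \<open>
  The balls on which the average exceeds \<open>c\<close> have bounded radius, so Vitali's lemma selects disjoint
  ones whose fivefold enlargements cover the superlevel set.
\<close>

lemma hl_maximal_weak_type:
  assumes [measurable]: "\<phi> \<in> borel_measurable borel" and c: "0 < c"
  shows "emeasure lborel {x. ennreal c < hl_maximal \<phi> x} \<le> ennreal (5 / c) * (\<integral>\<^sup>+x. \<phi> x \<partial>lborel)"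
proof (cases "(\<integral>\<^sup>+x. \<phi> x \<partial>lborel) = \<infinity>")
  case True
  then show ?thesis using c by (simp add: ennreal_mult_top)
next
  case False
  then obtain I where I: "(\<integral>\<^sup>+x. \<phi> x \<partial>lborel) = ennreal I" "0 \<le> I"
    by (metis ennreal_cases infinity_ennreal_def)
  define K where "K = {(y :: real, r). 0 < r \<and> ennreal (c * (2 * r)) \<le> (\<integral>\<^sup>+z\<in>ball y r. \<phi> z \<partial>lborel)}"
  have Kr: "0 < snd i \<and> snd i \<le> I / (2 * c)" if "i \<in> K" for i
  proof -
    have "ennreal (c * (2 * snd i)) \<le> (\<integral>\<^sup>+z\<in>ball (fst i) (snd i). \<phi> z \<partial>lborel)"
      using that by (auto simp: K_def)
    also have "\<dots> \<le> (\<integral>\<^sup>+x. \<phi> x \<partial>lborel)"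
      by (intro nn_integral_mono) (auto simp: indicator_def)
    finally have "c * (2 * snd i) \<le> I" using I by simp
    then show ?thesis using that c by (auto simp: K_def field_simps)
  qed
  obtain C where C: "countable C" "C \<subseteq> K"
     "pairwise (\<lambda>i j. disjnt (cball (fst i) (snd i)) (cball (fst j) (snd j))) C"
     "\<And>i. i \<in> K \<Longrightarrow> \<exists>j. j \<in> C \<and>
                        \<not> disjnt (cball (fst i) (snd i)) (cball (fst j) (snd j)) \<and>
                        cball (fst i) (snd i) \<subseteq> ball (fst j) (5 * snd j)"
    by (rule Vitali_covering_lemma_cballs_balls[of K snd "I / (2 * c)" fst]) (use Kr in auto)
  have sub: "{x. ennreal c < hl_maximal \<phi> x} \<subseteq> (\<Union>j\<in>C. ball (fst j) (5 * snd j))"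
  proof
    fix x assume "x \<in> {x. ennreal c < hl_maximal \<phi> x}"
    then obtain y r where yr: "dist y x < r" "ennreal c < (\<integral>\<^sup>+z\<in>ball y r. \<phi> z \<partial>lborel) / ennreal (2 * r)"
      by (auto simp: hl_maximal_def less_SUP_iff)
    have r: "0 < r" using yr(1) by (meson dist_not_less_zero linorder_not_less order_le_less_trans zero_le_dist)
    have "ennreal c * ennreal (2 * r) \<le> (\<integral>\<^sup>+z\<in>ball y r. \<phi> z \<partial>lborel) / ennreal (2 * r) * ennreal (2 * r)"
      using yr(2) by (intro mult_right_mono) auto
    also have "\<dots> = (\<integral>\<^sup>+z\<in>ball y r. \<phi> z \<partial>lborel)"
      using r by (simp add: ennreal_divide_times divide_mult_eq ennreal_mult_divide_eq flip: ennreal_times_divide)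
    finally have "(y, r) \<in> K" using r c by (auto simp: K_def ennreal_mult'')
    then show "x \<in> (\<Union>j\<in>C. ball (fst j) (5 * snd j))"
      using C(4) yr(1) by (fastforce simp: subset_iff)
  qed
  have "emeasure lborel {x. ennreal c < hl_maximal \<phi> x} \<le> emeasure lborel (\<Union>j\<in>C. ball (fst j) (5 * snd j))"
    using sub C(1) by (intro emeasure_mono) auto
  also have "\<dots> \<le> (\<integral>\<^sup>+j. emeasure lborel (ball (fst j) (5 * snd j)) \<partial>count_space C)"
    using C(1) by (intro emeasure_UN_le_count_space) auto 
  also have "\<dots> \<le> (\<integral>\<^sup>+j. ennreal (5 / c) * (\<integral>\<^sup>+z\<in>ball (fst j) (snd j). \<phi> z \<partial>lborel) \<partial>count_space C)"
  proof (intro nn_integral_mono)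
    fix j assume "j \<in> space (count_space C)"
    then have j: "0 < snd j" "ennreal (c * (2 * snd j)) \<le> (\<integral>\<^sup>+z\<in>ball (fst j) (snd j). \<phi> z \<partial>lborel)"
      using C(2) by (auto simp: K_def)
    have "emeasure lborel (ball (fst j) (5 * snd j)) = ennreal (5 / c) * ennreal (c * (2 * snd j))"
      using j(1) c by (simp add: ball_eq_greaterThanLessThan flip: ennreal_mult'')
    also have "\<dots> \<le> ennreal (5 / c) * (\<integral>\<^sup>+z\<in>ball (fst j) (snd j). \<phi> z \<partial>lborel)"
      using j(2) by (intro mult_left_mono) auto
    finally show "emeasure lborel (ball (fst j) (5 * snd j)) \<le> ennreal (5 / c) * (\<integral>\<^sup>+z\<in>ball (fst j) (snd j). \<phi> z \<partial>lborel)" .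
  qed
  also have "\<dots> = ennreal (5 / c) * (\<integral>\<^sup>+j. (\<integral>\<^sup>+z\<in>ball (fst j) (snd j). \<phi> z \<partial>lborel) \<partial>count_space C)"
    by (simp add: nn_integral_cmult)
  also have "(\<integral>\<^sup>+j. (\<integral>\<^sup>+z\<in>ball (fst j) (snd j). \<phi> z \<partial>lborel) \<partial>count_space C)
     = (\<integral>\<^sup>+z\<in>(\<Union>j\<in>C. ball (fst j) (snd j)). \<phi> z \<partial>lborel)"
  proof -
    have "disjoint_family_on (\<lambda>j. ball (fst j) (snd j)) C"
      unfolding disjoint_family_on_def
      proof (intro ballI impI)
      fix m n assume "m \<in> C" "n \<in> C" "m \<noteq> n"
      then have "cball (fst m) (snd m) \<inter> cball (fst n) (snd n) = {}"
        using C(3) by (simp add: pairwise_def disjnt_def)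
      then show "ball (fst m) (snd m) \<inter> ball (fst n) (snd n) = {}"
        using ball_subset_cball by blast
    qed
    then have "emeasure (density lborel \<phi>) (\<Union>j\<in>C. ball (fst j) (snd j))
        = (\<integral>\<^sup>+j. emeasure (density lborel \<phi>) (ball (fst j) (snd j)) \<partial>count_space C)"
      using C(1) by (intro emeasure_UN_countable) auto
    moreover have "(\<Union>j\<in>C. ball (fst j) (snd j)) \<in> sets lborel"
      by (simp add: open_UN borel_open)
    ultimately show ?thesis by (simp add: emeasure_density)
  qed
  also have "\<dots> \<le> (\<integral>\<^sup>+x. \<phi> x \<partial>lborel)"
    by (intro nn_integral_mono) (auto simp: indicator_def)
  finally show ?thesis by (simp add: mult_left_mono)
qed

lemma ennreal_top_le_of_nat_le:
  assumes "\<And>n. ennreal (real n) \<le> F"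
  shows "F = top"
proof (cases F rule: ennreal_cases)
  case (real r)
  obtain n where "r < real n" using reals_Archimedean2 by blast
  then show ?thesis using assms[of n] real by simp
qed

text \<open>
  The layer-cake formula for a square.
\<close>

lemma nn_integral_linear_below: "(\<integral>\<^sup>+c. ennreal (2 * c) * indicator {c. 0 < c \<and> ennreal c < F} c \<partial>lborel) = F * F"
proof -
  let ?I = "(\<integral>\<^sup>+c. ennreal (2 * c) * indicator {c. 0 < c \<and> ennreal c < F} c \<partial>lborel)"
  have fin: "(\<integral>\<^sup>+c. ennreal (2 * c) * indicator {0..r} c \<partial>lborel) = ennreal r * ennreal r" if "0 \<le> r" for r :: real
  proof -
    have "((\<lambda>c. c\<^sup>2) has_real_derivative 2 * x) (at x)" for x :: real
      by (auto intro!: derivative_eq_intros)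
    from nn_integral_FTC_Icc[of "\<lambda>c. 2 * c" 0 r "\<lambda>c. c\<^sup>2", OF _ DERIV_subset[OF this]] show ?thesis
      using that by (simp add: power2_eq_square ennreal_mult)
  qed
  show ?thesis
  proof (cases F rule: ennreal_cases)
    case (real r)
    have "?I
        = (\<integral>\<^sup>+c. ennreal (2 * c) * indicator {0..r} c \<partial>lborel)"
    proof (rule nn_integral_cong_AE)
      have "AE c in lborel. c \<noteq> r" by (rule AE_lborel_singleton)
      then show "AE c in lborel. ennreal (2 * c) * indicator {c. 0 < c \<and> ennreal c < F} c
          = ennreal (2 * c) * indicator {0..r} c"
        by eventually_elim (use real in \<open>auto simp: indicator_def ennreal_less_iff\<close>)
    qed
    then show ?thesis using fin[of r] real by simp
  next
    case top
    have "ennreal (real n) \<le> ?I" for n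
    proof -
      have "ennreal (real n) \<le> ennreal (real n * real n)"
        by (intro ennreal_leI) (simp flip: of_nat_mult)
      also have "\<dots> = (\<integral>\<^sup>+c. ennreal (2 * c) * indicator {0..real n} c \<partial>lborel)"
        using fin[of "real n"] by (simp add: ennreal_mult)
      also have "\<dots> \<le> ?I"
        using top by (intro nn_integral_mono) (auto simp: indicator_def)
      finally show ?thesis .
    qed
    then have "?I = top"
      by (intro ennreal_top_le_of_nat_le)
    then show ?thesis using top by simp
  qed
qed

text \<open>
  Values of \<open>\<phi>\<close> below \<open>c / 2\<close> contribute at most \<open>c / 2\<close> to any average, so the weak type estimate at
  height \<open>c / 2\<close> only sees the part of \<open>\<phi>\<close> above that height.
\<close>

lemma hl_maximal_truncation:
  assumes [measurable]: "\<phi> \<in> borel_measurable borel" and c: "0 < c"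
  shows "emeasure lborel {x. ennreal c < hl_maximal \<phi> x}
    \<le> ennreal (10 / c) * (\<integral>\<^sup>+x\<in>{x. ennreal (c / 2) < \<phi> x}. \<phi> x \<partial>lborel)"
proof -
  define \<psi> where "\<psi> x = \<phi> x * indicator {x. ennreal (c / 2) < \<phi> x} x" for x
  have [measurable]: "\<psi> \<in> borel_measurable borel" unfolding \<psi>_def by measurable
  have "{x. ennreal c < hl_maximal \<phi> x} \<subseteq> {x. ennreal (c / 2) < hl_maximal \<psi> x}"
  proof clarify
    fix x assume "ennreal c < hl_maximal \<phi> x"
    then obtain y r where yr: "dist y x < r" "ennreal c < (\<integral>\<^sup>+z\<in>ball y r. \<phi> z \<partial>lborel) / ennreal (2 * r)"
      by (auto simp: hl_maximal_def less_SUP_iff)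
    have r: "0 < r" using yr(1) zero_le_dist[of y x] by linarith
    have "(\<integral>\<^sup>+z\<in>ball y r. \<phi> z \<partial>lborel) \<le> (\<integral>\<^sup>+z\<in>ball y r. (\<psi> z + ennreal (c / 2)) \<partial>lborel)"
      by (intro nn_integral_mono) (auto simp: \<psi>_def indicator_def)
    also have "\<dots> = (\<integral>\<^sup>+z\<in>ball y r. \<psi> z \<partial>lborel) + ennreal (c / 2) * ennreal (2 * r)"
      using r by (simp add: distrib_right nn_integral_add nn_integral_cmult ball_eq_greaterThanLessThan)
    finally have "(\<integral>\<^sup>+z\<in>ball y r. \<phi> z \<partial>lborel) / ennreal (2 * r)
        \<le> ((\<integral>\<^sup>+z\<in>ball y r. \<psi> z \<partial>lborel) + ennreal (c / 2) * ennreal (2 * r)) / ennreal (2 * r)"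
      by (rule divide_right_mono_ennreal)
    also have "\<dots> = (\<integral>\<^sup>+z\<in>ball y r. \<psi> z \<partial>lborel) / ennreal (2 * r) + ennreal (c / 2)"
      using r by (simp add: add_divide_distrib_ennreal ennreal_mult_divide_eq)
    also have "\<dots> \<le> hl_maximal \<psi> x + ennreal (c / 2)"
      by (intro add_right_mono average_le_hl_maximal yr(1))
    finally have "ennreal (c / 2) + ennreal (c / 2) < hl_maximal \<psi> x + ennreal (c / 2)"
      using yr(2) c by (simp flip: ennreal_plus)
    then show "ennreal (c / 2) < hl_maximal \<psi> x"
      by (meson add_right_mono linorder_not_less)
  qed
  then have "emeasure lborel {x. ennreal c < hl_maximal \<phi> x} \<le> emeasure lborel {x. ennreal (c / 2) < hl_maximal \<psi> x}"
    by (intro emeasure_mono) auto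
  also have "\<dots> \<le> ennreal (5 / (c / 2)) * (\<integral>\<^sup>+x. \<psi> x \<partial>lborel)"
    using c by (intro hl_maximal_weak_type) auto
  finally show ?thesis by (simp add: \<psi>_def)
qed

text \<open>
  Marcinkiewicz interpolation in its simplest case: the refined weak type estimate is integrated over
  all heights.
\<close>

theorem hl_maximal_L2:
  assumes [measurable]: "\<phi> \<in> borel_measurable borel"
  shows "(\<integral>\<^sup>+x. hl_maximal \<phi> x * hl_maximal \<phi> x \<partial>lborel) \<le> 40 * (\<integral>\<^sup>+x. \<phi> x * \<phi> x \<partial>lborel)"
proof -
  let ?A = "\<lambda>x c. indicator {c. 0 < c \<and> ennreal c < hl_maximal \<phi> x} c"
  let ?B = "\<lambda>x c. indicator {c. 0 < c \<and> ennreal (c / 2) < \<phi> x} c"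
  have "(\<integral>\<^sup>+x. hl_maximal \<phi> x * hl_maximal \<phi> x \<partial>lborel)
      = (\<integral>\<^sup>+x. (\<integral>\<^sup>+c. ennreal (2 * c) * ?A x c \<partial>lborel) \<partial>lborel)"
    by (simp add: nn_integral_linear_below)
  also have "\<dots> = (\<integral>\<^sup>+c. (\<integral>\<^sup>+x. ennreal (2 * c) * ?A x c \<partial>lborel) \<partial>lborel)"
    by (rule lborel_pair.Fubini') measurable
  also have "\<dots> \<le> (\<integral>\<^sup>+c. (\<integral>\<^sup>+x. 20 * \<phi> x * ?B x c \<partial>lborel) \<partial>lborel)"
  proof (rule nn_integral_mono)
    fix c :: real
    show "(\<integral>\<^sup>+x. ennreal (2 * c) * ?A x c \<partial>lborel)
       \<le> (\<integral>\<^sup>+x. 20 * \<phi> x * ?B x c \<partial>lborel)"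
    proof (cases "0 < c")
      case True
      have "(\<integral>\<^sup>+x. ennreal (2 * c) * ?A x c \<partial>lborel)
         = ennreal (2 * c) * (\<integral>\<^sup>+x. indicator {x. ennreal c < hl_maximal \<phi> x} x \<partial>lborel)"
        using True by (subst nn_integral_cmult[symmetric]) (auto intro!: nn_integral_cong simp: indicator_def)
      also have "\<dots> = ennreal (2 * c) * emeasure lborel {x. ennreal c < hl_maximal \<phi> x}"
        by simp
      also have "\<dots> \<le> ennreal (2 * c) * (ennreal (10 / c) * (\<integral>\<^sup>+x\<in>{x. ennreal (c / 2) < \<phi> x}. \<phi> x \<partial>lborel))"
        using True by (intro mult_left_mono hl_maximal_truncation) auto
      also have "\<dots> = 20 * (\<integral>\<^sup>+x\<in>{x. ennreal (c / 2) < \<phi> x}. \<phi> x \<partial>lborel)"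
        using True by (simp add: mult.assoc[symmetric] flip: ennreal_mult)
      also have "\<dots> = (\<integral>\<^sup>+x. 20 * \<phi> x * ?B x c \<partial>lborel)"
        using True by (subst nn_integral_cmult[symmetric]) (auto intro!: nn_integral_cong simp: indicator_def)
      finally show ?thesis .
    qed simp
  qed
  also have "\<dots> = (\<integral>\<^sup>+x. (\<integral>\<^sup>+c. 20 * \<phi> x * ?B x c \<partial>lborel) \<partial>lborel)"
    by (rule lborel_pair.Fubini') measurable
  also have "\<dots> \<le> (\<integral>\<^sup>+x. 40 * (\<phi> x * \<phi> x) \<partial>lborel)"
  proof (intro nn_integral_mono)
    fix x :: real
    have "(\<integral>\<^sup>+c. 20 * \<phi> x * ?B x c \<partial>lborel)
        = 20 * \<phi> x * emeasure lborel {c. 0 < c \<and> ennreal (c / 2) < \<phi> x}"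
      by (simp add: nn_integral_cmult_indicator)
    also have "\<dots> \<le> 20 * \<phi> x * (2 * \<phi> x)"
    proof (rule mult_left_mono)
      show "emeasure lborel {c. 0 < c \<and> ennreal (c / 2) < \<phi> x} \<le> 2 * \<phi> x"
    proof (cases "\<phi> x" rule: ennreal_cases)
      case (real r)
      then have "emeasure lborel {c. 0 < c \<and> ennreal (c / 2) < \<phi> x} \<le> emeasure lborel {0..2 * r}"
        by (intro emeasure_mono) (auto simp: ennreal_less_iff)
      then show ?thesis using real by (simp add: ennreal_mult)
    qed simp
    qed simp
    also have "\<dots> = 40 * (\<phi> x * \<phi> x)" by (simp add: algebra_simps)
    finally show "(\<integral>\<^sup>+c. 20 * \<phi> x * ?B x c \<partial>lborel) \<le> 40 * (\<phi> x * \<phi> x)" .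
  qed
  also have "\<dots> = 40 * (\<integral>\<^sup>+x. \<phi> x * \<phi> x \<partial>lborel)"
    by (intro nn_integral_cmult) measurable
  finally show ?thesis .
qed

section \<open>Real parts of holomorphic functions\<close>

text \<open>
  The parametrisation by \<open>[0, 1]\<close> agrees with the one of \<open>circlepath\<close>.
\<close>

definition circle_point :: "complex \<Rightarrow> real \<Rightarrow> real \<Rightarrow> complex" where
  "circle_point z \<rho> t = z + of_real \<rho> * cis (2 * pi * t)"

lemma circle_point_simps [simp]:
  "Re (circle_point z \<rho> t) = Re z + \<rho> * cos (2 * pi * t)"
  "Im (circle_point z \<rho> t) = Im z + \<rho> * sin (2 * pi * t)"
  by (simp_all add: circle_point_def)

lemma dist_circle_point: "0 \<le> \<rho> \<Longrightarrow> dist (circle_point z \<rho> t) z = \<rho>"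
  by (simp add: circle_point_def dist_norm norm_mult)

lemma continuous_circle_point: "continuous_on A (circle_point z \<rho>)"
  unfolding circle_point_def cis.code by (intro continuous_intros)

lemma circlepath_eq_circle_point: "circlepath z \<rho> t = circle_point z \<rho> t"
  by (simp add: circlepath circle_point_def cis_conv_exp mult_ac)

lemma has_integral_circle_iff:
  "(f has_contour_integral I) (circlepath z \<rho>) \<longleftrightarrow>
   ((\<lambda>t. f (circle_point z \<rho> t) * (2 * of_real pi * \<i> * of_real \<rho> * cis (2 * pi * t))) has_integral I) {0..1}"
  unfolding has_contour_integral_def
  by (rule has_integral_cong)
     (simp add: vector_derivative_circlepath01 circlepath_eq_circle_point cis_conv_exp mult_ac)

text \<open>
  Cauchy's formulas for \<open>G\<close> and its derivative, and Cauchy's theorem for \<open>G\<close>. The third one, after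
  complex conjugation, allows replacing \<open>G\<close> by twice its real part in the second.
\<close>

lemma holomorphic_circle_integrals:
  assumes hol: "G holomorphic_on cball z \<rho>" and \<rho>: "0 < \<rho>"
  shows "((\<lambda>t. G (circle_point z \<rho> t)) has_integral G z) {0..1}"
    and "((\<lambda>t. G (circle_point z \<rho> t) * cis (- (2 * pi * t))) has_integral of_real \<rho> * deriv G z) {0..1}"
    and "((\<lambda>t. G (circle_point z \<rho> t) * cis (2 * pi * t)) has_integral 0) {0..1}"
proof -
  have hb: "G holomorphic_on ball z \<rho>" using hol by (rule holomorphic_on_subset) auto
  have c: "continuous_on (cball z \<rho>) G" using hol by (rule holomorphic_on_imp_continuous_on)
  have cp: "circle_point z \<rho> t - z = of_real \<rho> * cis (2 * pi * t)" for t
    by (simp add: circle_point_def)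
  have H: "((\<lambda>u. G u / (u - z) ^ Suc k) has_contour_integral (2 * pi * \<i> / fact k * (deriv ^^ k) G z)) (circlepath z \<rho>)" for k
    by (rule Cauchy_has_contour_integral_higher_derivative_circlepath[OF c hb]) (use \<rho> in auto)
  have cancel: "(g has_integral I) A" if "((\<lambda>t. g t * k) has_integral I * k) A" "k \<noteq> 0"
    for g :: "real \<Rightarrow> complex" and I k A
    using has_integral_mult_left[OF that(1), of "1 / k"] that(2) by (simp add: mult.assoc)
  have pi0: "2 * of_real pi * \<i> \<noteq> (0 :: complex)" by simp
  from H[of 0] have "((\<lambda>t. G (circle_point z \<rho> t) * (2 * of_real pi * \<i>)) has_integral (G z * (2 * of_real pi * \<i>))) {0..1}"
    unfolding has_integral_circle_iff cp using \<rho> by (simp add: mult_ac)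
  then show "((\<lambda>t. G (circle_point z \<rho> t)) has_integral G z) {0..1}"
    by (rule cancel) (use pi0 in auto)
  from H[of 1] have "((\<lambda>t. G (circle_point z \<rho> t) * cis (- (2 * pi * t)) * (2 * of_real pi * \<i> / of_real \<rho>)) has_integral
      (of_real \<rho> * deriv G z) * (2 * of_real pi * \<i> / of_real \<rho>)) {0..1}"
    unfolding has_integral_circle_iff cp using \<rho>
    by (simp add: mult_ac power2_eq_square flip: cis_inverse) (simp add: field_simps)
  then show "((\<lambda>t. G (circle_point z \<rho> t) * cis (- (2 * pi * t))) has_integral of_real \<rho> * deriv G z) {0..1}"
    by (rule cancel) (use pi0 \<rho> in auto)
  have "(G has_contour_integral 0) (circlepath z \<rho>)"
    by (rule Cauchy_theorem_convex_simple[OF hol]) (use \<rho> in auto)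
  then have "((\<lambda>t. G (circle_point z \<rho> t) * cis (2 * pi * t) * (2 * of_real pi * \<i> * of_real \<rho>)) has_integral 0 * (2 * of_real pi * \<i> * of_real \<rho>)) {0..1}"
    unfolding has_integral_circle_iff by (simp add: mult_ac)
  then show "((\<lambda>t. G (circle_point z \<rho> t) * cis (2 * pi * t)) has_integral 0) {0..1}"
    by (rule cancel) (use pi0 \<rho> in auto)
qed

text \<open>
  The derivative is \<open>2 / \<rho>\<close> times an average of the real part alone against unimodular factors.
\<close>

lemma norm_deriv_le_Re:
  assumes hol: "G holomorphic_on cball z \<rho>" and \<rho>: "0 < \<rho>"
    and B: "\<And>w. dist w z = \<rho> \<Longrightarrow> \<bar>Re (G w)\<bar> \<le> B"
  shows "norm (deriv G z) \<le> 2 / \<rho> * B"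
proof -
  let ?g = "\<lambda>t. G (circle_point z \<rho> t)"
  have "((\<lambda>t. cnj (?g t * cis (2 * pi * t))) has_integral cnj 0) {0..1}"
    using has_integral_linear[OF holomorphic_circle_integrals(3)[OF hol \<rho>] bounded_linear_cnj] by (simp add: o_def)
  from has_integral_add[OF holomorphic_circle_integrals(2)[OF hol \<rho>] this]
  have "((\<lambda>t. of_real (2 * Re (?g t)) * cis (- (2 * pi * t))) has_integral of_real \<rho> * deriv G z) (cbox 0 1)"
    by (simp add: cis_cnj complex_add_cnj flip: distrib_right)
  then have "norm (of_real \<rho> * deriv G z) \<le> (2 * B) * Henstock_Kurzweil_Integration.content (cbox 0 (1::real))"
  proof (rule has_integral_bound[rotated])
    show "0 \<le> 2 * B" using B[OF dist_circle_point, of 0] \<rho> by (smt (verit) abs_ge_zero)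
    show "norm (of_real (2 * Re (?g t)) * cis (- (2 * pi * t))) \<le> 2 * B" for t
      using B[OF dist_circle_point, of t] \<rho> by (simp add: norm_mult)
  qed
  then show ?thesis using \<rho> by (simp add: norm_mult field_simps)
qed

text \<open>
  On each half circle the abscissa \<open>x + \<rho> cos \<theta>\<close> is monotone with derivative of absolute value
  \<open>\<rho> \<bar>sin \<theta>\<bar>\<close>, so the weight \<open>\<bar>sin \<theta>\<bar>\<close> turns the integral over the arc into one over its projection.
\<close>

lemma nn_integral_half_circle:
  fixes p :: "real \<Rightarrow> real"
  assumes [measurable]: "p \<in> borel_measurable borel" and \<rho>: "0 < \<rho>"
    and s: "(a, b, s) = (0, 1/2, -1) \<or> (a, b, s) = (1/2, 1, 1 :: real)"
  shows "(\<integral>\<^sup>+t\<in>{a..b}. ennreal (p (x + \<rho> * cos (2 * pi * t))) * ennreal \<bar>sin (2 * pi * t)\<bar> \<partial>lborel)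
     = ennreal (1 / (2 * pi * \<rho>)) * (\<integral>\<^sup>+y\<in>{x - \<rho>..x + \<rho>}. ennreal (p y) \<partial>lborel)"
proof -
  let ?s = "\<lambda>t. \<bar>sin (2 * pi * t)\<bar>"
  define g where "g t = s * \<rho> * cos (2 * pi * t)" for t
  define g' where "g' t = - s * \<rho> * (2 * pi) * sin (2 * pi * t)" for t
  have cases: "\<bar>s\<bar> = 1" "s * s = 1" "a \<le> b" using s by auto
  have ends: "cos (2 * pi * a) = - s" "cos (2 * pi * b) = s"
  proof -
    consider "2 * pi * a = 0" "2 * pi * b = pi" "s = -1" | "2 * pi * a = pi" "2 * pi * b = 2 * pi" "s = 1"
      using s by fastforce
    then show "cos (2 * pi * a) = - s" "cos (2 * pi * b) = s"
      by (cases, simp_all only: cos_zero cos_pi cos_two_pi minus_minus)+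
  qed
  have sin: "- s * sin (2 * pi * t) = ?s t" if "t \<in> {a..b}" for t
    using s
  proof
    assume *: "(a, b, s) = (0, 1/2, -1)"
    then have "0 \<le> sin (2 * pi * t)" using that by (intro sin_ge_zero) auto
    then show ?thesis using * by simp
  next
    assume *: "(a, b, s) = (1/2, 1, 1)"
    then have "0 \<le> sin (2 * pi * t - pi)" using that by (intro sin_ge_zero) auto
    then show ?thesis using * by (simp add: sin_diff)
  qed
  have gend: "g a = - \<rho>" "g b = \<rho>" using cases ends by (auto simp: g_def)
  have g'eq: "g' t = 2 * pi * \<rho> * ?s t" if "t \<in> {a..b}" for t
  proof -
    have "g' t = 2 * pi * \<rho> * (- s * sin (2 * pi * t))" by (simp add: g'_def)
    then show ?thesis unfolding sin[OF that] .
  qed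
  have sg: "s * g t = \<rho> * cos (2 * pi * t)" for t
  proof -
    have "s * g t = (s * s) * (\<rho> * cos (2 * pi * t))" by (simp add: g_def)
    then show ?thesis unfolding cases by simp
  qed
  have "(\<integral>\<^sup>+y. ennreal (p (x + s * y) * indicator {g a..g b} y) \<partial>lborel)
      = (\<integral>\<^sup>+t. ennreal (p (x + s * g t) * g' t * indicator {a..b} t) \<partial>lborel)"
  proof (rule nn_integral_substitution)
    show "set_borel_measurable borel {g a..g b} (\<lambda>y. p (x + s * y))"
      unfolding set_borel_measurable_def by measurable
    show "(g has_real_derivative g' t) (at t)" for t
      unfolding g_def g'_def by (auto intro!: derivative_eq_intros)
    show "continuous_on {a..b} g'" unfolding g'_def by (intro continuous_intros)
    show "0 \<le> g' t" if "t \<in> {a..b}" for t using g'eq[OF that] \<rho> by simp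
  qed (use cases in auto)
  also have "\<dots> = ennreal (2 * pi * \<rho>) * (\<integral>\<^sup>+t\<in>{a..b}. ennreal (p (x + \<rho> * cos (2 * pi * t))) * ennreal (?s t) \<partial>lborel)"
  proof (subst nn_integral_cmult[symmetric], measurable, rule nn_integral_cong)
    fix t
    have "ennreal (p (x + s * g t) * g' t) = ennreal (2 * pi * \<rho>) * (ennreal (p (x + \<rho> * cos (2 * pi * t))) * ennreal (?s t))"
      if "t \<in> {a..b}"
    proof -
      have "p (x + s * g t) * g' t = (2 * pi * \<rho>) * (p (x + \<rho> * cos (2 * pi * t)) * ?s t)"
        unfolding sg g'eq[OF that] by (simp add: mult_ac)
      then show ?thesis using \<rho> by (simp only: ennreal_mult' ennreal_mult'' abs_ge_zero mult_nonneg_nonneg pi_ge_zero less_imp_le zero_le_numeral)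
    qed
    then show "ennreal (p (x + s * g t) * g' t * indicator {a..b} t)
        = ennreal (2 * pi * \<rho>) * (ennreal (p (x + \<rho> * cos (2 * pi * t))) * ennreal (?s t) * indicator {a..b} t)"
      by (cases "t \<in> {a..b}") simp_all
  qed
  finally have 1: "ennreal (2 * pi * \<rho>) * (\<integral>\<^sup>+t\<in>{a..b}. ennreal (p (x + \<rho> * cos (2 * pi * t))) * ennreal (?s t) \<partial>lborel)
     = (\<integral>\<^sup>+y. ennreal (p (x + s * y) * indicator {- \<rho>..\<rho>} y) \<partial>lborel)" using gend by simp
  have 2: "(\<integral>\<^sup>+y\<in>{x - \<rho>..x + \<rho>}. ennreal (p y) \<partial>lborel) = (\<integral>\<^sup>+y. ennreal (p (x + s * y) * indicator {- \<rho>..\<rho>} y) \<partial>lborel)"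
  proof -
    have "(\<integral>\<^sup>+y\<in>{x - \<rho>..x + \<rho>}. ennreal (p y) \<partial>lborel)
      = ennreal \<bar>s\<bar> * (\<integral>\<^sup>+y. ennreal (p (x + s * y)) * indicator {x - \<rho>..x + \<rho>} (x + s * y) \<partial>lborel)"
      using cases by (intro nn_integral_real_affine) auto
    also have "\<dots> = (\<integral>\<^sup>+y. ennreal (p (x + s * y) * indicator {- \<rho>..\<rho>} y) \<partial>lborel)"
    proof -
      have "ennreal (p (x + s * y)) * indicator {x - \<rho>..x + \<rho>} (x + s * y) = ennreal (p (x + s * y) * indicator {- \<rho>..\<rho>} y)" for y
        using s by (auto simp: indicator_def)
      then show ?thesis using cases by simp
    qed
    finally show ?thesis .
  qed
  have "ennreal (1 / (2 * pi * \<rho>)) * (ennreal (2 * pi * \<rho>) * J) = J" for J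
    using \<rho> by (simp add: mult.assoc[symmetric] ennreal_mult[symmetric])
  then show ?thesis unfolding 2 1[symmetric] by simp
qed

lemma nn_integral_circle:
  fixes p :: "real \<Rightarrow> real"
  assumes [measurable]: "p \<in> borel_measurable borel" and \<rho>: "0 < \<rho>"
  shows "(\<integral>\<^sup>+t\<in>{0..1}. ennreal (p (x + \<rho> * cos (2 * pi * t))) * ennreal \<bar>sin (2 * pi * t)\<bar> \<partial>lborel)
     = ennreal (1 / (pi * \<rho>)) * (\<integral>\<^sup>+y\<in>{x - \<rho>..x + \<rho>}. ennreal (p y) \<partial>lborel)"
proof -
  let ?f = "\<lambda>t. ennreal (p (x + \<rho> * cos (2 * pi * t))) * ennreal \<bar>sin (2 * pi * t)\<bar>"
  let ?I = "\<integral>\<^sup>+y\<in>{x - \<rho>..x + \<rho>}. ennreal (p y) \<partial>lborel"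
  have "(\<integral>\<^sup>+t\<in>{0..1}. ?f t \<partial>lborel) = (\<integral>\<^sup>+t. ?f t * indicator {0..1/2} t + ?f t * indicator {1/2..1} t \<partial>lborel)"
  proof (rule nn_integral_cong_AE)
    have "AE t in lborel. t \<noteq> 1/2" by (rule AE_lborel_singleton)
    then show "AE t in lborel. ?f t * indicator {0..1} t = ?f t * indicator {0..1/2} t + ?f t * indicator {1/2..1} t"
      by eventually_elim (auto simp: indicator_def)
  qed
  also have "\<dots> = ennreal (1 / (2 * pi * \<rho>)) * ?I + ennreal (1 / (2 * pi * \<rho>)) * ?I"
    using nn_integral_half_circle[OF assms, of 0 "1/2" "-1" x] nn_integral_half_circle[OF assms, of "1/2" 1 1 x]
    by (subst nn_integral_add) auto
  also have "\<dots> = ennreal (1 / (pi * \<rho>)) * ?I"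
    using \<rho> by (simp flip: distrib_right ennreal_plus)
  finally show ?thesis .
qed

text \<open>
  The function \<open>z \<mapsto> d(z)\<^sup>2 \<bar>u(z)\<bar>\<close>, with \<open>d(z)\<close> the distance from the boundary of the disc, has a maximum
  \<open>S\<close>, attained at some \<open>\<zeta>\<close>. The mean value property on a circle of radius \<open>d(\<zeta>) / 4\<close> about \<open>\<zeta>\<close> is split
  by \<open>1 = (1 - \<bar>sin \<theta>\<bar>) + \<bar>sin \<theta>\<bar>\<close>. The first part is estimated by the maximum; it is absorbed because the
  mean of \<open>\<bar>sin \<theta>\<bar>\<close> is \<open>2 / \<pi> \<ge> 1 / 2\<close>. In the second part one factor \<open>\<bar>u\<bar>\<^sup>1\<^sup>/\<^sup>2\<close> is estimated by the maximum
  and the other one by \<open>p\<close>; the weight \<open>\<bar>sin \<theta>\<bar>\<close> makes this an integral of \<open>p\<close> over an interval. Altogether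
  \<open>S \<le> (8 / 9) S + C S\<^sup>1\<^sup>/\<^sup>2 A\<close>, hence \<open>S\<^sup>1\<^sup>/\<^sup>2 \<le> C A\<close>, and the centre of the disc is a competitor for the maximum.
\<close>

lemma sqrt_Re_le_average_aux:
  fixes p :: "real \<Rightarrow> real"
  assumes hol: "G holomorphic_on cball z0 R" and R: "0 < R"
    and p [measurable]: "p \<in> borel_measurable borel"
    and le: "\<And>z. z \<in> cball z0 R \<Longrightarrow> sqrt \<bar>Re (G z)\<bar> \<le> p (Re z)"
    and A: "(\<integral>\<^sup>+x\<in>ball (Re z0) R. ennreal (p x) \<partial>lborel) \<le> ennreal A" "0 \<le> A"
  shows "sqrt \<bar>Re (G z0)\<bar> \<le> 16 / R * A"
proof -
  let ?s = "\<lambda>t. \<bar>sin (2 * pi * t)\<bar>"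
  define u where "u z = \<bar>Re (G z)\<bar>" for z
  define D where "D z = R - dist z z0" for z
  have contG: "continuous_on (cball z0 R) G" using hol by (rule holomorphic_on_imp_continuous_on)
  have contu: "continuous_on (cball z0 R) u" unfolding u_def by (intro continuous_intros contG)
  have contD: "continuous_on (cball z0 R) (\<lambda>z. (D z)\<^sup>2 * u z)"
    unfolding D_def by (intro continuous_intros contu)
  have ne: "cball z0 R \<noteq> {}" using R by simp
  obtain \<zeta> where \<zeta>0: "\<zeta> \<in> cball z0 R" "\<forall>z\<in>cball z0 R. (D z)\<^sup>2 * u z \<le> (D \<zeta>)\<^sup>2 * u \<zeta>"
    using continuous_attains_sup[OF compact_cball ne contD] by blast
  then have \<zeta>: "\<zeta> \<in> cball z0 R" "\<And>z. z \<in> cball z0 R \<Longrightarrow> (D z)\<^sup>2 * u z \<le> (D \<zeta>)\<^sup>2 * u \<zeta>"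
    by blast+
  define d where "d = D \<zeta>"
  define S where "S = d\<^sup>2 * u \<zeta>"
  have S_ge: "(D z)\<^sup>2 * u z \<le> S" if "z \<in> cball z0 R" for z using \<zeta>(2)[OF that] by (simp add: S_def d_def)
  have R2: "R\<^sup>2 * u z0 \<le> S" using S_ge[of z0] R by (simp add: D_def)
  have S0: "0 \<le> S" by (simp add: S_def u_def)
  have key: "sqrt S \<le> 16 * A"
  proof (cases "S = 0")
    case True
    then show ?thesis using A(2) by simp
  next
    case False
    have "d \<noteq> 0" using False by (auto simp: S_def)
    then have d: "0 < d" using \<zeta>(1) by (simp add: d_def D_def dist_commute)
    define \<rho> where "\<rho> = d / 4"
    have \<rho>: "0 < \<rho>" using d by (simp add: \<rho>_def)
    define c where "c = circle_point \<zeta> \<rho>"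
    have sub: "cball \<zeta> \<rho> \<subseteq> cball z0 R"
    proof
      fix w assume "w \<in> cball \<zeta> \<rho>"
      then show "w \<in> cball z0 R"
        using dist_triangle[of z0 w \<zeta>] d by (simp add: \<rho>_def d_def D_def dist_commute)
    qed
    have "c t \<in> cball \<zeta> \<rho>" for t
      using dist_circle_point[of \<rho> \<zeta> t] \<rho> by (simp add: c_def dist_commute)
    then have c_in: "c t \<in> cball z0 R" for t using sub by blast
    have Dc: "3 / 4 * d \<le> D (c t)" for t
    proof -
      have "dist (c t) \<zeta> = \<rho>" using dist_circle_point[OF less_imp_le[OF \<rho>], of \<zeta> t] by (simp add: c_def)
      then have "dist (c t) z0 \<le> \<rho> + dist \<zeta> z0" using dist_triangle[of "c t" z0 \<zeta>] by simp
      moreover have "dist \<zeta> z0 = R - d" by (simp add: d_def D_def)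
      ultimately show ?thesis by (simp add: D_def \<rho>_def)
    qed
    \<comment> \<open>On the circle the distance from the boundary is at least \<open>3 d / 4\<close>, so \<open>K\<close> bounds \<open>\<bar>u\<bar>\<close> there.\<close>
    define K where "K = 16 / 9 * S / d\<^sup>2"
    have uc: "u (c t) \<le> K" for t
    proof -
      have "(3 / 4 * d)\<^sup>2 * u (c t) \<le> (D (c t))\<^sup>2 * u (c t)"
        using d Dc[of t] by (intro mult_right_mono power_mono) (auto simp: u_def)
      also have "\<dots> \<le> S" using S_ge c_in by simp
      finally show ?thesis using d by (simp add: K_def field_simps power2_eq_square)
    qed
    have K0: "0 \<le> K" using S0 by (simp add: K_def)
    have contc: "continuous_on {0..1} (\<lambda>t. u (c t))"
      by (rule continuous_on_compose2[OF contu]) (use c_in in \<open>auto simp: c_def continuous_circle_point\<close>)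
    have cs: "continuous_on {0..1} (\<lambda>t. sin (2 * pi * t))" by (intro continuous_intros)
    define Z where "Z = integral {0..1} (\<lambda>t. sqrt (u (c t)) * ?s t)"
    define I1 where "I1 = integral {0..1} (\<lambda>t. ?s t)"
    have iZ: "(\<lambda>t. sqrt (u (c t)) * ?s t) integrable_on {0..1}"
      by (intro integrable_continuous_interval continuous_intros contc)
    have iI: "(\<lambda>t. ?s t) integrable_on {0..1}"
      by (intro integrable_continuous_interval continuous_intros)
    have "norm (Re (G \<zeta>)) \<le> integral {0..1} (\<lambda>t. u (c t))"
    proof -
      have "G holomorphic_on cball \<zeta> \<rho>" using hol sub by (rule holomorphic_on_subset)
      from has_integral_linear[OF holomorphic_circle_integrals(1)[OF this \<rho>] bounded_linear_Re]
      have *: "((\<lambda>t. Re (G (c t))) has_integral Re (G \<zeta>)) {0..1}" by (simp add: o_def c_def)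
      have "norm (integral {0..1} (\<lambda>t. Re (G (c t)))) \<le> integral {0..1} (\<lambda>t. u (c t))"
        by (rule integral_norm_bound_integral)
          (use * in \<open>auto simp: u_def[abs_def] intro: has_integral_integrable integrable_continuous_interval[OF contc[unfolded u_def]]\<close>)
      then show ?thesis using * by (simp add: integral_unique)
    qed
    also have "\<dots> \<le> integral {0..1} (\<lambda>t. K - K * ?s t + sqrt K * (sqrt (u (c t)) * ?s t))"
    proof (rule integral_le)
      fix t
      have "u (c t) * (1 - ?s t) \<le> K * (1 - ?s t)"
        using uc by (intro mult_right_mono) auto
      moreover have "u (c t) \<le> sqrt K * sqrt (u (c t))"
      proof -
        have "u (c t) = sqrt (u (c t)) * sqrt (u (c t))" by (simp add: u_def)
        also have "\<dots> \<le> sqrt K * sqrt (u (c t))" using uc[of t] by (intro mult_right_mono) (auto simp: u_def)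
        finally show ?thesis .
      qed
      then have "u (c t) * ?s t \<le> sqrt K * sqrt (u (c t)) * ?s t"
        by (intro mult_right_mono) auto
      ultimately show "u (c t) \<le> K - K * ?s t + sqrt K * (sqrt (u (c t)) * ?s t)"
        by (simp add: algebra_simps)
    qed (intro integrable_continuous_interval continuous_intros contc)+
    also have "\<dots> = K - K * I1 + sqrt K * Z"
    proof -
      have "((\<lambda>t. K - K * ?s t + sqrt K * (sqrt (u (c t)) * ?s t)) has_integral
         (1 - 0) *\<^sub>R K - K * I1 + sqrt K * Z) {0..1}"
        unfolding I1_def Z_def
        by (intro has_integral_add has_integral_diff has_integral_const_real has_integral_mult_right integrable_integral iI iZ)
           (use has_integral_const_real[of K 0 1] in simp)
      then show ?thesis by (simp add: integral_unique)
    qed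
    finally have 1: "u \<zeta> \<le> K - K * I1 + sqrt K * Z" by (simp add: u_def)
    have nnI: "ennreal (integral {0..1} (\<lambda>t. q t * ?s t))
         = (\<integral>\<^sup>+t\<in>{0..1}. ennreal (q t) * ennreal (?s t) \<partial>lborel)"
      if q: "continuous_on {0..1} q" "\<And>t. 0 \<le> q t" for q
    proof -
      let ?f = "\<lambda>t. q t * ?s t"
      have cf: "continuous_on {0..1} ?f" by (intro continuous_intros q)
      have "set_integrable lborel {0..1} ?f" by (rule borel_integrable_atLeastAtMost') (rule cf)
      then have int: "integrable lborel (\<lambda>t. indicator {0..1} t *\<^sub>R ?f t)" by (simp add: set_integrable_def)
      have "ennreal (integral {0..1} ?f) = ennreal (LINT t:{0..1}|lborel. ?f t)"
        using set_borel_integral_eq_integral(2)[OF borel_integrable_atLeastAtMost'[OF cf]] by simp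
      also have "\<dots> = (\<integral>\<^sup>+t. ennreal (indicator {0..1} t *\<^sub>R ?f t) \<partial>lborel)"
        unfolding set_lebesgue_integral_def using q int by (intro nn_integral_eq_integral[symmetric]) auto
      also have "\<dots> = (\<integral>\<^sup>+t\<in>{0..1}. ennreal (q t) * ennreal (?s t) \<partial>lborel)"
        using q by (intro nn_integral_cong) (auto simp: indicator_def ennreal_mult)
      finally show ?thesis .
    qed
    have "ennreal I1 = ennreal (2 / pi)"
      using nnI[of "\<lambda>_. 1"] nn_integral_circle[of "\<lambda>_. 1" \<rho> 0] \<rho>
      by (simp add: I1_def nn_integral_cmult_indicator flip: ennreal_mult'')
    moreover have "0 \<le> I1" unfolding I1_def by (intro integral_nonneg iI) auto
    ultimately have I1_eq: "I1 = 2 / pi" by (simp add: ennreal_inj)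
    have "2 / 4 \<le> 2 / pi" by (rule divide_left_mono) (use pi_less_4 in auto)
    then have I1: "1 / 2 \<le> I1" unfolding I1_eq by linarith
    have "ennreal Z = (\<integral>\<^sup>+t\<in>{0..1}. ennreal (sqrt (u (c t))) * ennreal (?s t) \<partial>lborel)"
      unfolding Z_def by (rule nnI[OF continuous_on_real_sqrt[OF contc]]) (simp add: u_def)
    also have "\<dots> \<le> (\<integral>\<^sup>+t\<in>{0..1}. ennreal (p (Re \<zeta> + \<rho> * cos (2 * pi * t))) * ennreal (?s t) \<partial>lborel)"
      using le[OF c_in] by (intro nn_integral_mono mult_right_mono ennreal_leI) (auto simp: u_def c_def)
    also have "\<dots> = ennreal (1 / (pi * \<rho>)) * (\<integral>\<^sup>+y\<in>{Re \<zeta> - \<rho>..Re \<zeta> + \<rho>}. ennreal (p y) \<partial>lborel)"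
      by (rule nn_integral_circle[OF p \<rho>])
    also have "\<dots> \<le> ennreal (1 / (pi * \<rho>)) * (\<integral>\<^sup>+x\<in>ball (Re z0) R. ennreal (p x) \<partial>lborel)"
    proof (rule mult_left_mono[OF nn_integral_mono])
      fix y
      have "dist (Re \<zeta>) (Re z0) \<le> dist \<zeta> z0" by (simp add: dist_norm abs_Re_le_cmod flip: minus_complex.sel)
      moreover have "dist \<zeta> z0 = R - d" by (simp add: d_def D_def)
      ultimately have "dist (Re \<zeta>) (Re z0) + \<rho> < R" using d by (simp add: \<rho>_def)
      then show "ennreal (p y) * indicator {Re \<zeta> - \<rho>..Re \<zeta> + \<rho>} y \<le> ennreal (p y) * indicator (ball (Re z0) R) y"
        by (auto simp: indicator_def dist_real_def)
    qed simp
    also have "\<dots> \<le> ennreal (1 / (pi * \<rho>)) * ennreal A" using A(1) by (rule mult_left_mono) simp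
    also have "\<dots> = ennreal (A / (pi * \<rho>))" using A(2) \<rho> by (simp flip: ennreal_mult)
    finally have "ennreal Z \<le> ennreal (A / (pi * \<rho>))" .
    moreover have "0 \<le> A / (pi * \<rho>)" using A(2) \<rho> by simp
    ultimately have "Z \<le> A / (pi * \<rho>)" by (simp only: ennreal_le_iff)
    also have "\<dots> \<le> 4 / 3 * A / d"
    proof -
      have "3 * A \<le> pi * A" using pi_gt3 A(2) by (intro mult_right_mono) auto
      then show ?thesis using d A(2) by (simp add: \<rho>_def field_simps)
    qed
    finally have Z: "Z \<le> 4 / 3 * A / d" .
    have sK: "sqrt K = 4 / 3 * sqrt S / d"
      using d S0 by (simp add: K_def real_sqrt_mult real_sqrt_divide)
    have "u \<zeta> \<le> K / 2 + sqrt K * (4 / 3 * A / d)"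
    proof -
      have "K * (1 / 2) \<le> K * I1" using I1 K0 by (intro mult_left_mono)
      moreover have "sqrt K * Z \<le> sqrt K * (4 / 3 * A / d)" using Z K0 by (intro mult_left_mono) auto
      ultimately show ?thesis using 1 by linarith
    qed
    then have "d\<^sup>2 * u \<zeta> \<le> d\<^sup>2 * (K / 2 + sqrt K * (4 / 3 * A / d))" by (intro mult_left_mono) auto
    also have "\<dots> = 8 / 9 * S + 16 / 9 * sqrt S * A"
      using d unfolding sK by (simp add: K_def field_simps power2_eq_square)
    finally have "S \<le> 16 * sqrt S * A" by (simp add: S_def[symmetric])
    then have "sqrt S * sqrt S \<le> sqrt S * (16 * A)" using S0 by (simp add: mult_ac)
    moreover have "0 < sqrt S" using False S0 by simp
    ultimately show ?thesis by (simp only: mult_le_cancel_left_pos)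
  qed
  have "R * sqrt (u z0) = sqrt (R\<^sup>2 * u z0)" using R by (simp add: real_sqrt_mult)
  also have "\<dots> \<le> 16 * A" using key real_sqrt_le_mono[OF R2] by linarith
  finally show ?thesis using R by (simp add: u_def field_simps)
qed

text \<open>
  A bound that only involves the projection to the real axis gives a bound by an average over the real
  axis. Compared with the real-valued version, infinite values of \<open>\<phi>\<close> are removed by cutting \<open>\<phi>\<close> off at
  the maximum of \<open>\<bar>Re G\<bar>\<^sup>1\<^sup>/\<^sup>2\<close> on the disc.
\<close>

theorem sqrt_Re_le_average:
  fixes \<phi> :: "real \<Rightarrow> ennreal"
  assumes hol: "G holomorphic_on cball z0 R" and R: "0 < R"
    and \<phi> [measurable]: "\<phi> \<in> borel_measurable borel"
    and le: "\<And>z. z \<in> cball z0 R \<Longrightarrow> ennreal (sqrt \<bar>Re (G z)\<bar>) \<le> \<phi> (Re z)"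
  shows "ennreal (sqrt \<bar>Re (G z0)\<bar>) \<le> ennreal (16 / R) * (\<integral>\<^sup>+x\<in>ball (Re z0) R. \<phi> x \<partial>lborel)"
proof (cases "(\<integral>\<^sup>+x\<in>ball (Re z0) R. \<phi> x \<partial>lborel) = top")
  case True
  then show ?thesis using R by (simp add: ennreal_mult_top)
next
  case False
  then obtain A where A: "(\<integral>\<^sup>+x\<in>ball (Re z0) R. \<phi> x \<partial>lborel) = ennreal A" "0 \<le> A"
    by (metis ennreal_cases)
  have "continuous_on (cball z0 R) (\<lambda>z. sqrt \<bar>Re (G z)\<bar>)"
    by (intro continuous_intros holomorphic_on_imp_continuous_on[OF hol])
  then have "bounded ((\<lambda>z. sqrt \<bar>Re (G z)\<bar>) ` cball z0 R)"
    by (intro compact_imp_bounded compact_continuous_image compact_cball)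
  then obtain M where "\<forall>r\<in>(\<lambda>z. sqrt \<bar>Re (G z)\<bar>) ` cball z0 R. norm r \<le> M"
    unfolding bounded_iff by blast
  then have M: "sqrt \<bar>Re (G z)\<bar> \<le> M" if "z \<in> cball z0 R" for z using that by auto
  define p where "p x = enn2real (min (\<phi> x) (ennreal M))" for x
  have p_eq: "ennreal (p x) = min (\<phi> x) (ennreal M)" for x
    unfolding p_def by (rule ennreal_enn2real) (simp add: min_less_iff_disj)
  have "sqrt \<bar>Re (G z0)\<bar> \<le> 16 / R * A"
  proof (rule sqrt_Re_le_average_aux[OF hol R, of p])
    show "p \<in> borel_measurable borel" unfolding p_def by measurable
    show "sqrt \<bar>Re (G z)\<bar> \<le> p (Re z)" if "z \<in> cball z0 R" for z
    proof -
      have "ennreal (sqrt \<bar>Re (G z)\<bar>) \<le> ennreal (p (Re z))"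
        unfolding p_eq using le[OF that] M[OF that] by (simp add: ennreal_leI)
      then show ?thesis by (simp add: p_def)
    qed
    have "(\<integral>\<^sup>+x\<in>ball (Re z0) R. ennreal (p x) \<partial>lborel) \<le> (\<integral>\<^sup>+x\<in>ball (Re z0) R. \<phi> x \<partial>lborel)"
      unfolding p_eq by (intro nn_integral_mono mult_right_mono) auto
    then show "(\<integral>\<^sup>+x\<in>ball (Re z0) R. ennreal (p x) \<partial>lborel) \<le> ennreal A" using A by simp
  qed (rule A(2))
  then show ?thesis unfolding A using R A(2) by (simp flip: ennreal_mult'')
qed

text \<open>
  With \<open>G = u + i v\<close> and \<open>w = x y\<close> one has
  \<open>Re (z G dz) + d (w v) = u (x dx - y dy) + w dv\<close>.
  The conjugate function \<open>v\<close> itself disappears: only \<open>u\<close> and the derivative of \<open>G\<close> remain on the right.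
\<close>

lemma moment_along_segment:
  assumes S: "open S" "G holomorphic_on S" "closed_segment p q \<subseteq> S"
    and B: "\<And>z. z \<in> closed_segment p q \<Longrightarrow> \<bar>Re (G z)\<bar> * norm z + \<bar>Re z * Im z\<bar> * norm (deriv G z) \<le> B"
  shows "\<bar>Re (contour_integral (linepath p q) (\<lambda>z. z * G z))
      + (Re q * Im q * Im (G q) - Re p * Im p * Im (G p))\<bar> \<le> B * norm (q - p)"
proof -
  let ?I = "contour_integral (linepath p q) (\<lambda>z. z * G z)"
  define \<gamma> where "\<gamma> = linepath p q"
  have \<gamma>_in: "\<gamma> t \<in> closed_segment p q" if "t \<in> {0..1}" for t
    using that linepath_in_path[of t p q] by (simp add: \<gamma>_def)
  have "(\<lambda>z. z * G z) contour_integrable_on linepath p q"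
    by (intro contour_integrable_holomorphic_simple[OF _ S(1)] holomorphic_intros S(2)) (use S(3) in auto)
  then have "((\<lambda>z. z * G z) has_contour_integral ?I) (linepath p q)"
    by (rule has_contour_integral_integral)
  then have "((\<lambda>t. \<gamma> t * G (\<gamma> t) * (q - p)) has_integral ?I) {0..1}"
    by (simp add: has_contour_integral_linepath \<gamma>_def)
  from has_integral_linear[OF this bounded_linear_Re]
  have 1: "((\<lambda>t. Re (\<gamma> t * G (\<gamma> t) * (q - p))) has_integral Re (?I)) {0..1}"
    by (simp add: o_def)
  define \<Psi>' where "\<Psi>' t = (Re (\<gamma> t) * Im (q - p) + Re (q - p) * Im (\<gamma> t)) * Im (G (\<gamma> t))
      + Re (\<gamma> t) * Im (\<gamma> t) * Im ((q - p) * deriv G (\<gamma> t))" for t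
  have 2: "(\<Psi>' has_integral (Re (\<gamma> 1) * Im (\<gamma> 1) * Im (G (\<gamma> 1)) - Re (\<gamma> 0) * Im (\<gamma> 0) * Im (G (\<gamma> 0)))) {0..1}"
  proof (rule fundamental_theorem_of_calculus)
    fix t :: real assume t: "t \<in> {0..1}"
    have d\<gamma>: "(\<gamma> has_vector_derivative (q - p)) (at t within {0..1})"
      unfolding \<gamma>_def by (rule has_vector_derivative_linepath_within)
    have "\<gamma> t \<in> S" using S(3) \<gamma>_in[OF t] by blast
    then have "(G has_field_derivative deriv G (\<gamma> t)) (at (\<gamma> t))"
      by (rule holomorphic_derivI[OF S(2,1)])
    then have "((G \<circ> \<gamma>) has_vector_derivative (q - p) * deriv G (\<gamma> t)) (at t within {0..1})"
      by (rule field_vector_diff_chain_within[OF d\<gamma> has_field_derivative_at_within])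
    then have dG: "((\<lambda>t. Im (G (\<gamma> t))) has_real_derivative Im ((q - p) * deriv G (\<gamma> t))) (at t within {0..1})"
      unfolding has_real_derivative_iff_has_vector_derivative
      by (auto dest!: bounded_linear.has_vector_derivative[OF bounded_linear_Im] simp: o_def)
    have dR: "((\<lambda>t. Re (\<gamma> t)) has_real_derivative Re (q - p)) (at t within {0..1})"
      "((\<lambda>t. Im (\<gamma> t)) has_real_derivative Im (q - p)) (at t within {0..1})"
      unfolding has_real_derivative_iff_has_vector_derivative
      using bounded_linear.has_vector_derivative[OF bounded_linear_Re d\<gamma>]
        bounded_linear.has_vector_derivative[OF bounded_linear_Im d\<gamma>] by simp_all
    have "((\<lambda>t. Re (\<gamma> t) * Im (\<gamma> t) * Im (G (\<gamma> t))) has_real_derivative \<Psi>' t) (at t within {0..1})"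
      by (rule DERIV_cong[OF DERIV_mult[OF DERIV_mult[OF dR] dG]]) (simp add: \<Psi>'_def algebra_simps)
    then show "((\<lambda>t. Re (\<gamma> t) * Im (\<gamma> t) * Im (G (\<gamma> t))) has_vector_derivative \<Psi>' t) (at t within {0..1})"
      unfolding has_real_derivative_iff_has_vector_derivative .
  qed simp
  let ?W = "(Re (\<gamma> 1) * Im (\<gamma> 1) * Im (G (\<gamma> 1)) - Re (\<gamma> 0) * Im (\<gamma> 0) * Im (G (\<gamma> 0)))"
  have "norm (Re (?I) + ?W)
      \<le> (B * norm (q - p)) * Henstock_Kurzweil_Integration.content (cbox 0 (1::real))"
  proof (rule has_integral_bound)
    have "0 \<le> \<bar>Re (G p)\<bar> * norm p + \<bar>Re p * Im p\<bar> * norm (deriv G p)" by simp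
    also have "\<dots> \<le> B" by (rule B) simp
    finally show "0 \<le> B * norm (q - p)" by simp
    show "((\<lambda>t. Re (\<gamma> t * G (\<gamma> t) * (q - p)) + \<Psi>' t) has_integral (Re (?I) + ?W)) (cbox 0 1)"
      using has_integral_add[OF 1 2] by simp
  next
    fix t :: real assume "t \<in> cbox 0 1"
    then have t: "\<gamma> t \<in> closed_segment p q" using \<gamma>_in by simp
    have "Re (\<gamma> t * G (\<gamma> t) * (q - p)) + \<Psi>' t
       = Re (G (\<gamma> t)) * Re (\<gamma> t * (q - p)) + Re (\<gamma> t) * Im (\<gamma> t) * Im ((q - p) * deriv G (\<gamma> t))"
      by (simp add: \<Psi>'_def algebra_simps)
    also have "norm \<dots> \<le> \<bar>Re (G (\<gamma> t))\<bar> * norm (\<gamma> t * (q - p)) + \<bar>Re (\<gamma> t) * Im (\<gamma> t)\<bar> * norm ((q - p) * deriv G (\<gamma> t))"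
      unfolding real_norm_def
      by (intro order_trans[OF abs_triangle_ineq] add_mono)
         (simp_all only: abs_mult, (intro mult_left_mono abs_Re_le_cmod abs_Im_le_cmod mult_nonneg_nonneg abs_ge_zero)+)
    also have "\<dots> = (\<bar>Re (G (\<gamma> t))\<bar> * norm (\<gamma> t) + \<bar>Re (\<gamma> t) * Im (\<gamma> t)\<bar> * norm (deriv G (\<gamma> t))) * norm (q - p)"
      by (simp only: norm_mult distrib_right distrib_left mult_ac)
    also have "\<dots> \<le> B * norm (q - p)" by (intro mult_right_mono B t) simp
    finally show "norm (Re (\<gamma> t * G (\<gamma> t) * (q - p)) + \<Psi>' t) \<le> B * norm (q - p)" .
  qed
  then show ?thesis by (simp add: \<gamma>_def linepath_def)
qed

text \<open>
  Cauchy's theorem for \<open>z G(z)\<close> on the triangle with vertices \<open>a\<close>, \<open>b\<close> and \<open>c = a + i (b - a)\<close>. The boundary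
  terms \<open>w v\<close> of the two upper sides cancel at \<open>c\<close> and vanish at \<open>a\<close> and \<open>b\<close>.
\<close>

theorem moment_on_interval:
  assumes S: "open S" "convex S" "G holomorphic_on S" and ab: "a < b"
    and c: "c = Complex a (b - a)" "of_real a \<in> S" "of_real b \<in> S" "c \<in> S"
    and B: "\<And>z. z \<in> closed_segment (of_real b) c \<union> closed_segment c (of_real a) \<Longrightarrow>
      \<bar>Re (G z)\<bar> * norm z + \<bar>Re z * Im z\<bar> * norm (deriv G z) \<le> B"
  shows "\<bar>integral {a..b} (\<lambda>x. x * Re (G (of_real x)))\<bar> \<le> 3 * (b - a) * B"
proof -
  let ?f = "\<lambda>z. z * G z"
  have seg: "closed_segment p q \<subseteq> S" if "p \<in> S" "q \<in> S" for p q
    using S(2) that by (meson convex_contains_segment)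
  have hull: "convex hull {of_real a, of_real b, c} \<subseteq> S"
    using c S(2) by (intro hull_minimal) auto
  have "?f holomorphic_on S" by (intro holomorphic_intros S(3))
  then have "(?f has_contour_integral 0) (linepath (of_real a) (of_real b) +++ linepath (of_real b) c +++ linepath c (of_real a))"
    using hull by (intro Cauchy_theorem_triangle) (rule holomorphic_on_subset)
  moreover have int: "?f contour_integrable_on linepath p q" if "p \<in> S" "q \<in> S" for p q
    by (intro contour_integrable_holomorphic_simple[OF _ S(1)] holomorphic_intros S(3)) (use seg that in auto)
  ultimately have zero: "contour_integral (linepath (of_real a) (of_real b)) ?f
      + (contour_integral (linepath (of_real b) c) ?f + contour_integral (linepath c (of_real a)) ?f) = 0"
    using c by (simp add: contour_integral_unique contour_integrable_joinI flip: contour_integral_join)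
  have real: "Re (contour_integral (linepath (of_real a) (of_real b)) ?f) = integral {a..b} (\<lambda>x. x * Re (G (of_real x)))"
  proof -
    have "(?f has_contour_integral contour_integral (linepath (of_real a) (of_real b)) ?f) (linepath (of_real a) (of_real b))"
      using int c by (intro has_contour_integral_integral) auto
    then have "((\<lambda>x. ?f (of_real x)) has_integral contour_integral (linepath (of_real a) (of_real b)) ?f) {a..b}"
      using ab by (subst (asm) has_contour_integral_linepath_Reals_iff) auto
    from has_integral_linear[OF this bounded_linear_Re]
    show ?thesis by (simp add: o_def integral_unique)
  qed
  have "\<bar>Re (contour_integral (linepath (of_real b) c) ?f) + (Re c * Im c * Im (G c) - 0)\<bar> \<le> B * norm (c - of_real b)"
    using moment_along_segment[OF S(1,3) seg[OF c(3,4)], of B] B by simp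
  moreover have "\<bar>Re (contour_integral (linepath c (of_real a)) ?f) + (0 - Re c * Im c * Im (G c))\<bar> \<le> B * norm (of_real a - c)"
    using moment_along_segment[OF S(1,3) seg[OF c(4,2)], of B] B by simp
  moreover have "Re (contour_integral (linepath (of_real a) (of_real b)) ?f)
      + (Re (contour_integral (linepath (of_real b) c) ?f) + Re (contour_integral (linepath c (of_real a)) ?f)) = 0"
    using arg_cong[OF zero, of Re] by simp
  ultimately have "\<bar>integral {a..b} (\<lambda>x. x * Re (G (of_real x)))\<bar> \<le> B * norm (c - of_real b) + B * norm (of_real a - c)"
    unfolding real[symmetric] by linarith
  also have "\<dots> \<le> B * (2 * (b - a)) + B * (b - a)"
  proof -
    have "0 \<le> \<bar>Re (G c)\<bar> * norm c + \<bar>Re c * Im c\<bar> * norm (deriv G c)" by simp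
    also have "\<dots> \<le> B" by (rule B) simp
    finally have B0: "0 \<le> B" .
    have 1: "norm (c - of_real b) \<le> 2 * (b - a)"
      using cmod_le[of "c - of_real b"] ab by (simp add: c(1))
    have 2: "norm (of_real a - c) \<le> b - a"
      using cmod_le[of "of_real a - c"] ab by (simp add: c(1))
    show ?thesis by (rule add_mono[OF mult_left_mono[OF 1 B0] mult_left_mono[OF 2 B0]])
  qed
  also have "\<dots> = 3 * (b - a) * B" by (simp add: algebra_simps)
  finally show ?thesis .
qed

section \<open>Atoms from weighted level sets\<close>

lemma
  fixes a b :: real
  assumes "a \<le> b"
  shows set_integrable_ident_Icc: "set_integrable lborel {a..b} (\<lambda>x. x)"
    and set_integral_ident_Icc: "(LINT x:{a..b}|lborel. x) = (b\<^sup>2 - a\<^sup>2) / 2"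
proof -
  show i: "set_integrable lborel {a..b} (\<lambda>x. x)"
    by (rule borel_integrable_atLeastAtMost'[OF continuous_on_id])
  show "(LINT x:{a..b}|lborel. x) = (b\<^sup>2 - a\<^sup>2) / 2"
    unfolding set_borel_integral_eq_integral(2)[OF i] using ident_has_integral[OF assms] by (rule integral_unique)
qed

text \<open>
  A pointwise bound by the density \<open>x\<close>, normalised on the interval, implies the quadratic bound of an atom. The
  end points have to be added to the interval because the support of an atom is closed in \<open>(0, \<infinity>)\<close>.
\<close>

lemma atom_onI:
  fixes \<phi> :: "real \<Rightarrow> complex"
  assumes ab: "0 \<le> a" "a < b"
    and \<phi> [measurable]: "\<phi> \<in> borel_measurable borel"
    and off: "\<And>x. x \<notin> {a<..<b} \<Longrightarrow> \<phi> x = 0"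
    and le: "\<And>x. x \<in> {a<..<b} \<Longrightarrow> norm (\<phi> x) \<le> x / ((b\<^sup>2 - a\<^sup>2) / 2)"
    and zero: "(LINT x|lborel. \<phi> x * complex_of_real x) = 0"
  shows "atom_on ({a..b} \<inter> {0<..}) \<phi>"
    and "(\<integral>\<^sup>+x. ennreal (norm (\<phi> x)) \<partial>lborel) \<le> 1"
proof -
  let ?X = "\<lambda>x. indicator {a..b} x *\<^sub>R x"
  let ?N = "\<lambda>x. (norm (\<phi> x))\<^sup>2 / x"
  define m where "m = (b\<^sup>2 - a\<^sup>2) / 2"
  let ?B = "{a..b} \<inter> {0<..}"
  have m: "0 < m" using ab by (simp add: m_def power_strict_mono)
  have int: "integrable lborel (\<lambda>x. ?X x)" "(LINT x|lborel. ?X x) = m"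
    using set_integrable_ident_Icc[of a b] set_integral_ident_Icc[of a b] ab
    by (simp_all add: set_integrable_def set_lebesgue_integral_def m_def)
  have le': "norm (\<phi> x) \<le> ?X x / m" for x
    using le[of x] off[of x] ab m by (cases "x \<in> {a<..<b}") (auto simp: m_def indicator_def)
  have bx: "indicator ?B x *\<^sub>R x = ?X x" for x :: real
    using ab by (auto simp: indicator_def)
  have int1: "integrable lborel (\<lambda>x. \<phi> x * complex_of_real x)"
  proof (rule Bochner_Integration.integrable_bound[OF integrable_mult_right[OF int(1), of "b / m"]])
    show "AE x in lborel. norm (\<phi> x * complex_of_real x) \<le> norm (b / m * (?X x))"
    proof (rule AE_I2)
      fix x
      show "norm (\<phi> x * complex_of_real x) \<le> norm (b / m * (?X x))"
      proof (cases "x \<in> {a<..<b}")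
        case True
        then have "norm (\<phi> x) * x \<le> (x / m) * b"
          using le'[of x] ab m by (intro mult_mono) (auto simp: indicator_def)
        then show ?thesis using True ab m by (simp add: norm_mult abs_mult mult_ac)
      qed (simp add: off)
    qed
  qed simp
  have int2: "integrable lborel (\<lambda>x. ?N x)"
    and le2: "(LINT x|lborel. ?N x) \<le> 1 / m"
  proof -
    have *: "?N x \<le> 1 / m\<^sup>2 * (?X x)" "0 \<le> ?N x" for x
    proof -
      have "?N x \<le> 1 / m\<^sup>2 * (?X x) \<and> 0 \<le> ?N x"
      proof (cases "x \<in> {a<..<b}")
        case True
        then have x: "0 < x" "x \<in> {a..b}" using ab by auto
        have "(norm (\<phi> x))\<^sup>2 \<le> (x / m)\<^sup>2"
          using le'[of x] x by (intro power_mono) auto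
        then have "?N x \<le> (x / m)\<^sup>2 / x" using x by (intro divide_right_mono) auto
        also have "\<dots> = 1 / m\<^sup>2 * x" using x by (simp add: power2_eq_square)
        finally show ?thesis using x by simp
      next
        case False
        then show ?thesis using off[OF False] ab by (auto simp: indicator_def)
      qed
      then show "?N x \<le> 1 / m\<^sup>2 * (?X x)" "0 \<le> ?N x" by auto
    qed
    show i: "integrable lborel (\<lambda>x. ?N x)"
      by (rule Bochner_Integration.integrable_bound[OF integrable_mult_right[OF int(1), of "1 / m\<^sup>2"]])
         (simp, rule AE_I2, simp only: real_norm_def abs_of_nonneg[OF *(2)] order_trans[OF *(1) abs_ge_self])
    have "(LINT x|lborel. ?N x) \<le> (LINT x|lborel. 1 / m\<^sup>2 * (?X x))"
      by (rule integral_mono[OF i integrable_mult_right[OF int(1)]]) (rule *)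
    also have "\<dots> = 1 / m\<^sup>2 * m" unfolding int(2)[symmetric] by (rule integral_mult_right_zero)
    finally show "(LINT x|lborel. ?N x) \<le> 1 / m" using m by (simp add: power2_eq_square)
  qed
  have "(\<integral>\<^sup>+x. ennreal (norm (\<phi> x)) \<partial>lborel) \<le> (\<integral>\<^sup>+x. ennreal (?X x / m) \<partial>lborel)"
    using le' by (intro nn_integral_mono ennreal_leI)
  also have "\<dots> = ennreal (LINT x|lborel. ?X x / m)"
    using int(1) m ab by (intro nn_integral_eq_integral) (auto simp: indicator_def)
  also have "(LINT x|lborel. ?X x / m) = 1"
    using int(2) m by simp
  finally show "(\<integral>\<^sup>+x. ennreal (norm (\<phi> x)) \<partial>lborel) \<le> 1" by simp
  have zeroB: "indicator ?B x *\<^sub>R (\<phi> x * complex_of_real x) = \<phi> x * complex_of_real x"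
      "indicator ?B x *\<^sub>R (?N x) = ?N x" for x
    by (cases "x \<in> {a<..<b}"; use ab in \<open>auto simp: indicator_def off\<close>)+
  have "{x \<in> {0<..}. \<phi> x \<noteq> 0} \<subseteq> {a<..<b}" using off by blast
  then have "closure {x \<in> {0<..}. \<phi> x \<noteq> 0} \<subseteq> {a..b}"
    by (intro closure_minimal) auto
  moreover have "{a<..<b} \<subseteq> interior ?B" using ab by (intro interior_maximal) auto
  then have "interior ?B \<noteq> {}" using ab by (metis dense greaterThanLessThan_empty_iff subset_empty linorder_not_less)
  moreover have "is_interval ?B" by (intro is_interval_Int) (auto simp: is_interval_1)
  moreover have "bounded ?B" by (rule bounded_subset[OF bounded_closed_interval]) auto
  moreover have "(LINT x:?B|lborel. ?N x) powr (1/2) \<le> (LINT x:?B|lborel. x) powr (-1/2)"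
  proof -
    have "(LINT x|lborel. ?N x) powr (1/2) \<le> (1 / m) powr (1/2)"
    proof (rule powr_mono2)
      have "0 \<le> ?N x" for x
        using off[of x] ab by (cases "x \<in> {a<..<b}") auto
      then show "0 \<le> (LINT x|lborel. ?N x)" by (rule Bochner_Integration.integral_nonneg)
    qed (use le2 in auto)
    also have "\<dots> = m powr (-1/2)" using m by (simp add: powr_divide powr_minus_divide)
    finally show ?thesis unfolding set_lebesgue_integral_def zeroB(2) bx int(2) .
  qed
  ultimately show "atom_on ?B \<phi>"
    unfolding atom_on_def set_integrable_def set_lebesgue_integral_def zeroB using zero int1 int2
    by (auto simp: half_line_def intro!: measurable_restrict_space1)
qed

lemma atom_on_zero: "atom_on {0<..1} (\<lambda>x. 0)"
proof -
  have "{0..1} \<inter> {0<..} = {0<..1 :: real}" by auto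
  then show ?thesis using atom_onI(1)[of 0 1 "\<lambda>x. 0"] by simp
qed

text \<open>
  The end points of a component of an open set do not belong to the open set, since otherwise the component
  could be enlarged.
\<close>

lemma open_component_greaterThanLessThan:
  fixes U :: "real set"
  assumes U: "open U" "bdd_below U" and I: "I \<in> components U" "bdd_above I"
  obtains a b where "a < b" "I = {a<..<b}" "a \<notin> U" "b \<notin> U"
proof -
  have sub: "I \<subseteq> U" and ne: "I \<noteq> {}" and con: "connected I" and op: "open I"
    using I(1) U(1) by (auto simp: in_components_subset in_components_nonempty in_components_connected open_components)
  have bb: "bdd_below I" using U(2) sub by (rule bdd_below_mono)
  define a b where "a = Inf I" and "b = Sup I"
  have not: "a \<notin> I" "b \<notin> I"
  proof -
    show "a \<notin> I"
    proof
      assume "a \<in> I"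
      then obtain e where "0 < e" "ball a e \<subseteq> I" using op openE by blast
      then have "a - e / 2 \<in> I" by (auto simp: subset_iff dist_real_def)
      then show False using cInf_lower[OF _ bb] \<open>0 < e\<close> by (force simp: a_def)
    qed
    show "b \<notin> I"
    proof
      assume "b \<in> I"
      then obtain e where "0 < e" "ball b e \<subseteq> I" using op openE by blast
      then have "b + e / 2 \<in> I" by (auto simp: subset_iff dist_real_def)
      then show False using cSup_upper[OF _ I(2)] \<open>0 < e\<close> by (force simp: b_def)
    qed
  qed
  have bounds: "a < x" "x < b" if "x \<in> I" for x
    using cInf_lower[OF that bb] cSup_upper[OF that I(2)] that not by (auto simp: a_def b_def less_le)
  have eq: "I = {a<..<b}"
  proof (intro equalityI subsetI)
    fix x assume x: "x \<in> {a<..<b}"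
    obtain y where y: "y \<in> I" "y < x" using x ne bb by (auto simp: a_def cInf_less_iff)
    obtain z where z: "z \<in> I" "x < z" using x ne I(2) by (auto simp: b_def less_cSup_iff)
    show "x \<in> I" using connected_contains_Icc[OF con y(1) z(1)] y z by auto
  qed (use bounds in auto)
  have ab: "a < b" using ne eq by auto
  have mid: "(a + b) / 2 \<in> {a<..<b}" using ab by auto
  have max: "J \<subseteq> I" if "connected J" "J \<subseteq> U" "J \<inter> I \<noteq> {}" for J
    using components_maximal[OF I(1) that(1,2)] that(3) by blast
  have "a \<notin> U"
  proof
    assume "a \<in> U"
    then have "{a..<b} \<subseteq> U"
      unfolding ivl_disj_un_singleton(3)[OF ab, symmetric] using sub eq by blast
    moreover have "(a + b) / 2 \<in> {a..<b} \<inter> I" using mid eq by auto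
    then have "{a..<b} \<inter> I \<noteq> {}" by blast
    ultimately have "{a..<b} \<subseteq> I" by (intro max) auto
    then show False using not ab by auto
  qed
  moreover have "b \<notin> U"
  proof
    assume "b \<in> U"
    then have "{a<..b} \<subseteq> U"
      unfolding ivl_disj_un_singleton(4)[OF ab, symmetric] using sub eq by blast
    moreover have "(a + b) / 2 \<in> {a<..b} \<inter> I" using mid eq by auto
    then have "{a<..b} \<inter> I \<noteq> {}" by blast
    ultimately have "{a<..b} \<subseteq> I" by (intro max) auto
    then show False using not ab by auto
  qed
  ultimately show thesis using that ab eq by blast
qed

lemma countable_components_open:
  fixes U :: "real set"
  assumes "open U"
  shows "countable (components U)"
proof (rule countable_disjoint_open_subsets)
  show "pairwise disjnt (components U)"
    using pairwise_disjoint_components[of U] by (simp add: pairwise_def disjnt_def)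
qed (use assms open_components in blast)

text \<open>
  The components are countably many disjoint open sets.
\<close>

lemma integral_zero_by_components:
  fixes \<phi> :: "real \<Rightarrow> complex"
  assumes U: "open U" and int: "integrable lborel \<phi>" and off: "\<And>x. x \<notin> U \<Longrightarrow> \<phi> x = 0"
    and zero: "\<And>J. J \<in> components U \<Longrightarrow> (LINT x:J|lborel. \<phi> x) = 0"
  shows "(LINT x|lborel. \<phi> x) = 0"
proof -
  define \<C> where "\<C> = components U"
  have cnt: "countable \<C>" unfolding \<C>_def by (rule countable_components_open[OF U])
  define A where "A n = (if n \<in> to_nat_on \<C> ` \<C> then from_nat_into \<C> n else {})" for n
  have A: "A n \<in> \<C> \<or> A n = {}" for n using cnt by (auto simp: A_def)
  have A_to: "A (to_nat_on \<C> J) = J" if "J \<in> \<C>" for J using that cnt by (simp add: A_def)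
  have UA: "(\<Union>n. A n) = U"
  proof -
    have "(\<Union>n. A n) = \<Union>\<C>" using A A_to by blast
    then show ?thesis by (simp add: \<C>_def)
  qed
  have inj: "m = n" if "A m = A n" "A m \<noteq> {}" for m n
    using that cnt by (auto simp: A_def split: if_splits)
  have "(LINT x:(\<Union>n. A n)|lborel. \<phi> x) = (\<Sum>n. LINT x:A n|lborel. \<phi> x)"
  proof (rule lebesgue_integral_countable_add)
    show "A n \<in> sets lborel" for n
      using A[of n] open_components[OF U] by (auto simp: \<C>_def)
    show "A m \<inter> A n = {}" if "m \<noteq> n" for m n
      using A[of m] A[of n] inj[of m n] that components_nonoverlap[of "A m" U "A n"] by (auto simp: \<C>_def)
    show "set_integrable lborel (\<Union>n. A n) \<phi>"
      unfolding UA set_integrable_def using int U by (intro integrable_mult_indicator) auto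
  qed
  also have "\<dots> = 0"
  proof -
    have "(LINT x:A n|lborel. \<phi> x) = 0" for n using A[of n] zero by (auto simp: \<C>_def set_lebesgue_integral_def[of _ "{}"])
    then show ?thesis by simp
  qed
  also have "(LINT x:(\<Union>n. A n)|lborel. \<phi> x) = (LINT x|lborel. \<phi> x)"
    unfolding UA set_lebesgue_integral_def using off by (intro Bochner_Integration.integral_cong) (auto simp: indicator_def)
  finally show ?thesis .
qed

text \<open>
  Distinct powers of two are dominated by the next larger power.
\<close>

lemma sum_powi_less:
  assumes "finite K" "\<And>k. k \<in> K \<Longrightarrow> k \<le> m"
  shows "(\<Sum>k\<in>K. 2 powi k) < (2 :: real) powi (m + 1)"
  using assms
proof (induction K arbitrary: m rule: finite_linorder_max_induct)
  case (insert b A)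
  have "(\<Sum>k\<in>A. 2 powi k) < (2 :: real) powi (b - 1 + 1)" using insert.hyps(2) by (intro insert.IH) force
  moreover have "(2 :: real) powi (b + 1) \<le> 2 powi (m + 1)" using insert.prems by (intro power_int_increasing) auto
  moreover have "(2 :: real) powi (b + 1) = 2 powi b + 2 powi b" by (simp add: power_int_add)
  moreover have "(\<Sum>k\<in>insert b A. 2 powi k) = (2 :: real) powi b + (\<Sum>k\<in>A. 2 powi k)"
    using insert.hyps by (subst sum.insert) auto
  ultimately show ?case by simp
qed simp

lemma sum_powi_le:
  assumes K: "finite K" "\<And>k. k \<in> K \<Longrightarrow> 2 powi k \<le> q" and q: "0 \<le> q"
  shows "(\<Sum>k\<in>K. 2 powi k) \<le> 2 * (q :: real)"
proof (cases "K = {}")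
  case False
  have "(\<Sum>k\<in>K. 2 powi k) < (2 :: real) powi (Max K + 1)" using K by (intro sum_powi_less) auto
  also have "\<dots> = 2 * 2 powi Max K" by (simp add: power_int_add)
  also have "\<dots> \<le> 2 * q" using K False by simp
  finally show ?thesis by simp
qed (use q in simp)

text \<open>
  The partial sums of the tail are bounded by those of the norms; the right-hand side is infinite if the series
  converges only conditionally.
\<close>

lemma norm_tail_le:
  fixes g :: "nat \<Rightarrow> complex"
  assumes "g sums s"
  shows "ennreal (norm (s - (\<Sum>k<n. g k))) \<le> (\<Sum>k. ennreal (norm (g (k + n))))"
proof -
  have "(\<lambda>k. g (k + n)) sums (s - (\<Sum>k<n. g k))" using assms by (simp add: sums_iff_shift)
  then have "(\<lambda>m. ennreal (norm (\<Sum>k<m. g (k + n)))) \<longlonglongrightarrow> ennreal (norm (s - (\<Sum>k<n. g k)))"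
    unfolding sums_def by (intro tendsto_ennrealI tendsto_norm)
  then show ?thesis
  proof (rule LIMSEQ_le_const2, intro exI allI impI)
    fix m
    have "ennreal (norm (\<Sum>k<m. g (k + n))) \<le> ennreal (\<Sum>k<m. norm (g (k + n)))"
      by (intro ennreal_leI norm_sum)
    also have "\<dots> = (\<Sum>k<m. ennreal (norm (g (k + n))))" by (subst sum_ennreal) auto
    also have "\<dots> \<le> (\<Sum>k. ennreal (norm (g (k + n))))" by (intro sum_le_suminf) auto
    finally show "ennreal (norm (\<Sum>k<m. g (k + n))) \<le> (\<Sum>k. ennreal (norm (g (k + n))))" .
  qed
qed

lemma L1_convergence_of_AE_sums:
  fixes f :: "'a \<Rightarrow> complex"
  assumes [measurable]: "\<And>n. a n \<in> borel_measurable M"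
    and a: "\<And>n. (\<integral>\<^sup>+x. ennreal (norm (a n x)) \<partial>M) \<le> 1"
    and l: "summable (\<lambda>n. norm (l n))"
    and sums: "AE x in M. (\<lambda>n. l n * a n x) sums f x"
  shows "(\<lambda>n. \<integral>\<^sup>+x. ennreal (norm (f x - (\<Sum>k<n. l k * a k x))) \<partial>M) \<longlonglongrightarrow> 0"
proof (rule tendsto_sandwich[OF _ _ tendsto_const])
  let ?E = "\<lambda>n. (\<integral>\<^sup>+x. ennreal (norm (f x - (\<Sum>k<n. l k * a k x))) \<partial>M)"
  let ?g = "\<lambda>n k x. ennreal (norm (l (k + n) * a (k + n) x))"
  let ?T = "\<lambda>n. \<Sum>k. norm (l (k + n))"
  have ls: "summable (\<lambda>k. norm (l (k + n)))" for n using l by (subst summable_iff_shift)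
  have "?T = (\<lambda>n. (\<Sum>k. norm (l k)) - (\<Sum>k<n. norm (l k)))"
    using suminf_minus_initial_segment[OF l] by auto
  moreover have "(\<lambda>n. (\<Sum>k. norm (l k)) - (\<Sum>k<n. norm (l k))) \<longlonglongrightarrow> (\<Sum>k. norm (l k)) - (\<Sum>k. norm (l k))"
    by (intro tendsto_diff tendsto_const summable_LIMSEQ l)
  ultimately have "?T \<longlonglongrightarrow> 0" by simp
  from tendsto_ennrealI[OF this] show "(\<lambda>n. ennreal (?T n)) \<longlonglongrightarrow> 0" by simp
  show "\<forall>\<^sub>F n in sequentially. (?E n) \<le> ennreal (?T n)"
  proof (rule always_eventually, rule allI)
    fix n
    have "(?E n)
        \<le> (\<integral>\<^sup>+x. (\<Sum>k. ?g n k x) \<partial>M)"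
      using sums by (intro nn_integral_mono_AE) (auto elim!: eventually_mono intro: norm_tail_le)
    also have "\<dots> = (\<Sum>k. \<integral>\<^sup>+x. ?g n k x \<partial>M)"
      by (rule nn_integral_suminf) measurable
    also have "\<dots> \<le> (\<Sum>k. ennreal (norm (l (k + n))))"
    proof (rule suminf_le)
      fix k
      have "(\<integral>\<^sup>+x. ?g n k x \<partial>M)
          = ennreal (norm (l (k + n))) * (\<integral>\<^sup>+x. ennreal (norm (a (k + n) x)) \<partial>M)"
        by (subst nn_integral_cmult[symmetric]) (auto simp: norm_mult ennreal_mult)
      also have "\<dots> \<le> ennreal (norm (l (k + n))) * 1" by (intro mult_left_mono a) simp
      finally show "(\<integral>\<^sup>+x. ?g n k x \<partial>M) \<le> ennreal (norm (l (k + n)))" by simp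
    qed auto
    also have "\<dots> = ennreal (?T n)" by (rule suminf_ennreal2[OF _ ls]) simp
    finally show "(?E n) \<le> ennreal (?T n)" .
  qed
qed simp

text \<open>
  What the decomposition into atoms needs to know about \<open>f\<close>: a lower semicontinuous integrable majorant \<open>N\<close>,
  up to the factor \<open>2\<close>, such that the moment of \<open>f\<close> over an interval is controlled by the values of \<open>N\<close> at its end
  points. An end point \<open>0\<close> counts as controlled, because the odd extension of \<open>f\<close> has a harmonic extension that
  vanishes above it. The size \<open>\<tau> b\<^sup>2 (b - a)\<close> is that of the moment of \<open>\<tau> x\<close>.
\<close>

locale moment_control =
  fixes f :: "real \<Rightarrow> complex" and N :: "real \<Rightarrow> ennreal" and C :: real
  assumes f_meas [measurable]: "f \<in> borel_measurable borel"
    and N_open: "\<And>c. open {x. c < N x}"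
    and N_int: "(\<integral>\<^sup>+x\<in>{0<..}. N x \<partial>lborel) < \<infinity>"
    and f_le: "\<And>x. 0 < x \<Longrightarrow> ennreal (norm (f x)) \<le> 2 * N x"
    and C_ge: "1 \<le> C"
    and moment: "\<And>a b \<tau>. 0 \<le> a \<Longrightarrow> a < b \<Longrightarrow> 0 < \<tau> \<Longrightarrow> a = 0 \<or> N a \<le> ennreal (\<tau> * a) \<Longrightarrow> N b \<le> ennreal (\<tau> * b) \<Longrightarrow>
        norm (LINT x:{a<..<b}|lborel. f x * of_real x) \<le> C * \<tau> * b\<^sup>2 * (b - a)"
begin

text \<open>
  The superlevel set of \<open>N(x) / x\<close> at height \<open>2\<^sup>k\<close>.
\<close>

definition level :: "int \<Rightarrow> real set" where
  "level k = {x. 0 < x \<and> ennreal (2 powi k * x) < N x}"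

text \<open>
  The multiple of \<open>x\<close> with this slope has the same moment over \<open>I\<close> as \<open>f\<close>.
\<close>

definition slope :: "real set \<Rightarrow> complex" where
  "slope I = (LINT y:I|lborel. f y * of_real y) / of_real (LINT y:I|lborel. y\<^sup>2)"

definition good :: "int \<Rightarrow> real \<Rightarrow> complex" where
  "good k x = (if x \<in> level k then slope (connected_component_set (level k) x) * of_real x else f x)"

lemma N_measurable [measurable]: "N \<in> borel_measurable borel"
  by (rule borel_measurableI_greater) (use N_open in auto)

lemma open_level: "open (level k)"
proof -
  have "level k = (\<Union>c. {0<..} \<inter> {x. ennreal (2 powi k * x) < c} \<inter> {x. c < N x})"
    unfolding level_def by (auto dest: dense intro: less_trans)
  moreover have "open {x. ennreal (2 powi k * x) < c}" for c
    by (intro open_Collect_less continuous_on_ennreal continuous_intros)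
  ultimately show ?thesis using N_open by (auto intro!: open_UN open_Int)
qed

lemma level_measurable [measurable]: "level k \<in> sets borel"
  using open_level by (rule borel_open)

lemma level_pos: "x \<in> level k \<Longrightarrow> 0 < x"
  by (simp add: level_def)

lemma level_mono: "level (k + 1) \<subseteq> level k"
proof
  fix x assume x: "x \<in> level (k + 1)"
  then have "2 powi k * x \<le> 2 powi (k + 1) * x"
    by (simp add: level_def power_int_add)
  then have "ennreal (2 powi k * x) \<le> ennreal (2 powi (k + 1) * x)" by (rule ennreal_leI)
  also have "\<dots> < N x" using x by (simp add: level_def)
  finally show "x \<in> level k" using x by (simp add: level_def)
qed

text \<open>
  A component cannot be unbounded, since \<open>N\<close> is bounded below by a positive constant on the part of the
  component to the right of any of its points, and \<open>N\<close> is integrable.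
\<close>

lemma component_level:
  assumes I: "I \<in> components (level k)"
  obtains a b where "0 \<le> a" "a < b" "I = {a<..<b}" "a = 0 \<or> N a \<le> ennreal (2 powi k * a)" "N b \<le> ennreal (2 powi k * b)"
proof -
  obtain J where J: "(\<integral>\<^sup>+x\<in>{0<..}. N x \<partial>lborel) = ennreal J" "0 \<le> J"
    using N_int by (metis ennreal_cases infinity_ennreal_def less_irrefl)
  have sub: "I \<subseteq> level k" and ne: "I \<noteq> {}" and con: "connected I"
    using I by (auto simp: in_components_subset in_components_nonempty in_components_connected)
  obtain y where y: "y \<in> I" using ne by blast
  define c where "c = 2 powi k * y"
  have c: "0 < c" using y sub level_pos by (auto simp: c_def)
  have "z \<le> y + J / c" if z: "z \<in> I" for z
  proof (cases "y \<le> z")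
    case True
    have ivl: "{y..z} \<subseteq> level k" using connected_contains_Icc[OF con y z] sub by blast
    have "ennreal (c * (z - y)) = (\<integral>\<^sup>+x\<in>{y..z}. ennreal c \<partial>lborel)"
      using True c by (simp add: nn_integral_cmult_indicator ennreal_mult)
    also have "\<dots> \<le> (\<integral>\<^sup>+x\<in>{0<..}. N x \<partial>lborel)"
    proof (intro nn_integral_mono)
      fix x
      have "ennreal c \<le> N x \<and> 0 < x" if "x \<in> {y..z}"
      proof -
        have x: "x \<in> level k" using that ivl by blast
        have "ennreal c \<le> ennreal (2 powi k * x)" using that by (intro ennreal_leI) (simp add: c_def)
        also have "\<dots> < N x" using x by (simp add: level_def)
        finally show ?thesis using x by (simp add: level_def less_imp_le)
      qed
      then show "ennreal c * indicator {y..z} x \<le> N x * indicator {0<..} x" by (auto simp: indicator_def)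
    qed
    finally have "ennreal (c * (z - y)) \<le> ennreal J" by (simp only: J(1))
    then have "c * (z - y) \<le> J" using J(2) by (simp only: ennreal_le_iff)
    then show ?thesis using c by (simp add: field_simps)
  next
    case False
    then show ?thesis using J c by (simp add: add_increasing2)
  qed
  then have ba: "bdd_above I" by (rule bdd_aboveI)
  have bb: "bdd_below (level k)" by (rule bdd_belowI[of _ 0]) (simp add: level_pos less_imp_le)
  obtain a b where ab: "a < b" "I = {a<..<b}" "a \<notin> level k" "b \<notin> level k"
    by (rule open_component_greaterThanLessThan[OF open_level bb I ba])
  have a: "0 \<le> a"
  proof (rule ccontr)
    assume "\<not> 0 \<le> a"
    then have "min 0 ((a + b) / 2) \<in> I" using ab by (auto simp: min_def)
    then have "0 < min 0 ((a + b) / 2)" using sub level_pos by blast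
    then show False by simp
  qed
  have N_le: "N c \<le> ennreal (2 powi k * c)" if "0 < c" "c \<notin> level k" for c
    using that by (simp add: level_def not_less)
  have "a = 0 \<or> N a \<le> ennreal (2 powi k * a)" using N_le[OF _ ab(3)] a by (cases "a = 0") simp_all
  moreover have "N b \<le> ennreal (2 powi k * b)" using a ab(1,4) by (intro N_le) auto
  ultimately show thesis by (rule that[OF a ab(1,2)])
qed

lemma connected_component_eq_component:
  assumes "I \<in> components U" "x \<in> I"
  shows "connected_component_set U x = I"
proof -
  obtain y where y: "I = connected_component_set U y" using assms(1) unfolding components_iff by blast
  show ?thesis unfolding y by (rule connected_component_eq) (use assms(2) y in blast)
qed

lemma f_integrable: "integrable lborel (\<lambda>x. indicator {0<..} x *\<^sub>R f x)"
proof (rule integrableI_bounded)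
  have "(\<integral>\<^sup>+x. ennreal (norm (indicator {0<..} x *\<^sub>R f x)) \<partial>lborel) \<le> (\<integral>\<^sup>+x. 2 * (N x * indicator {0<..} x) \<partial>lborel)"
    using f_le by (intro nn_integral_mono) (auto simp: indicator_def)
  also have "\<dots> = 2 * (\<integral>\<^sup>+x\<in>{0<..}. N x \<partial>lborel)" by (rule nn_integral_cmult) measurable
  also have "\<dots> < \<infinity>" using N_int by (simp add: ennreal_mult_less_top)
  finally show "(\<integral>\<^sup>+x. ennreal (norm (indicator {0<..} x *\<^sub>R f x)) \<partial>lborel) < \<infinity>" .
qed measurable

lemma f_moment_integrable:
  assumes "0 \<le> a"
  shows "set_integrable lborel {a<..<b} (\<lambda>x. f x * of_real x)"
  unfolding set_integrable_def
proof (rule Bochner_Integration.integrable_bound[OF integrable_mult_right[OF integrable_norm[OF f_integrable], of "\<bar>b\<bar>"]])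
  show "AE x in lborel. norm (indicator {a<..<b} x *\<^sub>R (f x * of_real x)) \<le> norm (\<bar>b\<bar> * norm (indicator {0<..} x *\<^sub>R f x))"
    using assms by (intro AE_I2) (auto simp: indicator_def norm_mult mult.commute intro!: mult_mono)
qed measurable

lemma set_integral_square_Ioo:
  fixes a b :: real
  assumes "a \<le> b"
  shows "(LINT x:{a<..<b}|lborel. x\<^sup>2) = (b ^ 3 - a ^ 3) / 3"
proof -
  have i: "set_integrable lborel {a..b} (\<lambda>x. x\<^sup>2)"
    by (rule borel_integrable_atLeastAtMost') (intro continuous_intros)
  then have j: "set_integrable lborel {a<..<b} (\<lambda>x. x\<^sup>2)" by (rule set_integrable_subset) auto
  have "((\<lambda>x. x ^ 3 / 3) has_real_derivative x\<^sup>2) (at x within {a..b})" for x :: real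
    by (auto intro!: derivative_eq_intros)
  then have "((\<lambda>x. x\<^sup>2) has_integral b ^ 3 / 3 - a ^ 3 / 3) {a..b}"
    by (intro fundamental_theorem_of_calculus assms) (simp add: has_real_derivative_iff_has_vector_derivative)
  then show "(LINT x:{a<..<b}|lborel. x\<^sup>2) = (b ^ 3 - a ^ 3) / 3"
    unfolding set_borel_integral_eq_integral(2)[OF j] integral_open_interval_real[symmetric]
    by (simp add: integral_unique diff_divide_distrib)
qed

text \<open>
  The end points of the component do not belong to the level set, so the moment assumption applies with \<open>\<tau> = 2\<^sup>k\<close>,
  and the moment of \<open>x\<close> over \<open>(a, b)\<close> is at least \<open>b\<^sup>2 (b - a) / 3\<close>.
\<close>

lemma norm_slope_le:
  assumes I: "I \<in> components (level k)"
  shows "norm (slope I) \<le> 3 * C * 2 powi k"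
proof -
  obtain a b where ab: "0 \<le> a" "a < b" "I = {a<..<b}" "a = 0 \<or> N a \<le> ennreal (2 powi k * a)" "N b \<le> ennreal (2 powi k * b)"
    using component_level[OF I] .
  have m: "norm (LINT x:I|lborel. f x * of_real x) \<le> C * 2 powi k * b\<^sup>2 * (b - a)"
    unfolding ab(3) by (rule moment) (use ab in auto)
  have eq: "(LINT x:I|lborel. x\<^sup>2) = (b ^ 3 - a ^ 3) / 3"
    unfolding ab(3) by (rule set_integral_square_Ioo) (use ab in auto)
  have q: "b\<^sup>2 * (b - a) \<le> b ^ 3 - a ^ 3"
  proof -
    have "b ^ 3 - a ^ 3 - b\<^sup>2 * (b - a) = a * (b + a) * (b - a)"
      by (simp add: power3_eq_cube power2_eq_square algebra_simps)
    also have "0 \<le> \<dots>" using ab by (intro mult_nonneg_nonneg) auto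
    finally show ?thesis by simp
  qed
  have p: "0 < b\<^sup>2 * (b - a)" using ab by simp
  have "norm (slope I) = norm (LINT x:I|lborel. f x * of_real x) / ((b ^ 3 - a ^ 3) / 3)"
    unfolding slope_def eq norm_divide norm_of_real using p q by simp
  also have "\<dots> \<le> (C * 2 powi k * (b\<^sup>2 * (b - a))) / ((b\<^sup>2 * (b - a)) / 3)"
    using m p q C_ge by (intro frac_le) (auto simp: mult.assoc)
  also have "\<dots> = 3 * C * 2 powi k" using p ab by (simp add: field_simps)
  finally show ?thesis .
qed

lemma norm_good_le:
  assumes x: "0 < x"
  shows "norm (good k x) \<le> 3 * C * 2 powi k * x"
proof (cases "x \<in> level k")
  case True
  then have "connected_component_set (level k) x \<in> components (level k)" by (auto simp: components_def)
  from norm_slope_le[OF this] show ?thesis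
    using True x by (simp add: good_def norm_mult mult_right_mono)
next
  case False
  then have "N x \<le> ennreal (2 powi k * x)" using x by (auto simp: level_def)
  then have "ennreal (norm (f x)) \<le> 2 * ennreal (2 powi k * x)"
    using f_le[OF x] by (meson mult_left_mono order_trans zero_le)
  also have "\<dots> = ennreal (2 * (2 powi k * x))" using x by (simp add: ennreal_mult)
  finally have "norm (f x) \<le> 2 * (2 powi k * x)" using x by simp
  also have "\<dots> \<le> 3 * C * (2 powi k * x)" using x C_ge by (intro mult_right_mono) auto
  finally show ?thesis using False by (simp add: good_def mult.assoc)
qed

text \<open>
  On the open level set the slope is locally constant.
\<close>

lemma good_measurable [measurable]: "good k \<in> borel_measurable borel"
proof -
  let ?s = "\<lambda>x. slope (connected_component_set (level k) x) * of_real x"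
  have "continuous_on (level k) (\<lambda>x. slope (connected_component_set (level k) x))"
  proof (subst continuous_on_eq_continuous_at[OF open_level], rule ballI)
    fix x assume x: "x \<in> level k"
    let ?I = "connected_component_set (level k) x"
    have "open ?I" by (rule open_connected_component[OF open_level])
    moreover have "x \<in> ?I" using x by simp
    ultimately have "eventually (\<lambda>y. y \<in> ?I) (nhds x)" by (rule eventually_nhds_in_open)
    then have "eventually (\<lambda>y. slope (connected_component_set (level k) y) = slope ?I) (nhds x)"
      by eventually_elim (simp add: connected_component_eq)
    then show "isCont (\<lambda>x. slope (connected_component_set (level k) x)) x"
      by (subst isCont_cong) auto
  qed
  then have "continuous_on (level k) ?s" by (intro continuous_intros)
  then have [measurable]: "(\<lambda>x. indicator (level k) x *\<^sub>R ?s x) \<in> borel_measurable borel"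
    by (rule borel_measurable_continuous_on_indicator[OF level_measurable])
  have "good k = (\<lambda>x. indicator (level k) x *\<^sub>R ?s x + indicator (- level k) x *\<^sub>R f x)"
    by (auto simp: good_def)
  then show ?thesis by simp
qed

lemma good_moment_integrable:
  assumes "0 \<le> a"
  shows "set_integrable lborel {a<..<b} (\<lambda>x. good k x * of_real x)"
  unfolding set_integrable_def
proof (rule Bochner_Integration.integrable_bound)
  have "set_integrable lborel {a<..<b} (\<lambda>x. 3 * C * 2 powi k * \<bar>x\<bar> * \<bar>x\<bar>)"
    by (rule set_integrable_subset[OF borel_integrable_atLeastAtMost'[of a b]]) (auto intro!: continuous_intros)
  then show "integrable lborel (\<lambda>x. indicator {a<..<b} x *\<^sub>R (3 * C * 2 powi k * \<bar>x\<bar> * \<bar>x\<bar>))"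
    by (simp add: set_integrable_def)
  show "AE x in lborel. norm (indicator {a<..<b} x *\<^sub>R (good k x * of_real x)) \<le> norm (indicator {a<..<b} x *\<^sub>R (3 * C * 2 powi k * \<bar>x\<bar> * \<bar>x\<bar>))"
  proof (rule AE_I2)
    fix x
    show "norm (indicator {a<..<b} x *\<^sub>R (good k x * of_real x)) \<le> norm (indicator {a<..<b} x *\<^sub>R (3 * C * 2 powi k * \<bar>x\<bar> * \<bar>x\<bar>))"
    proof (cases "x \<in> {a<..<b}")
      case True
      then have "0 < x" using assms by auto
      then show ?thesis using True norm_good_le[of x k] C_ge
        by (simp add: norm_mult abs_mult mult_right_mono)
    qed simp
  qed
qed measurable

lemma integral_good:
  assumes I: "I \<in> components (level k)"
  shows "(LINT x:I|lborel. good k x * of_real x) = (LINT x:I|lborel. f x * of_real x)"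
proof -
  obtain a b where ab: "0 \<le> a" "a < b" "I = {a<..<b}" using component_level[OF I] by metis
  have sub: "I \<subseteq> level k" using I by (rule in_components_subset)
  have q: "(LINT x:I|lborel. x\<^sup>2) \<noteq> 0"
    unfolding ab(3) set_integral_square_Ioo[OF less_imp_le[OF ab(2)]]
    using power_strict_mono[OF ab(2,1), of 3] by simp
  have "(LINT x:I|lborel. good k x * of_real x) = (LINT x:I|lborel. slope I * of_real (x\<^sup>2))"
    unfolding set_lebesgue_integral_def
    using sub by (intro Bochner_Integration.integral_cong)
      (auto simp: good_def connected_component_eq_component[OF I] power2_eq_square mult.assoc indicator_def)
  also have "\<dots> = slope I * (LINT x:I|lborel. complex_of_real (x\<^sup>2))"
    by (rule set_integral_mult_right)
  also have "(LINT x:I|lborel. complex_of_real (x\<^sup>2)) = of_real (LINT x:I|lborel. x\<^sup>2)"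
    by (rule set_integral_complex_of_real)
  finally show ?thesis using q by (simp add: slope_def)
qed

text \<open>
  On a component \<open>I\<close> of level \<open>k\<close>, the next approximation differs from \<open>f\<close> only on components of level \<open>k + 1\<close>,
  each of which is contained in \<open>I\<close> or disjoint from it, and on each of these both have the same moment.
\<close>

lemma integral_good_next:
  assumes I: "I \<in> components (level k)"
  shows "(LINT x:I|lborel. good (k + 1) x * of_real x) = (LINT x:I|lborel. f x * of_real x)"
proof -
  obtain a b where ab: "0 \<le> a" "a < b" "I = {a<..<b}" using component_level[OF I] by metis
  let ?\<phi> = "\<lambda>x. indicator I x *\<^sub>R (good (k + 1) x * of_real x - f x * of_real x)"
  have i: "set_integrable lborel I (\<lambda>x. good (k + 1) x * of_real x)" "set_integrable lborel I (\<lambda>x. f x * of_real x)"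
    unfolding ab(3) using good_moment_integrable[OF ab(1)] f_moment_integrable[OF ab(1)] by auto
  have "(LINT x|lborel. ?\<phi> x) = 0"
  proof (rule integral_zero_by_components[OF open_level[of "k + 1"]])
    show "integrable lborel ?\<phi>" using set_integral_diff(1)[OF i] by (simp add: set_integrable_def)
    show "?\<phi> x = 0" if "x \<notin> level (k + 1)" for x using that by (simp add: good_def)
    fix J assume J: "J \<in> components (level (k + 1))"
    obtain a' b' where ab': "0 \<le> a'" "a' < b'" "J = {a'<..<b'}" using component_level[OF J] by metis
    have J': "set_integrable lborel J (\<lambda>x. good (k + 1) x * of_real x)" "set_integrable lborel J (\<lambda>x. f x * of_real x)"
      unfolding ab'(3) using good_moment_integrable[OF ab'(1)] f_moment_integrable[OF ab'(1)] by auto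
    have "J \<subseteq> level k" using in_components_subset[OF J] level_mono by blast
    then consider "J \<subseteq> I" | "J \<inter> I = {}"
      using components_maximal[OF I in_components_connected[OF J]] by blast
    then show "(LINT x:J|lborel. ?\<phi> x) = 0"
    proof cases
      case 1
      then have "(LINT x:J|lborel. ?\<phi> x) = (LINT x:J|lborel. good (k + 1) x * of_real x - f x * of_real x)"
        unfolding set_lebesgue_integral_def by (intro Bochner_Integration.integral_cong) (auto simp: indicator_def)
      also have "\<dots> = 0" using set_integral_diff(2)[OF J'] integral_good[OF J] by simp
      finally show ?thesis .
    next
      case 2
      then have "(LINT x:J|lborel. ?\<phi> x) = (LINT (x::real)|lborel. 0)"
        unfolding set_lebesgue_integral_def by (intro Bochner_Integration.integral_cong) (auto simp: indicator_def)
      then show ?thesis by simp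
    qed
  qed
  then show ?thesis using set_integral_diff(2)[OF i] by (simp add: set_lebesgue_integral_def)
qed

text \<open>
  The index set of the decomposition: a level and one of the components of its level set.
\<close>

definition pieces :: "(int \<times> real set) set" where
  "pieces = (SIGMA k:UNIV. components (level k))"

text \<open>
  The factor \<open>9 C 2\<^sup>k\<close> bounds \<open>\<bar>g\<^sub>k\<^sub>+\<^sub>1(x) - g\<^sub>k(x)\<bar> / x\<close>.
\<close>

definition coeff :: "int \<times> real set \<Rightarrow> real" where
  "coeff p = 9 * C * 2 powi fst p * (LINT x:snd p|lborel. x)"

definition piece :: "int \<times> real set \<Rightarrow> real \<Rightarrow> complex" where
  "piece p x = indicator (snd p) x *\<^sub>R (good (fst p + 1) x - good (fst p) x) / of_real (coeff p)"

lemma countable_pieces: "countable pieces"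
  unfolding pieces_def using countable_components_open[OF open_level] by (intro countable_SIGMA) auto

lemma coeff_eq:
  assumes "0 \<le> a" "a < b"
  shows "coeff (k, {a<..<b}) = 9 * C * 2 powi k * ((b\<^sup>2 - a\<^sup>2) / 2)"
proof -
  have "(LINT x:{a<..<b}|lborel. x) = (LINT x:{a..b}|lborel. x)"
    using assms by (intro set_integral_cong_set) 
      (auto simp: set_borel_measurable_def indicator_def intro!: AE_I'[of "{a, b}"] finite_imp_null_set_lborel)
  then show ?thesis using assms by (simp add: coeff_def set_integral_ident_Icc)
qed

lemma piece_atom:
  assumes p: "p \<in> pieces"
  shows "0 < coeff p" "\<exists>B. atom_on B (piece p)" "(\<integral>\<^sup>+x. ennreal (norm (piece p x)) \<partial>lborel) \<le> 1"
    "piece p \<in> borel_measurable borel"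
proof -
  obtain k I where kI: "p = (k, I)" "I \<in> components (level k)" using p by (auto simp: pieces_def)
  obtain a b where ab: "0 \<le> a" "a < b" "I = {a<..<b}" using component_level[OF kI(2)] by metis
  define m where "m = (b\<^sup>2 - a\<^sup>2) / 2"
  have m: "0 < m" using ab by (simp add: m_def power_strict_mono)
  have c: "coeff p = 9 * C * 2 powi k * m" unfolding kI ab(3) m_def by (rule coeff_eq[OF ab(1,2)])
  then show c0: "0 < coeff p" using m C_ge by simp
  have piece_eq: "piece p x = indicator {a<..<b} x *\<^sub>R (good (k + 1) x - good k x) / of_real (coeff p)" for x
    by (simp add: piece_def kI(1) ab(3))
  show meas [measurable]: "piece p \<in> borel_measurable borel" unfolding piece_eq[abs_def] by measurable
  have off: "piece p x = 0" if "x \<notin> {a<..<b}" for x using that by (simp add: piece_eq)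
  have le: "norm (piece p x) \<le> x / ((b\<^sup>2 - a\<^sup>2) / 2)" if x: "x \<in> {a<..<b}" for x
  proof -
    have x0: "0 < x" using x ab by auto
    have "norm (good (k + 1) x - good k x) \<le> 3 * C * 2 powi (k + 1) * x + 3 * C * 2 powi k * x"
      by (intro order_trans[OF norm_triangle_ineq4] add_mono norm_good_le x0)
    also have "\<dots> = 9 * C * 2 powi k * x" by (simp add: power_int_add)
    finally have "norm (piece p x) \<le> (9 * C * 2 powi k * x) / coeff p"
      using x c0 by (simp add: piece_eq norm_divide divide_right_mono)
    also have "\<dots> = x / m" using C_ge by (simp add: c)
    finally show ?thesis by (simp add: m_def)
  qed
  have zero: "(LINT x|lborel. piece p x * of_real x) = 0"
  proof -
    have i: "set_integrable lborel I (\<lambda>x. good (k + 1) x * of_real x)" "set_integrable lborel I (\<lambda>x. good k x * of_real x)"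
      unfolding ab(3) by (rule good_moment_integrable[OF ab(1)])+
    have "(LINT x|lborel. piece p x * of_real x)
       = (LINT x|lborel. (indicator I x *\<^sub>R (good (k + 1) x * of_real x - good k x * of_real x)) / of_real (coeff p))"
      by (intro Bochner_Integration.integral_cong) (auto simp: piece_eq ab(3) algebra_simps indicator_def)
    also have "\<dots> = (LINT x:I|lborel. good (k + 1) x * of_real x - good k x * of_real x) / of_real (coeff p)"
      unfolding set_lebesgue_integral_def by (rule integral_divide_zero)
    also have "\<dots> = 0"
      using set_integral_diff(2)[OF i] integral_good_next[OF kI(2)] integral_good[OF kI(2)] by simp
    finally show ?thesis .
  qed
  note atom = atom_onI[OF ab(1,2) meas off le zero]
  show "\<exists>B. atom_on B (piece p)" using atom(1) by blast
  show "(\<integral>\<^sup>+x. ennreal (norm (piece p x)) \<partial>lborel) \<le> 1" by (rule atom(2))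
qed

text \<open>
  The sum is the integral of \<open>9 C\<close> times the sum of those \<open>2\<^sup>k x\<close> for which \<open>x\<close> lies in one of the chosen components
  of level \<open>k\<close>. Such \<open>k\<close> satisfy \<open>2\<^sup>k x < N(x)\<close>, so this geometric sum is at most \<open>2 N(x)\<close>.
\<close>

lemma sum_coeff_le:
  assumes F: "finite F" "F \<subseteq> pieces"
  shows "ennreal (\<Sum>p\<in>F. coeff p) \<le> ennreal (18 * C) * (\<integral>\<^sup>+x\<in>{0<..}. N x \<partial>lborel)"
proof -
  let ?g = "\<lambda>p x. ennreal (9 * C * (2 powi fst p * x)) * indicator (snd p) x"
  have meas [measurable]: "snd p \<in> sets borel" if "p \<in> pieces" for p
    using that open_components[OF open_level] by (auto simp: pieces_def)
  have coeff_nn: "ennreal (coeff p) = (\<integral>\<^sup>+x. ?g p x \<partial>lborel)" if p: "p \<in> pieces" for p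
  proof -
    obtain k I where kI: "p = (k, I)" "I \<in> components (level k)" using p by (auto simp: pieces_def)
    obtain a b where ab: "0 \<le> a" "a < b" "I = {a<..<b}" using component_level[OF kI(2)] by metis
    have int: "integrable lborel (\<lambda>x. 9 * C * 2 powi k * (indicator I x *\<^sub>R x))"
    proof (rule integrable_mult_right)
      have "set_integrable lborel I (\<lambda>x. x)"
        by (rule set_integrable_subset[OF set_integrable_ident_Icc[of a b]]) (use ab in auto)
      then show "integrable lborel (\<lambda>x. indicator I x *\<^sub>R x)" by (simp add: set_integrable_def)
    qed
    have "ennreal (coeff p) = ennreal (LINT x|lborel. 9 * C * 2 powi k * (indicator I x *\<^sub>R x))"
      unfolding coeff_def kI(1) set_lebesgue_integral_def by simp
    also have "\<dots> = (\<integral>\<^sup>+x. ennreal (9 * C * 2 powi k * (indicator I x *\<^sub>R x)) \<partial>lborel)"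
      using int C_ge ab by (intro nn_integral_eq_integral[symmetric]) (auto simp: indicator_def)
    also have "\<dots> = (\<integral>\<^sup>+x. ?g p x \<partial>lborel)"
      by (intro nn_integral_cong) (auto simp: indicator_def kI(1) mult.assoc)
    finally show ?thesis .
  qed
  have "ennreal (\<Sum>p\<in>F. coeff p) = (\<Sum>p\<in>F. ennreal (coeff p))"
    using F piece_atom(1) by (intro sum_ennreal[symmetric]) (auto intro: less_imp_le)
  also have "\<dots> = (\<Sum>p\<in>F. \<integral>\<^sup>+x. ?g p x \<partial>lborel)"
    using F coeff_nn by (intro sum.cong) auto
  also have "\<dots> = (\<integral>\<^sup>+x. (\<Sum>p\<in>F. ?g p x) \<partial>lborel)"
  proof (rule nn_integral_sum[symmetric])
    fix p assume "p \<in> F"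
    then have [measurable]: "snd p \<in> sets borel" using F meas by blast
    show "?g p \<in> borel_measurable lborel" by measurable
  qed
  also have "\<dots> \<le> (\<integral>\<^sup>+x. ennreal (18 * C) * (N x * indicator {0<..} x) \<partial>lborel)"
  proof (rule nn_integral_mono)
    fix x
    define P where "P = {p \<in> F. x \<in> snd p}"
    have P: "finite P" "P \<subseteq> pieces" using F by (auto simp: P_def)
    have lev: "x \<in> level (fst p)" if "p \<in> P" for p
    proof -
      have "snd p \<in> components (level (fst p))" using that P(2) by (auto simp: pieces_def)
      from in_components_subset[OF this] show ?thesis using that by (auto simp: P_def)
    qed
    have sum: "(\<Sum>p\<in>F. ?g p x) = (\<Sum>p\<in>P. ennreal (9 * C * (2 powi fst p * x)))"
      unfolding P_def using F(1) by (intro sum.mono_neutral_cong_right) (auto simp: indicator_def)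
    show "(\<Sum>p\<in>F. ?g p x) \<le> ennreal (18 * C) * (N x * indicator {0<..} x)"
    proof (cases "P = {}")
      case False
      then have x: "0 < x" using lev level_pos by blast
      have inj: "inj_on fst P"
      proof (rule inj_onI)
        fix p q assume pq: "p \<in> P" "q \<in> P" "fst p = fst q"
        have "snd r = connected_component_set (level (fst r)) x" if "r \<in> P" for r
        proof -
          have "snd r \<in> components (level (fst r))" using that P(2) by (auto simp: pieces_def)
          then show ?thesis using that by (intro connected_component_eq_component[symmetric]) (auto simp: P_def)
        qed
        from this[OF pq(1)] this[OF pq(2)] show "p = q" using pq(3) by (simp add: prod_eq_iff)
      qed
      show ?thesis
      proof (cases "N x" rule: ennreal_cases)
        case (real r)
        have "2 powi fst p \<le> r / x" if "p \<in> P" for p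
          using lev[OF that] real x by (simp add: level_def ennreal_less_iff field_simps)
        then have "(\<Sum>k\<in>fst ` P. 2 powi k) \<le> 2 * (r / x)"
          using P(1) real x by (intro sum_powi_le) auto
        then have 1: "(\<Sum>p\<in>P. 2 powi fst p) \<le> 2 * (r / x)" by (simp add: sum.reindex[OF inj])
        have "(\<Sum>p\<in>P. ennreal (9 * C * (2 powi fst p * x))) = ennreal (\<Sum>p\<in>P. 9 * C * (2 powi fst p * x))"
          using x C_ge by (intro sum_ennreal) auto
        also have "(\<Sum>p\<in>P. 9 * C * (2 powi fst p * x)) = (\<Sum>p\<in>P. 2 powi fst p) * (9 * C * x)"
          unfolding sum_distrib_right by (intro sum.cong) auto
        also have "ennreal \<dots> \<le> ennreal (2 * (r / x) * (9 * C * x))"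
          using 1 x C_ge by (intro ennreal_leI mult_right_mono) auto
        also have "2 * (r / x) * (9 * C * x) = 18 * C * r" using x by simp
        also have "ennreal (18 * C * r) = ennreal (18 * C) * (N x * indicator {0<..} x)"
          using x C_ge real by (simp add: ennreal_mult)
        finally show ?thesis unfolding sum .
      next
        case top
        then show ?thesis using x C_ge by (simp add: ennreal_mult_top)
      qed
    qed (simp add: sum)
  qed
  also have "\<dots> = ennreal (18 * C) * (\<integral>\<^sup>+x\<in>{0<..}. N x \<partial>lborel)"
    by (rule nn_integral_cmult) measurable
  finally show ?thesis .
qed

text \<open>
  For large \<open>k\<close> the point \<open>x\<close> has left the level sets and \<open>g\<^sub>k(x) = f(x)\<close>; as \<open>k\<close> decreases, \<open>g\<^sub>k(x)\<close> tends to zero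
  geometrically. The telescoping series is therefore absolutely convergent, which permits the rearrangements below.
\<close>

lemma good_has_sum:
  assumes x: "0 < x" and fin: "N x < top"
  shows "((\<lambda>k. good (k + 1) x - good k x) has_sum f x) UNIV"
proof -
  define d where "d k = good (k + 1) x - good k x" for k
  obtain r where r: "N x = ennreal r" "0 \<le> r" using fin by (metis ennreal_cases less_irrefl)
  \<comment> \<open>Above level \<open>n\<close> the point \<open>x\<close> is outside the level sets; the sum runs downwards from there.\<close>
  obtain n where "r / x < 2 ^ n" using real_arch_pow[of 2 "r / x"] by auto
  then have n: "r < 2 powi int n * x" using x by (simp add: field_simps)
  have out: "x \<notin> level k" if "int n \<le> k" for k
  proof -
    have "(2 :: real) powi int n \<le> 2 powi k" using that by (intro power_int_increasing) auto
    then have "2 powi int n * x \<le> 2 powi k * x" using x by (intro mult_right_mono) auto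
    then have "r < 2 powi k * x" using n by linarith
    then show ?thesis using r(2) by (simp add: level_def r(1) ennreal_less_iff)
  qed
  have d0: "d k = 0" if "int n \<le> k" for k
    using out[OF that] out[of "k + 1"] that by (simp add: d_def good_def)
  have norm_good: "norm (good (int n - int j) x) \<le> 3 * C * 2 ^ n * x * (1 / 2) ^ j" for j
  proof -
    have "(2 :: real) powi (int n - int j) = 2 ^ n * (1 / 2) ^ j"
      by (simp add: power_int_diff power_one_over)
    then show ?thesis using norm_good_le[OF x, of "int n - int j"] by (simp add: mult_ac)
  qed
  have "(\<lambda>j. 3 * C * 2 ^ n * x * (1 / 2) ^ j) \<longlonglongrightarrow> 0"
    by (intro tendsto_mult_right_zero LIMSEQ_power_zero) auto
  then have lim: "(\<lambda>j. good (int n - int j) x) \<longlonglongrightarrow> 0"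
    by (rule Lim_null_comparison[rotated]) (simp add: norm_good)
  have "(\<lambda>j. good (int n - int j) x - good (int n - int (Suc j)) x) sums (good (int n - int 0) x - 0)"
    by (rule telescope_sums'[OF lim])
  moreover have "good (int n - int j) x - good (int n - int (Suc j)) x = d (int n - 1 - int j)" for j
    by (simp add: d_def algebra_simps)
  ultimately have sums: "(\<lambda>j. d (int n - 1 - int j)) sums f x"
    using out[of "int n"] by (simp add: good_def[of "int n"])
  have "summable (\<lambda>j. norm (d (int n - 1 - int j)))"
  proof (rule summable_comparison_test')
    show "summable (\<lambda>j. 2 * (3 * C * 2 ^ n * x) * (1 / 2) ^ j)"
      by (intro summable_mult summable_geometric) auto
    fix j :: nat
    have "norm (d (int n - 1 - int j)) \<le> norm (good (int n - int j) x) + norm (good (int n - int (Suc j)) x)"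
      unfolding d_def by (rule order_trans[OF norm_triangle_ineq4]) (simp add: algebra_simps)
    also have "\<dots> \<le> 3 * C * 2 ^ n * x * (1 / 2) ^ j + 3 * C * 2 ^ n * x * (1 / 2) ^ Suc j"
      by (intro add_mono norm_good)
    also have "\<dots> \<le> 2 * (3 * C * 2 ^ n * x) * (1 / 2) ^ j" using x C_ge by simp
    finally show "norm (norm (d (int n - 1 - int j))) \<le> 2 * (3 * C * 2 ^ n * x) * (1 / 2) ^ j" by simp
  qed
  then have "((\<lambda>j. d (int n - 1 - int j)) has_sum f x) UNIV" by (rule norm_summable_imp_has_sum[OF _ sums])
  then have "(d \<circ> (\<lambda>j. int n - 1 - int j) has_sum f x) UNIV" by (simp add: o_def)
  then have "(d has_sum f x) (range (\<lambda>j. int n - 1 - int j))"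
    by (subst has_sum_reindex) (auto simp: inj_on_def)
  also have "(d has_sum f x) (range (\<lambda>j. int n - 1 - int j)) \<longleftrightarrow> (d has_sum f x) UNIV"
  proof (rule has_sum_cong_neutral)
    fix k assume k: "k \<in> UNIV - range (\<lambda>j. int n - 1 - int j)"
    have "k = int n - 1 - int (nat (int n - 1 - k))" if "k < int n" using that by simp
    then have "k \<in> range (\<lambda>j. int n - 1 - int j)" if "k < int n" using that by (metis rangeI)
    then have "int n \<le> k" using k by fastforce
    then show "d k = 0" by (rule d0)
  qed auto
  finally show ?thesis unfolding d_def[abs_def] .
qed

text \<open>
  At most one component of each level contains \<open>x\<close>, so only the order of summation changes.
\<close>

lemma pieces_has_sum:
  assumes x: "0 < x" and fin: "N x < top"
  shows "((\<lambda>p. of_real (coeff p) * piece p x) has_sum f x) pieces"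
proof -
  define d where "d k = good (k + 1) x - good k x" for k
  let ?K = "{k. x \<in> level k}"
  let ?c = "\<lambda>k. (k, connected_component_set (level k) x)"
  have d0: "d k = 0" if "x \<notin> level k" for k
    using that level_mono[of k] by (auto simp: d_def good_def)
  have "(d has_sum f x) UNIV" unfolding d_def[abs_def] by (rule good_has_sum[OF assms])
  also have "(d has_sum f x) UNIV \<longleftrightarrow> (d has_sum f x) ?K"
    by (rule has_sum_cong_neutral) (auto simp: d0)
  also have "\<dots> \<longleftrightarrow> ((d \<circ> fst) \<circ> ?c has_sum f x) ?K" by (simp add: o_def)
  also have "\<dots> \<longleftrightarrow> (d \<circ> fst has_sum f x) (?c ` ?K)"
    by (rule has_sum_reindex[symmetric]) (auto simp: inj_on_def)
  also have "\<dots> \<longleftrightarrow> ((\<lambda>p. of_real (coeff p) * piece p x) has_sum f x) pieces"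
  proof (rule has_sum_cong_neutral)
    fix p assume p: "p \<in> pieces - ?c ` ?K"
    have "x \<notin> snd p"
    proof
      assume xp: "x \<in> snd p"
      have c: "snd p \<in> components (level (fst p))" using p by (auto simp: pieces_def)
      have "p = ?c (fst p)" using connected_component_eq_component[OF c xp] by (simp add: prod_eq_iff)
      moreover have "fst p \<in> ?K" using in_components_subset[OF c] xp by auto
      ultimately show False using p by blast
    qed
    then show "of_real (coeff p) * piece p x = 0" by (simp add: piece_def)
  next
    fix p assume "p \<in> ?c ` ?K - pieces"
    then show "(d \<circ> fst) p = 0" by (auto simp: pieces_def components_def)
  next
    fix p assume p: "p \<in> ?c ` ?K \<inter> pieces"
    then have "x \<in> snd p" by auto
    then show "(d \<circ> fst) p = of_real (coeff p) * piece p x"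
      using piece_atom(1)[of p] p by (simp add: piece_def d_def)
  qed
  finally show ?thesis .
qed

text \<open>
  The countable index set is embedded into the natural numbers, and the numbers outside the image
  receive the zero atom.
\<close>

theorem atomic_decomposition:
  obtains l a B where
    "\<And>n. atom_on (B n) (a n)" "\<And>n. (\<integral>\<^sup>+x. ennreal (norm (a n x)) \<partial>lborel) \<le> 1" "\<And>n. a n \<in> borel_measurable borel"
    "summable (\<lambda>n. norm (l n :: complex))"
    "ennreal (\<Sum>n. norm (l n)) \<le> ennreal (18 * C) * (\<integral>\<^sup>+x\<in>{0<..}. N x \<partial>lborel)"
    "\<And>x. 0 < x \<Longrightarrow> N x < top \<Longrightarrow> (\<lambda>n. l n * a n x) sums f x"
proof -
  define e where "e = to_nat_on pieces"
  define q where "q = from_nat_into pieces"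
  have inj: "inj_on e pieces" unfolding e_def by (rule inj_on_to_nat_on[OF countable_pieces])
  have qe: "q (e p) = p" if "p \<in> pieces" for p using that countable_pieces by (simp add: e_def q_def)
  define l where "l n = (if n \<in> e ` pieces then complex_of_real (coeff (q n)) else 0)" for n
  define a where "a n = (if n \<in> e ` pieces then piece (q n) else (\<lambda>x. 0))" for n
  obtain J where J: "ennreal (18 * C) * (\<integral>\<^sup>+x\<in>{0<..}. N x \<partial>lborel) = ennreal J" "0 \<le> J"
  proof -
    have "ennreal (18 * C) * (\<integral>\<^sup>+x\<in>{0<..}. N x \<partial>lborel) < top"
      using N_int by (simp add: ennreal_mult_less_top)
    then show thesis using that by (cases "ennreal (18 * C) * (\<integral>\<^sup>+x\<in>{0<..}. N x \<partial>lborel)" rule: ennreal_cases) auto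
  qed
  have "\<exists>B. atom_on B (a n)" for n
    using piece_atom(2) atom_on_zero qe by (fastforce simp: a_def)
  then obtain B where B: "\<And>n. atom_on (B n) (a n)" by metis
  have part: "(\<Sum>i<n. norm (l i)) \<le> J" for n
  proof -
    let ?F = "{p \<in> pieces. e p < n}"
    have fin: "finite ?F"
      by (rule inj_on_finite[of e _ "{..<n}"]) (use inj in \<open>auto simp: inj_on_def\<close>)
    have "(\<Sum>i<n. norm (l i)) = (\<Sum>i\<in>e ` ?F. norm (l i))"
      by (rule sum.mono_neutral_right) (auto simp: l_def)
    also have "\<dots> = (\<Sum>p\<in>?F. norm (l (e p)))"
      by (subst sum.reindex) (use inj in \<open>auto simp: inj_on_def\<close>)
    also have "\<dots> = (\<Sum>p\<in>?F. coeff p)"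
      using piece_atom(1) by (intro sum.cong) (auto simp: l_def qe less_imp_le)
    finally have "ennreal (\<Sum>i<n. norm (l i)) \<le> ennreal J" using sum_coeff_le[OF fin] J(1) by simp
    then show ?thesis using J(2) by (simp only: ennreal_le_iff)
  qed
  show thesis
  proof (rule that[of B a l])
    show "atom_on (B n) (a n)" for n by (rule B)
    show "(\<integral>\<^sup>+x. ennreal (norm (a n x)) \<partial>lborel) \<le> 1" for n
      using piece_atom(3) qe by (auto simp: a_def)
    show "a n \<in> borel_measurable borel" for n
      using piece_atom(4) qe by (auto simp: a_def)
    show sm: "summable (\<lambda>n. norm (l n))"
      by (rule summableI_nonneg_bounded[of _ J]) (use part in auto)
    have "(\<Sum>n. norm (l n)) \<le> J" by (rule suminf_le_const[OF sm part])
    then show "ennreal (\<Sum>n. norm (l n)) \<le> ennreal (18 * C) * (\<integral>\<^sup>+x\<in>{0<..}. N x \<partial>lborel)"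
      unfolding J(1) by (rule ennreal_leI)
    fix x :: real assume x: "0 < x" "N x < top"
    have "((\<lambda>n. l n * a n x) \<circ> e has_sum f x) pieces \<longleftrightarrow> ((\<lambda>p. of_real (coeff p) * piece p x) has_sum f x) pieces"
      by (rule has_sum_cong) (simp add: l_def a_def qe)
    then have "((\<lambda>n. l n * a n x) has_sum f x) (e ` pieces)"
      using pieces_has_sum[OF x] has_sum_reindex[OF inj, of "\<lambda>n. l n * a n x"] by simp
    also have "((\<lambda>n. l n * a n x) has_sum f x) (e ` pieces) \<longleftrightarrow> ((\<lambda>n. l n * a n x) has_sum f x) UNIV"
      by (rule has_sum_cong_neutral) (auto simp: l_def)
    finally show "(\<lambda>n. l n * a n x) sums f x" by (rule has_sum_imp_sums)
  qed
qed

end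

section \<open>From the heat maximal function to level sets\<close>

text \<open>
  The square root on the extended half-line.
\<close>

definition esqrt :: "ennreal \<Rightarrow> ennreal" where
  "esqrt a = (if a = top then top else ennreal (sqrt (enn2real a)))"

lemma esqrt_measurable [measurable]: "esqrt \<in> borel_measurable borel"
  unfolding esqrt_def by measurable

lemma esqrt_mult_self: "esqrt a * esqrt a = a"
  by (cases a rule: ennreal_cases) (auto simp: esqrt_def simp flip: ennreal_mult)

lemma esqrt_mono: "a \<le> b \<Longrightarrow> esqrt a \<le> esqrt b"
  by (cases a rule: ennreal_cases; cases b rule: ennreal_cases) (auto simp: esqrt_def top_unique intro!: ennreal_leI)

lemma esqrt_ennreal: "0 \<le> a \<Longrightarrow> esqrt (ennreal a) = ennreal (sqrt a)"
  by (simp add: esqrt_def)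

text \<open>
  The majorant \<open>N\<close>: it bounds the harmonic extension in the cone over \<open>x\<close>. The constant \<open>256\<close> is the one that arises when the square root of the harmonic
  extension is compared with an average over an interval that contains the vertex of the cone.
\<close>

definition control :: "(real \<Rightarrow> complex) \<Rightarrow> real \<Rightarrow> ennreal" where
  "control f x = (256 * hl_maximal (\<lambda>x. esqrt (2 * maximal_function f x)) x) * (256 * hl_maximal (\<lambda>x. esqrt (2 * maximal_function f x)) x)"

lemma open_control_greater: "open {x. c < control f x}"
proof -
  define m where "m = hl_maximal (\<lambda>x. esqrt (2 * maximal_function f x))"
  have "c < (256 * m x) * (256 * m x) \<longleftrightarrow> esqrt c / 256 < m x" for x
  proof -
    have "c < (256 * m x) * (256 * m x) \<longleftrightarrow> esqrt c < 256 * m x"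
    proof
      assume "c < (256 * m x) * (256 * m x)"
      then show "esqrt c < 256 * m x" using mult_mono[of "256 * m x" "esqrt c" "256 * m x" "esqrt c"]
        by (metis esqrt_mult_self linorder_not_less zero_le)
    next
      assume *: "esqrt c < 256 * m x"
      then have "esqrt c \<noteq> top" by auto
      then obtain s where s: "esqrt c = ennreal s" "0 \<le> s" by (cases "esqrt c" rule: ennreal_cases) auto
      have c: "c = ennreal (s * s)" using esqrt_mult_self[of c] s by (simp add: ennreal_mult)
      show "c < (256 * m x) * (256 * m x)"
      proof (cases "256 * m x" rule: ennreal_cases)
        case (real r)
        then have "s * s < r * r" using * s by (intro mult_strict_mono) (auto simp: ennreal_less_iff)
        then show ?thesis unfolding c real(2) using s by (simp add: ennreal_less_iff flip: ennreal_mult' ennreal_mult'' real(2))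
            (metis ennreal_less_iff ennreal_mult real(1,2) mult_nonneg_nonneg)
      next
        case top
        then show ?thesis unfolding c by simp
      qed
    qed
    also have "\<dots> \<longleftrightarrow> esqrt c / 256 < m x"
      using divide_less_ennreal[of 256 "esqrt c" "m x"] by (simp add: mult.commute)
    finally show ?thesis .
  qed
  then show ?thesis unfolding control_def m_def[symmetric] using open_hl_maximal_greater[of "esqrt c / 256", folded m_def]
    by (simp add: m_def open_hl_maximal_greater)
qed

lemma control_measurable [measurable]: "control f \<in> borel_measurable borel"
  by (rule borel_measurableI_greater) (use open_control_greater in auto)

text \<open>
  The Dirichlet kernel is odd in its first variable.
\<close>

lemma maximal_function_minus: "maximal_function f (- x) = maximal_function f x"
proof -
  have "dirichlet_kernel t (- x) y = - dirichlet_kernel t x y" for t y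
    by (simp add: dirichlet_kernel_def algebra_simps power2_eq_square)
  then have "dirichlet_semigroup t f (- x) = - dirichlet_semigroup t f x" for t
    by (simp add: dirichlet_semigroup_def)
  then show ?thesis by (simp add: maximal_function_def)
qed

lemma nn_integral_maximal_function:
  assumes f: "integrable half_line f"
  shows "(\<integral>\<^sup>+x. maximal_function f x \<partial>lborel) = 2 * hardy_norm f"
proof -
  note [measurable] = maximal_function_measurable[OF f]
  let ?h = "maximal_function f"
  have "(\<integral>\<^sup>+x. ?h x \<partial>lborel) = (\<integral>\<^sup>+x. ?h x * indicator {0<..} x + ?h x * indicator {..<0} x \<partial>lborel)"
  proof (rule nn_integral_cong_AE)
    have "AE x in lborel. x \<noteq> (0 :: real)" by (rule AE_lborel_singleton)
    then show "AE x in lborel. ?h x = ?h x * indicator {0<..} x + ?h x * indicator {..<0} x"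
      by eventually_elim (auto simp: indicator_def)
  qed
  also have "\<dots> = (\<integral>\<^sup>+x. ?h x * indicator {0<..} x \<partial>lborel) + (\<integral>\<^sup>+x. ?h x * indicator {..<0} x \<partial>lborel)"
    by (rule nn_integral_add) measurable
  also have "(\<integral>\<^sup>+x. ?h x * indicator {..<0} x \<partial>lborel) = (\<integral>\<^sup>+x. ?h (- x) * indicator {..<0} (- x) \<partial>lborel)"
    by (subst nn_integral_real_affine[where c = "-1" and t = 0]) auto
  also have "\<dots> = (\<integral>\<^sup>+x. ?h x * indicator {0<..} x \<partial>lborel)"
    by (intro nn_integral_cong) (auto simp: maximal_function_minus indicator_def)
  finally show ?thesis by (simp add: hardy_norm_def nn_integral_half_line mult_2)
qed

lemma nn_integral_control_le:
  assumes f: "integrable half_line f"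
  shows "(\<integral>\<^sup>+x\<in>{0<..}. control f x \<partial>lborel) \<le> ennreal (65536 * 160) * hardy_norm f"
proof -
  note [measurable] = maximal_function_measurable[OF f]
  define \<phi> where "\<phi> = (\<lambda>x. esqrt (2 * maximal_function f x))"
  have [measurable]: "\<phi> \<in> borel_measurable borel" unfolding \<phi>_def by measurable
  have "(\<integral>\<^sup>+x\<in>{0<..}. control f x \<partial>lborel) \<le> (\<integral>\<^sup>+x. 65536 * (hl_maximal \<phi> x * hl_maximal \<phi> x) \<partial>lborel)"
    by (intro nn_integral_mono) (auto simp: control_def \<phi>_def indicator_def algebra_simps)
  also have "\<dots> = 65536 * (\<integral>\<^sup>+x. hl_maximal \<phi> x * hl_maximal \<phi> x \<partial>lborel)" by (rule nn_integral_cmult) measurable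
  also have "\<dots> \<le> 65536 * (40 * (\<integral>\<^sup>+x. \<phi> x * \<phi> x \<partial>lborel))" by (intro mult_left_mono hl_maximal_L2) auto
  also have "(\<integral>\<^sup>+x. \<phi> x * \<phi> x \<partial>lborel) = (\<integral>\<^sup>+x. 2 * maximal_function f x \<partial>lborel)" by (simp add: \<phi>_def esqrt_mult_self)
  also have "\<dots> = 2 * (\<integral>\<^sup>+x. maximal_function f x \<partial>lborel)" by (rule nn_integral_cmult) measurable
  also have "\<dots> = 2 * (2 * hardy_norm f)" unfolding nn_integral_maximal_function[OF f] ..
  also have "65536 * (40 * (2 * (2 * hardy_norm f))) = ennreal (65536 * 160) * hardy_norm f"
    by (simp add: mult.assoc[symmetric])
  finally show ?thesis .
qed

definition odd_part :: "(complex \<Rightarrow> real) \<Rightarrow> (real \<Rightarrow> complex) \<Rightarrow> real \<Rightarrow> real" where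
  "odd_part r f y = r (zero_ext f y) - r (zero_ext f (- y))"

text \<open>
  The mean value and contour arguments are about real functions; they are applied to the real and the
  imaginary part of \<open>f\<close>.
\<close>

locale real_functional =
  fixes r :: "complex \<Rightarrow> real" and f :: "real \<Rightarrow> complex"
  assumes r: "bounded_linear r" and r_le: "\<And>z. \<bar>r z\<bar> \<le> norm z"
    and f: "integrable half_line f"
begin

lemma zero_ext_integrable: "integrable lborel (zero_ext f)"
  using f by (simp add: integrable_zero_ext)

lemma r_integrable: "integrable lborel (\<lambda>y. r (zero_ext f y))" "integrable lborel (\<lambda>y. r (zero_ext f (- y)))"
proof -
  show 1: "integrable lborel (\<lambda>y. r (zero_ext f y))" by (rule integrable_bounded_linear[OF r zero_ext_integrable])
  show "integrable lborel (\<lambda>y. r (zero_ext f (- y)))" using lborel_integrable_real_affine[OF 1, of "-1" 0] by simp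
qed

lemma odd_part_integrable: "integrable lborel (odd_part r f)"
  unfolding odd_part_def[abs_def] by (rule Bochner_Integration.integrable_diff[OF r_integrable])

lemma odd_part_pos: "0 < x \<Longrightarrow> odd_part r f x = r (f x)"
  by (simp add: odd_part_def zero_ext_def linear_0[OF bounded_linear.linear[OF r]])

lemma r_of_real_mult: "r (of_real c * z) = c * r z"
  using linear_cmul[OF bounded_linear.linear[OF r], of c z] by (simp add: scaleR_conv_of_real)

text \<open>
  The Poisson integral of the odd extension, written as an integral over the half-line.
\<close>

lemma poisson_odd_part:
  assumes t: "0 < t"
  shows "poisson (odd_part r f) t x = r (LINT y|lborel. of_real (poisson_kernel t (x - y) - poisson_kernel t (x + y)) * zero_ext f y)"
proof -
  let ?k = "\<lambda>y. of_real (poisson_kernel t (x - y) - poisson_kernel t (x + y))"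
  let ?g = "\<lambda>y. r (zero_ext f y)"
  have b: "norm (poisson_kernel t y) \<le> 1 / (pi * t)" for y
    using poisson_kernel_le[OF t, of y] poisson_kernel_pos[OF t, of y] by simp
  have i: "integrable lborel (\<lambda>y. ?g y * poisson_kernel t (x - y))" "integrable lborel (\<lambda>y. ?g (- y) * poisson_kernel t (x - y))"
      "integrable lborel (\<lambda>y. ?g y * poisson_kernel t (x + y))"
    using r_integrable b by (auto intro!: integrable_mult_bounded[where M = "1 / (pi * t)"])
  have "poisson (odd_part r f) t x = (LINT y|lborel. ?g y * poisson_kernel t (x - y) - ?g (- y) * poisson_kernel t (x - y))"
    by (simp add: poisson_def odd_part_def left_diff_distrib)
  also have "\<dots> = (LINT y|lborel. ?g y * poisson_kernel t (x - y)) - (LINT y|lborel. ?g (- y) * poisson_kernel t (x - y))"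
    by (rule Bochner_Integration.integral_diff[OF i(1,2)])
  also have "(LINT y|lborel. ?g (- y) * poisson_kernel t (x - y)) = (LINT y|lborel. ?g y * poisson_kernel t (x + y))"
    using lborel_integral_real_affine[of "-1" "\<lambda>y. ?g (- y) * poisson_kernel t (x - y)" 0] by simp
  also have "(LINT y|lborel. ?g y * poisson_kernel t (x - y)) - (LINT y|lborel. ?g y * poisson_kernel t (x + y))
     = (LINT y|lborel. ?g y * poisson_kernel t (x - y) - ?g y * poisson_kernel t (x + y))"
    by (rule Bochner_Integration.integral_diff[OF i(1,3), symmetric])
  also have "\<dots> = (LINT y|lborel. r (?k y * zero_ext f y))"
    unfolding r_of_real_mult by (intro Bochner_Integration.integral_cong refl) (simp add: algebra_simps)
  also have "\<dots> = r (LINT y|lborel. ?k y * zero_ext f y)"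
  proof (rule integral_bounded_linear[OF r])
    have b2: "norm (complex_of_real (poisson_kernel t (x - y) - poisson_kernel t (x + y))) \<le> 1 / (pi * t) + 1 / (pi * t)" for y
      using b[of "x - y"] b[of "x + y"] unfolding norm_of_real real_norm_def by linarith
    have "integrable lborel (\<lambda>y. zero_ext f y * ?k y)"
      by (rule integrable_mult_bounded[OF zero_ext_integrable _ b2]) measurable
    then show "integrable lborel (\<lambda>y. ?k y * zero_ext f y)"
      by (simp add: mult.commute)
  qed
  finally show ?thesis .
qed

lemma poisson_odd_part_zero: "0 < t \<Longrightarrow> poisson (odd_part r f) t 0 = 0"
  by (simp add: poisson_odd_part linear_0[OF bounded_linear.linear[OF r]])

lemma poisson_odd_part_le:
  assumes t: "0 < t"
  shows "ennreal \<bar>poisson (odd_part r f) t x\<bar> \<le> 2 * maximal_function f x"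
  unfolding poisson_odd_part[OF t]
  by (rule order_trans[OF ennreal_leI[OF r_le] poisson_le_maximal_function[OF f t]])

abbreviation "G \<equiv> cauchy_transform (odd_part r f)"

lemmas G_holomorphic = holomorphic_cauchy_transform[OF odd_part_integrable]
lemmas Re_G = Re_cauchy_transform[OF odd_part_integrable]

text \<open>
  In the cone of aperture \<open>3\<close> over \<open>x\<close>, the disc about \<open>z\<close> of radius \<open>R = Im z / 2\<close> stays in the upper half-plane,
  and the interval of radius \<open>8 R\<close> about \<open>Re z\<close> contains \<open>x\<close>. The ratio of the two lengths
  turns the factor \<open>16 / R\<close> into \<open>256\<close>.
\<close>

lemma Re_G_le_control:
  assumes z: "0 < Im z" "\<bar>Re z - x\<bar> \<le> 3 * Im z"
  shows "ennreal \<bar>Re (G z)\<bar> \<le> control f x"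
proof -
  define \<phi> where "\<phi> = (\<lambda>x. esqrt (2 * maximal_function f x))"
  note [measurable] = maximal_function_measurable[OF f]
  have [measurable]: "\<phi> \<in> borel_measurable borel" unfolding \<phi>_def by measurable
  define R where "R = Im z / 2"
  have R: "0 < R" using z by (simp add: R_def)
  have Im_pos: "0 < Im w" if "w \<in> cball z R" for w
  proof -
    have "Im z - Im w \<le> R" using abs_Im_le_cmod[of "z - w"] that by (simp add: dist_norm)
    then show ?thesis using z(1) unfolding R_def by linarith
  qed
  have "ennreal (sqrt \<bar>Re (G z)\<bar>) \<le> ennreal (16 / R) * (\<integral>\<^sup>+x\<in>ball (Re z) R. \<phi> x \<partial>lborel)"
  proof (rule sqrt_Re_le_average[OF _ R])
    show "G holomorphic_on cball z R" by (rule holomorphic_on_subset[OF G_holomorphic]) (use Im_pos in auto)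
    fix w assume w: "w \<in> cball z R"
    have "ennreal (sqrt \<bar>Re (G w)\<bar>) = esqrt (ennreal \<bar>Re (G w)\<bar>)" by (simp add: esqrt_ennreal)
    also have "\<dots> \<le> \<phi> (Re w)"
      unfolding \<phi>_def Re_G[OF Im_pos[OF w]] by (intro esqrt_mono poisson_odd_part_le Im_pos[OF w])
    finally show "ennreal (sqrt \<bar>Re (G w)\<bar>) \<le> \<phi> (Re w)" .
  qed measurable
  also have "\<dots> \<le> ennreal (16 / R) * (\<integral>\<^sup>+x\<in>ball (Re z) (8 * R). \<phi> x \<partial>lborel)"
    using R by (intro mult_left_mono nn_integral_mono) (auto simp: indicator_def)
  also have "\<dots> = 256 * ((\<integral>\<^sup>+x\<in>ball (Re z) (8 * R). \<phi> x \<partial>lborel) / ennreal (2 * (8 * R)))"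
  proof -
    have "ennreal (16 / R) = 256 * (1 / ennreal (2 * (8 * R)))"
      using R by (simp add: divide_ennreal[of 1, simplified] flip: ennreal_mult'' ennreal_numeral)
    then show ?thesis by (simp add: mult.assoc ennreal_times_divide mult.commute)
  qed
  also have "\<dots> \<le> 256 * hl_maximal \<phi> x"
    using z R by (intro mult_left_mono average_le_hl_maximal) (auto simp: dist_real_def R_def)
  finally have *: "ennreal (sqrt \<bar>Re (G z)\<bar>) \<le> 256 * hl_maximal \<phi> x" .
  have "ennreal \<bar>Re (G z)\<bar> = ennreal (sqrt \<bar>Re (G z)\<bar>) * ennreal (sqrt \<bar>Re (G z)\<bar>)" by (simp flip: ennreal_mult)
  also have "\<dots> \<le> (256 * hl_maximal \<phi> x) * (256 * hl_maximal \<phi> x)" by (intro mult_mono *) auto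
  finally show ?thesis by (simp add: control_def \<phi>_def)
qed

lemma Re_G_le:
  assumes "control f x \<le> ennreal A" "0 \<le> A" "0 < Im z" "\<bar>Re z - x\<bar> \<le> 3 * Im z"
  shows "\<bar>Re (G z)\<bar> \<le> A"
proof -
  have "ennreal \<bar>Re (G z)\<bar> \<le> ennreal A" by (rule order_trans[OF Re_G_le_control[OF assms(3,4)] assms(1)])
  then show ?thesis using assms(2) by (simp only: ennreal_le_iff)
qed

text \<open>
  A disc of radius \<open>Im z / 2\<close> about a point of the cone of aperture \<open>1\<close> is contained in the cone of
  aperture \<open>3\<close>.
\<close>

lemma norm_deriv_G_le:
  assumes A: "control f x \<le> ennreal A" "0 \<le> A" and z: "0 < Im z" "\<bar>Re z - x\<bar> \<le> Im z"
  shows "norm (deriv G z) \<le> 4 / Im z * A"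
proof -
  define \<rho> where "\<rho> = Im z / 2"
  have \<rho>: "0 < \<rho>" using z by (simp add: \<rho>_def)
  have near: "\<bar>Im w - Im z\<bar> \<le> \<rho> \<and> \<bar>Re w - Re z\<bar> \<le> \<rho>" if "dist w z \<le> \<rho>" for w
    using abs_Im_le_cmod[of "w - z"] abs_Re_le_cmod[of "w - z"] that by (simp add: dist_norm)
  have "norm (deriv G z) \<le> 2 / \<rho> * A"
  proof (rule norm_deriv_le_Re[OF _ \<rho>])
    show "G holomorphic_on cball z \<rho>"
    proof (rule holomorphic_on_subset[OF G_holomorphic], rule subsetI)
      fix w assume "w \<in> cball z \<rho>"
      then have "Im z - \<rho> \<le> Im w" using near[of w] by (auto simp: dist_commute abs_le_iff)
      then have "0 < Im w" using z(1) unfolding \<rho>_def by linarith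
      then show "w \<in> {z. 0 < Im z}" by simp
    qed
    fix w assume "dist w z = \<rho>"
    then have "\<bar>Im w - Im z\<bar> \<le> \<rho>" "\<bar>Re w - Re z\<bar> \<le> \<rho>" using near[of w] by auto
    then have "0 < Im w" "\<bar>Re w - x\<bar> \<le> 3 * Im w" using z unfolding \<rho>_def by linarith+
    then show "\<bar>Re (G w)\<bar> \<le> A" by (rule Re_G_le[OF A])
  qed
  then show ?thesis by (simp add: \<rho>_def)
qed

text \<open>
  The contour argument for the extension shifted down by \<open>e\<close>, which is holomorphic across the real axis. The shift
  does not leave the cones.
\<close>

lemma moment_poisson_le:
  assumes ab: "0 \<le> a" "a < b" and \<tau>: "0 < \<tau>" and e: "0 < e"
    and a: "a = 0 \<or> control f a \<le> ennreal (\<tau> * a)" and b: "control f b \<le> ennreal (\<tau> * b)"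
  shows "\<bar>integral {a..b} (\<lambda>x. x * poisson (odd_part r f) e x)\<bar> \<le> 18 * \<tau> * b\<^sup>2 * (b - a)"
proof -
  define c where "c = Complex a (b - a)"
  define Ge where "Ge = (\<lambda>z. G (z + \<i> * of_real e))"
  define S where "S = {z. - e < Im z}"
  have S: "open S" "convex S" unfolding S_def by (simp_all add: open_halfspace_Im_gt convex_halfspace_Im_gt)
  have hol: "Ge holomorphic_on S"
    unfolding Ge_def by (rule holomorphic_on_compose_gen[OF _ G_holomorphic, unfolded o_def]) (auto intro!: holomorphic_intros simp: S_def)
  have dGe: "deriv Ge z = deriv G (z + \<i> * of_real e)" if "0 \<le> Im z" for z
  proof -
    have "(G has_field_derivative deriv G (z + \<i> * of_real e)) (at (z + \<i> * of_real e))"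
      by (rule holomorphic_derivI[OF G_holomorphic]) (use that e in \<open>auto simp: open_halfspace_Im_gt\<close>)
    then have "(Ge has_field_derivative deriv G (z + \<i> * of_real e)) (at z)"
      unfolding Ge_def by (simp add: DERIV_shift)
    then show ?thesis by (rule DERIV_imp_deriv)
  qed
  have real: "Re (Ge (of_real x)) = poisson (odd_part r f) e x" for x
    unfolding Ge_def using e by (simp add: Re_G)
  \<comment> \<open>Both legs stay in the unit cone of an endpoint \<open>q\<close>, so one estimate serves for them.\<close>
  have leg: "\<bar>Re (Ge z)\<bar> * norm z + \<bar>Re z * Im z\<bar> * norm (deriv Ge z) \<le> 6 * \<tau> * b\<^sup>2"
    if z: "0 \<le> Re z" "Re z \<le> b" "0 \<le> Im z" "Im z \<le> b" and q: "0 \<le> q" "q \<le> b" "control f q \<le> ennreal (\<tau> * q)" "\<bar>Re z - q\<bar> \<le> Im z" for z q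
  proof -
    have \<tau>q: "0 \<le> \<tau> * q" "\<tau> * q \<le> \<tau> * b" using \<tau> q by auto
    have 1: "\<bar>Re (Ge z)\<bar> \<le> \<tau> * b"
      using Re_G_le[OF q(3) \<tau>q(1), of "z + \<i> * of_real e"] z q e \<tau>q(2) by (simp add: Ge_def)
    have "norm (deriv Ge z) \<le> 4 / (Im z + e) * (\<tau> * q)"
      using norm_deriv_G_le[OF q(3) \<tau>q(1), of "z + \<i> * of_real e"] z q e by (simp add: dGe)
    also have "\<dots> \<le> 4 / (Im z + e) * (\<tau> * b)" using z e by (intro mult_left_mono \<tau>q) auto
    finally have "\<bar>Re z * Im z\<bar> * norm (deriv Ge z) \<le> (b * Im z) * (4 / (Im z + e) * (\<tau> * b))"
      using z by (intro mult_mono) (auto simp: abs_mult intro!: mult_mono)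
    also have "\<dots> = (Im z / (Im z + e)) * (4 * \<tau> * b\<^sup>2)" by (simp add: power2_eq_square)
    also have "\<dots> \<le> 1 * (4 * \<tau> * b\<^sup>2)" using z e \<tau> by (intro mult_right_mono) auto
    finally have 2: "\<bar>Re z * Im z\<bar> * norm (deriv Ge z) \<le> 4 * \<tau> * b\<^sup>2" by simp
    have "norm z \<le> 2 * b" using cmod_le[of z] z by simp
    then have "\<bar>Re (Ge z)\<bar> * norm z \<le> (\<tau> * b) * (2 * b)" using 1 by (intro mult_mono) (use \<tau> ab in auto)
    then have "\<bar>Re (Ge z)\<bar> * norm z \<le> 2 * \<tau> * b\<^sup>2" by (simp add: power2_eq_square)
    then show ?thesis using 2 by linarith
  qed
  have "\<bar>integral {a..b} (\<lambda>x. x * Re (Ge (of_real x)))\<bar> \<le> 3 * (b - a) * (6 * \<tau> * b\<^sup>2)"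
  proof (rule moment_on_interval[OF S hol ab(2) c_def])
    show "of_real a \<in> S" "of_real b \<in> S" "c \<in> S" using e ab by (auto simp: S_def c_def)
    fix z assume "z \<in> closed_segment (of_real b) c \<union> closed_segment c (of_real a)"
    then show "\<bar>Re (Ge z)\<bar> * norm z + \<bar>Re z * Im z\<bar> * norm (deriv Ge z) \<le> 6 * \<tau> * b\<^sup>2"
    proof
      assume "z \<in> closed_segment (of_real b) c"
      then obtain u where u: "0 \<le> u" "u \<le> 1" "z = (1 - u) *\<^sub>R of_real b + u *\<^sub>R c" by (auto simp: closed_segment_def)
      have zz: "Re z = b - u * (b - a)" "Im z = u * (b - a)" by (simp_all add: u(3) c_def algebra_simps)
      have ub: "0 \<le> u * (b - a)" "u * (b - a) \<le> b - a" using u ab by (auto simp: mult_left_le_one_le)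
      have "0 \<le> Re z" "Re z \<le> b" "0 \<le> Im z" "Im z \<le> b" "\<bar>Re z - b\<bar> \<le> Im z"
        unfolding zz using ub ab by linarith+
      then show ?thesis using ab b by (intro leg[of z b]) auto
    next
      assume "z \<in> closed_segment c (of_real a)"
      then obtain u where u: "0 \<le> u" "u \<le> 1" "z = (1 - u) *\<^sub>R c + u *\<^sub>R of_real a" by (auto simp: closed_segment_def)
      have zz: "Re z = a" "Im z = (1 - u) * (b - a)" by (simp_all add: u(3) c_def algebra_simps)
      have ub: "0 \<le> (1 - u) * (b - a)" "(1 - u) * (b - a) \<le> b - a" using u ab by (auto simp: mult_left_le_one_le)
      show ?thesis
      proof (cases "a = 0")
        case True
        then have "Re (Ge z) = 0"
          using zz ub e by (simp add: Ge_def Re_G poisson_odd_part_zero)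
        then show ?thesis using True zz \<tau> by simp
      next
        case False
        have "0 \<le> Re z" "Re z \<le> b" "0 \<le> Im z" "Im z \<le> b" "\<bar>Re z - a\<bar> \<le> Im z"
          unfolding zz using ub ab by linarith+
        then show ?thesis using ab a False by (intro leg[of z a]) auto
      qed
    qed
  qed
  moreover have "3 * (b - a) * (6 * \<tau> * b\<^sup>2) = 18 * \<tau> * b\<^sup>2 * (b - a)" by (simp add: algebra_simps)
  ultimately show ?thesis unfolding real by (simp only:)
qed

lemma continuous_poisson: "0 < e \<Longrightarrow> continuous_on UNIV (poisson (odd_part r f) e)"
proof -
  assume e: "0 < e"
  have "continuous_on UNIV (\<lambda>x. Re (G (of_real x + \<i> * of_real e)))"
    by (intro continuous_intros continuous_on_compose2[OF holomorphic_on_imp_continuous_on[OF G_holomorphic]]) (use e in auto)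
  moreover have "Re (G (of_real x + \<i> * of_real e)) = poisson (odd_part r f) e x" for x
    using e by (simp add: Re_G)
  ultimately show ?thesis by simp
qed

lemma poisson_tendsto_L1:
  "(\<lambda>n. \<integral>\<^sup>+x. ennreal \<bar>poisson (odd_part r f) (1 / real (Suc n)) x - odd_part r f x\<bar> \<partial>lborel) \<longlonglongrightarrow> 0"
  by (rule poisson_L1_convergence[OF odd_part_integrable]) (use LIMSEQ_inverse_real_of_nat in \<open>auto simp: inverse_eq_divide\<close>)

text \<open>
  Passage to the limit in the contour estimate by convergence in \<open>L\<^sup>1\<close>.
\<close>

lemma moment_le:
  assumes ab: "0 \<le> a" "a < b" and \<tau>: "0 < \<tau>"
    and a: "a = 0 \<or> control f a \<le> ennreal (\<tau> * a)" and b: "control f b \<le> ennreal (\<tau> * b)"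
  shows "\<bar>LINT x:{a<..<b}|lborel. r (f x) * x\<bar> \<le> 18 * \<tau> * b\<^sup>2 * (b - a)"
proof -
  let ?u = "\<lambda>n x. poisson (odd_part r f) (1 / real (Suc n)) x" and ?F = "odd_part r f"
  let ?U = "\<lambda>n x. indicator {a..b} x *\<^sub>R (x * ?u n x)"
  let ?V = "\<lambda>x. indicator {a..b} x *\<^sub>R (x * ?F x)"
  have cont: "continuous_on A (\<lambda>x. x * ?u n x)" for n A
    by (intro continuous_intros continuous_on_subset[OF continuous_poisson]) auto
  have si: "set_integrable lborel {a..b} (\<lambda>x. x * ?u n x)" for n
    by (rule borel_integrable_atLeastAtMost') (rule cont)
  have iF: "integrable lborel (\<lambda>x. ?V x)"
  proof (rule Bochner_Integration.integrable_bound[OF integrable_mult_right[OF integrable_norm[OF odd_part_integrable], of b]])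
    show "(\<lambda>x. ?V x) \<in> borel_measurable lborel"
      using borel_measurable_integrable[OF odd_part_integrable] by measurable
    show "AE x in lborel. norm (?V x) \<le> norm (b * norm (?F x))"
      using ab by (intro AE_I2) (auto simp: indicator_def abs_mult intro!: mult_right_mono)
  qed
  have "(\<lambda>n. LINT x|lborel. ?U n x) \<longlonglongrightarrow> (LINT x|lborel. ?V x)"
  proof (rule tendsto_L1_int)
    show "integrable lborel (\<lambda>x. ?U n x)" for n
      using si by (simp only: set_integrable_def)
    show "integrable lborel (\<lambda>x. ?V x)" by (rule iF)
    show "(\<lambda>n. \<integral>\<^sup>+x. ennreal (norm (?U n x - ?V x)) \<partial>lborel) \<longlonglongrightarrow> 0"
    proof (rule tendsto_sandwich[OF _ _ tendsto_const])
      show "(\<lambda>n. ennreal b * (\<integral>\<^sup>+x. ennreal \<bar>?u n x - ?F x\<bar> \<partial>lborel)) \<longlonglongrightarrow> 0"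
        using ennreal_tendsto_cmult[OF _ poisson_tendsto_L1, of "ennreal b"] by simp
      show "\<forall>\<^sub>F n in sequentially. (\<integral>\<^sup>+x. ennreal (norm (?U n x - ?V x)) \<partial>lborel)
          \<le> ennreal b * (\<integral>\<^sup>+x. ennreal \<bar>?u n x - ?F x\<bar> \<partial>lborel)"
      proof (rule always_eventually, rule allI)
        fix n
        have [measurable]: "?u n \<in> borel_measurable borel"
          by (rule borel_measurable_continuous_onI[OF continuous_poisson]) simp
        have [measurable]: "?F \<in> borel_measurable borel" using borel_measurable_integrable[OF odd_part_integrable] by simp
        have "norm (?U n x - ?V x) \<le> b * \<bar>?u n x - ?F x\<bar>" for x
        proof (cases "x \<in> {a..b}")
          case True
          then have "norm (?U n x - ?V x) = \<bar>x\<bar> * \<bar>?u n x - ?F x\<bar>"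
            by (simp add: abs_mult flip: right_diff_distrib)
          also have "\<dots> \<le> b * \<bar>?u n x - ?F x\<bar>" using True ab by (intro mult_right_mono) auto
          finally show ?thesis .
        next
          case False
          then show ?thesis using ab by simp
        qed
        then have "(\<integral>\<^sup>+x. ennreal (norm (?U n x - ?V x)) \<partial>lborel)
            \<le> (\<integral>\<^sup>+x. ennreal b * ennreal \<bar>?u n x - ?F x\<bar> \<partial>lborel)"
          using ab by (intro nn_integral_mono) (simp add: ennreal_leI flip: ennreal_mult)
        also have "\<dots> = ennreal b * (\<integral>\<^sup>+x. ennreal \<bar>?u n x - ?F x\<bar> \<partial>lborel)" by (rule nn_integral_cmult) measurable
        finally show "(\<integral>\<^sup>+x. ennreal (norm (?U n x - ?V x)) \<partial>lborel)
          \<le> ennreal b * (\<integral>\<^sup>+x. ennreal \<bar>?u n x - ?F x\<bar> \<partial>lborel)" .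
      qed
    qed auto
  qed
  then have "(\<lambda>n. \<bar>LINT x|lborel. ?U n x\<bar>) \<longlonglongrightarrow> \<bar>LINT x|lborel. ?V x\<bar>"
    by (rule tendsto_rabs)
  then have le: "\<bar>LINT x|lborel. ?V x\<bar> \<le> 18 * \<tau> * b\<^sup>2 * (b - a)"
  proof (rule LIMSEQ_le_const2, intro exI allI impI)
    fix n
    show "\<bar>LINT x|lborel. ?U n x\<bar> \<le> 18 * \<tau> * b\<^sup>2 * (b - a)"
    using moment_poisson_le[OF ab \<tau> _ a b, of "1 / real (Suc n)"] set_borel_integral_eq_integral(2)[OF si[of n]]
    by (simp add: set_lebesgue_integral_def)
  qed
  have "(LINT x:{a<..<b}|lborel. r (f x) * x) = (LINT x|lborel. ?V x)"
    unfolding set_lebesgue_integral_def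
  proof (rule integral_cong_AE)
    have "AE x in lborel. x \<noteq> a \<and> x \<noteq> b" using AE_lborel_singleton[of a] AE_lborel_singleton[of b] by eventually_elim simp
    then show "AE x in lborel. indicator {a<..<b} x *\<^sub>R (r (f x) * x) = ?V x"
      by eventually_elim (use ab in \<open>auto simp: indicator_def odd_part_pos\<close>)
    have eq: "(\<lambda>x. indicator {a<..<b} x *\<^sub>R (r (f x) * x)) = (\<lambda>x. indicator {a<..<b} x *\<^sub>R (?F x * x))"
      using ab by (auto simp: indicator_def odd_part_pos)
    show "(\<lambda>x. indicator {a<..<b} x *\<^sub>R (r (f x) * x)) \<in> borel_measurable lborel"
      unfolding eq using borel_measurable_integrable[OF odd_part_integrable] by measurable
    show "(\<lambda>x. ?V x) \<in> borel_measurable lborel" by (rule borel_measurable_integrable[OF iF])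
  qed
  then show ?thesis using le by simp
qed

text \<open>
  The Poisson integrals are bounded by \<open>N\<close> and converge in \<open>L\<^sup>1\<close>, so the excess of \<open>\<bar>f\<bar>\<close> over \<open>N\<close> has integral zero.
\<close>

lemma AE_le_control: "AE x in lborel. 0 < x \<longrightarrow> ennreal \<bar>r (f x)\<bar> \<le> control f x"
proof -
  let ?u = "\<lambda>n x. poisson (odd_part r f) (1 / real (Suc n)) x" and ?F = "odd_part r f"
  have [measurable]: "?F \<in> borel_measurable borel" using borel_measurable_integrable[OF odd_part_integrable] by simp
  let ?I = "\<integral>\<^sup>+x. (ennreal \<bar>?F x\<bar> - control f x) \<partial>lborel"
  have "?I \<le> (\<integral>\<^sup>+x. ennreal \<bar>?u n x - ?F x\<bar> \<partial>lborel)" for n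
  proof (rule nn_integral_mono)
    fix x
    have "ennreal \<bar>?u n x\<bar> \<le> control f x"
      using Re_G_le_control[of "of_real x + \<i> * of_real (1 / real (Suc n))" x] by (simp add: Re_G)
    moreover have "ennreal \<bar>?F x\<bar> \<le> ennreal \<bar>?u n x\<bar> + ennreal \<bar>?u n x - ?F x\<bar>"
      by (simp add: ennreal_leI flip: ennreal_plus)
    ultimately have "ennreal \<bar>?F x\<bar> \<le> control f x + ennreal \<bar>?u n x - ?F x\<bar>"
      by (meson add_right_mono order_trans)
    then show "ennreal \<bar>?F x\<bar> - control f x \<le> ennreal \<bar>?u n x - ?F x\<bar>"
      by (simp add: ennreal_minus_le_iff)
  qed
  then have "?I \<le> 0" by (intro LIMSEQ_le_const[OF poisson_tendsto_L1]) auto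
  then have "?I = 0" by simp
  then have "AE x in lborel. ennreal \<bar>?F x\<bar> - control f x = 0"
    by (subst (asm) nn_integral_0_iff_AE) auto
  then show ?thesis
  proof eventually_elim
    case (elim x)
    then show ?case by (auto simp: diff_eq_0_iff_ennreal odd_part_pos)
  qed
qed

end

lemma real_functional_Re_Im:
  assumes "integrable half_line f"
  shows "real_functional Re f" "real_functional Im f"
  using assms by (auto simp: real_functional_def bounded_linear_Re bounded_linear_Im abs_Re_le_cmod abs_Im_le_cmod)

text \<open>
  On a null set \<open>f\<close> may exceed the majorant, and there it is replaced by zero.
\<close>

lemma moment_control_truncation:
  assumes f: "integrable half_line f" and fin: "hardy_norm f < \<infinity>"
  shows "moment_control (\<lambda>x. if 0 < x \<and> ennreal (norm (f x)) \<le> 2 * control f x then f x else 0) (control f) 36"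
    and "AE x in half_line. ennreal (norm (f x)) \<le> 2 * control f x"
proof -
  interpret R: real_functional Re f by (rule real_functional_Re_Im[OF f])
  interpret I: real_functional Im f by (rule real_functional_Re_Im[OF f])
  define g where "g = (\<lambda>x. if 0 < x \<and> ennreal (norm (f x)) \<le> 2 * control f x then f x else 0)"
  have f0: "integrable lborel (zero_ext f)" using f by (simp add: integrable_zero_ext)
  then have [measurable]: "zero_ext f \<in> borel_measurable borel" by (simp add: borel_measurable_integrable)
  have ae: "AE x in lborel. 0 < x \<longrightarrow> ennreal (norm (f x)) \<le> 2 * control f x"
    using R.AE_le_control I.AE_le_control
  proof eventually_elim
    case (elim x)
    have "ennreal (norm (f x)) \<le> ennreal \<bar>Re (f x)\<bar> + ennreal \<bar>Im (f x)\<bar>"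
      using cmod_le[of "f x"] by (simp add: ennreal_leI flip: ennreal_plus)
    then show ?case using elim by (auto simp: mult_2 intro: order_trans add_mono)
  qed
  then show "AE x in half_line. ennreal (norm (f x)) \<le> 2 * control f x" by (simp add: AE_half_line)
  have g_eq: "g = (\<lambda>x. if ennreal (norm (zero_ext f x)) \<le> 2 * control f x then zero_ext f x else 0)"
    by (auto simp: g_def zero_ext_def indicator_def)
  have "moment_control g (control f) 36"
  proof
    show "g \<in> borel_measurable borel" unfolding g_eq by measurable
    show "open {x. c < control f x}" for c by (rule open_control_greater)
    have "ennreal (65536 * 160) * hardy_norm f < \<infinity>" using fin by (simp add: ennreal_mult_less_top)
    then show "(\<integral>\<^sup>+x\<in>{0<..}. control f x \<partial>lborel) < \<infinity>" by (rule le_less_trans[OF nn_integral_control_le[OF f]])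
    show "ennreal (norm (g x)) \<le> 2 * control f x" for x by (simp add: g_def)
    fix a b \<tau> :: real
    assume ab: "0 \<le> a" "a < b" and \<tau>: "0 < \<tau>"
      and a: "a = 0 \<or> control f a \<le> ennreal (\<tau> * a)" and b: "control f b \<le> ennreal (\<tau> * b)"
    have int: "integrable lborel (\<lambda>x. indicator {a<..<b} x *\<^sub>R (zero_ext f x * of_real x))"
    proof (rule Bochner_Integration.integrable_bound[OF integrable_mult_right[OF integrable_norm[OF f0], of b]])
      show "AE x in lborel. norm (indicator {a<..<b} x *\<^sub>R (zero_ext f x * of_real x)) \<le> norm (b * norm (zero_ext f x))"
        using ab by (intro AE_I2) (auto simp: indicator_def norm_mult mult.commute intro!: mult_right_mono)
    qed measurable
    have "(LINT x:{a<..<b}|lborel. g x * of_real x) = (LINT x|lborel. indicator {a<..<b} x *\<^sub>R (zero_ext f x * of_real x))"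
      unfolding set_lebesgue_integral_def
    proof (rule integral_cong_AE)
      show "(\<lambda>x. indicator {a<..<b} x *\<^sub>R (g x * of_real x)) \<in> borel_measurable lborel" unfolding g_eq by measurable
      show "AE x in lborel. indicator {a<..<b} x *\<^sub>R (g x * of_real x) = indicator {a<..<b} x *\<^sub>R (zero_ext f x * of_real x)"
        using ae by eventually_elim (use ab in \<open>auto simp: indicator_def g_def zero_ext_def\<close>)
    qed measurable
    then have eq: "(LINT x:{a<..<b}|lborel. g x * of_real x) = (LINT x|lborel. indicator {a<..<b} x *\<^sub>R (zero_ext f x * of_real x))" .
    let ?J = "LINT x|lborel. indicator {a<..<b} x *\<^sub>R (zero_ext f x * of_real x)"
    have part: "r ?J = (LINT x:{a<..<b}|lborel. r (f x) * x)" if r: "bounded_linear r" "\<And>c z. r (of_real c * z) = c * r z" for r :: "complex \<Rightarrow> real"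
    proof -
      have "r ?J = (LINT x|lborel. r (indicator {a<..<b} x *\<^sub>R (zero_ext f x * of_real x)))"
        by (rule integral_bounded_linear[OF r(1) int, symmetric])
      also have "\<dots> = (LINT x:{a<..<b}|lborel. r (f x) * x)"
        unfolding set_lebesgue_integral_def
      proof (rule Bochner_Integration.integral_cong[OF refl])
        fix x
        have "r (f x * of_real x) = r (f x) * x" using r(2)[of x "f x"] by (simp add: mult.commute)
        then show "r (indicator {a<..<b} x *\<^sub>R (zero_ext f x * of_real x)) = indicator {a<..<b} x *\<^sub>R (r (f x) * x)"
          using ab linear_0[OF bounded_linear.linear[OF r(1)]] by (auto simp: indicator_def zero_ext_def)
      qed
      finally show ?thesis .
    qed
    have "norm ?J \<le> \<bar>Re ?J\<bar> + \<bar>Im ?J\<bar>" by (rule cmod_le)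
    also have "\<dots> \<le> 18 * \<tau> * b\<^sup>2 * (b - a) + 18 * \<tau> * b\<^sup>2 * (b - a)"
      unfolding part[OF bounded_linear_Re R.r_of_real_mult] part[OF bounded_linear_Im I.r_of_real_mult]
      by (intro add_mono R.moment_le I.moment_le ab \<tau> a b)
    also have "\<dots> = 36 * \<tau> * b\<^sup>2 * (b - a)" by simp
    finally show "norm (LINT x:{a<..<b}|lborel. g x * of_real x) \<le> 36 * \<tau> * b\<^sup>2 * (b - a)"
      unfolding eq .
  qed simp
  then show "moment_control (\<lambda>x. if 0 < x \<and> ennreal (norm (f x)) \<le> 2 * control f x then f x else 0) (control f) 36"
    by (simp add: g_def)
qed

theorem hardy_space_atomic_upper_bound:
  assumes f: "integrable half_line f" and fin: "hardy_norm f < \<infinity>"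
  obtains l a B where
    "\<And>n. atom_on (B n) (a n)" "\<And>n. (\<integral>\<^sup>+x. ennreal (norm (a n x)) \<partial>half_line) \<le> 1" "\<And>n. a n \<in> borel_measurable half_line"
    "summable (\<lambda>n. norm (l n :: complex))"
    "ennreal (\<Sum>n. norm (l n)) \<le> ennreal (18 * 36 * (65536 * 160)) * hardy_norm f"
    "AE x in half_line. (\<lambda>n. l n * a n x) sums f x"
proof -
  define g where "g = (\<lambda>x. if 0 < x \<and> ennreal (norm (f x)) \<le> 2 * control f x then f x else 0)"
  interpret moment_control g "control f" 36
    unfolding g_def by (rule moment_control_truncation(1)[OF f fin])
  obtain l a B where *: "\<And>n. atom_on (B n) (a n)" "\<And>n. (\<integral>\<^sup>+x. ennreal (norm (a n x)) \<partial>lborel) \<le> 1" "\<And>n. a n \<in> borel_measurable borel"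
    "summable (\<lambda>n. norm (l n :: complex))"
    "ennreal (\<Sum>n. norm (l n)) \<le> ennreal (18 * 36) * (\<integral>\<^sup>+x\<in>{0<..}. control f x \<partial>lborel)"
    "\<And>x. 0 < x \<Longrightarrow> control f x < top \<Longrightarrow> (\<lambda>n. l n * a n x) sums g x"
    by (rule atomic_decomposition) (rule that)
  have finae: "AE x in lborel. 0 < x \<longrightarrow> control f x < top"
  proof -
    have "AE x in lborel. control f x * indicator {0<..} x \<noteq> \<infinity>"
      by (rule nn_integral_noteq_infinite) (use N_int in auto)
    then show ?thesis by eventually_elim (auto simp: less_top)
  qed
  show thesis
  proof (rule that[of B a l])
    show "(\<integral>\<^sup>+x. ennreal (norm (a n x)) \<partial>half_line) \<le> 1" for n
      unfolding nn_integral_half_line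
      by (rule order_trans[OF nn_integral_mono *(2)[of n]]) (auto simp: indicator_def)
    show "a n \<in> borel_measurable half_line" for n
      unfolding half_line_def using *(3)[of n] by (intro measurable_restrict_space1) simp
    have "ennreal (18 * 36) * (\<integral>\<^sup>+x\<in>{0<..}. control f x \<partial>lborel) \<le> ennreal (18 * 36) * (ennreal (65536 * 160) * hardy_norm f)"
      by (intro mult_left_mono nn_integral_control_le f) simp
    also have "\<dots> = ennreal (18 * 36 * (65536 * 160)) * hardy_norm f"
      unfolding mult.assoc[symmetric] by (subst ennreal_mult[symmetric]) auto
    finally show "ennreal (\<Sum>n. norm (l n)) \<le> ennreal (18 * 36 * (65536 * 160)) * hardy_norm f" using *(5) by (rule order_trans[rotated])
    show "AE x in half_line. (\<lambda>n. l n * a n x) sums f x"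
      unfolding AE_half_line
      using finae moment_control_truncation(2)[OF f fin, unfolded AE_half_line]
    proof eventually_elim
      case (elim x)
      then show ?case using *(6)[of x] by (simp add: g_def)
    qed
  qed (use * in auto)
qed

text \<open>
  The lower estimate \<open>C\<^sup>-\<^sup>1 \<parallel>f\<parallel> \<le> \<Sum>\<bar>\<lambda>\<^sub>k\<bar>\<close> is a matter of normalisation: the zero function is an atom, so it may be
  listed first with the coefficient \<open>\<parallel>f\<parallel>\<close>. This increases the sum of the coefficients by \<open>\<parallel>f\<parallel>\<close> only and leaves the
  series unchanged.
\<close>

theorem corollary12:
  "\<exists>C::real. C > 0 \<and>
     (\<forall>f \<in> hardy_space.
        \<exists>(l :: nat \<Rightarrow> complex) (a :: nat \<Rightarrow> real \<Rightarrow> complex) (B :: nat \<Rightarrow> real set).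
          (\<forall>k. atom_on (B k) (a k)) \<and>
          summable (\<lambda>k. norm (l k)) \<and>
          (\<lambda>n. \<integral>\<^sup>+x. ennreal (norm (f x - (\<Sum>k<n. l k * a k x))) \<partial>half_line) \<longlonglongrightarrow> 0 \<and>
          (AE x in half_line. (\<lambda>k. l k * a k x) sums f x) \<and>
          ennreal (inverse C) * hardy_norm f \<le> ennreal (\<Sum>k. norm (l k)) \<and>
          ennreal (\<Sum>k. norm (l k)) \<le> ennreal C * hardy_norm f)"
proof (intro exI[of _ "18 * 36 * (65536 * 160) + 1 :: real"] conjI ballI)
  let ?K = "18 * 36 * (65536 * 160) :: real"
  fix f assume "f \<in> hardy_space"
  then have f: "integrable half_line f" and fin: "hardy_norm f < \<infinity>" by (rule hardy_norm_finite)+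
  obtain H where H: "hardy_norm f = ennreal H" "0 \<le> H" using fin by (cases "hardy_norm f" rule: ennreal_cases) auto
  obtain l a B where *: "\<And>n. atom_on (B n) (a n)" "\<And>n. (\<integral>\<^sup>+x. ennreal (norm (a n x)) \<partial>half_line) \<le> 1" "\<And>n. a n \<in> borel_measurable half_line"
    "summable (\<lambda>n. norm (l n :: complex))"
    "ennreal (\<Sum>n. norm (l n)) \<le> ennreal ?K * hardy_norm f"
    "AE x in half_line. (\<lambda>n. l n * a n x) sums f x"
    by (rule hardy_space_atomic_upper_bound[OF f fin]) (rule that)
  define l' where "l' = case_nat (complex_of_real H) l"
  define a' where "a' = case_nat (\<lambda>x. 0) a"
  define B' where "B' = case_nat {0<..1} B"
  have sm: "summable (\<lambda>k. norm (l' k))" by (subst summable_Suc_iff[symmetric]) (simp add: l'_def *(4))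
  have sum: "(\<Sum>k. norm (l' k)) = H + (\<Sum>k. norm (l k))"
    using suminf_split_head[OF sm] H(2) by (simp add: l'_def)
  have sums: "AE x in half_line. (\<lambda>k. l' k * a' k x) sums f x"
    using *(6)
  proof eventually_elim
    case (elim x)
    have "(\<lambda>k. l' (Suc k) * a' (Suc k) x) sums f x" using elim by (simp add: l'_def a'_def)
    then show ?case using sums_Suc[of "\<lambda>k. l' k * a' k x" "f x"] by (simp add: a'_def)
  qed
  have le: "(\<Sum>k. norm (l k)) \<le> ?K * H"
  proof -
    have "ennreal (\<Sum>n. norm (l n)) \<le> ennreal (?K * H)" using *(5) H by (simp add: ennreal_mult)
    then show ?thesis using H(2) by (subst (asm) ennreal_le_iff) auto
  qed
  have "\<forall>k. atom_on (B' k) (a' k)" by (auto simp: B'_def a'_def *(1) atom_on_zero split: nat.split)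
  moreover have "(\<lambda>n. \<integral>\<^sup>+x. ennreal (norm (f x - (\<Sum>k<n. l' k * a' k x))) \<partial>half_line) \<longlonglongrightarrow> 0"
  proof (rule L1_convergence_of_AE_sums[OF _ _ sm sums])
    show "a' n \<in> borel_measurable half_line" for n using *(3) by (cases n) (auto simp: a'_def)
    show "(\<integral>\<^sup>+x. ennreal (norm (a' n x)) \<partial>half_line) \<le> 1" for n using *(2) by (cases n) (auto simp: a'_def)
  qed
  moreover have "ennreal (inverse (?K + 1)) * hardy_norm f \<le> ennreal (\<Sum>k. norm (l' k))"
  proof -
    have "inverse (?K + 1) * H \<le> 1 * H" using H(2) by (intro mult_right_mono) auto
    also have "\<dots> \<le> (\<Sum>k. norm (l' k))" unfolding sum using suminf_nonneg[OF *(4)] by simp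
    finally show ?thesis unfolding H(1) using H(2) by (subst ennreal_mult[symmetric]) (auto intro: ennreal_leI)
  qed
  moreover have "ennreal (\<Sum>k. norm (l' k)) \<le> ennreal (?K + 1) * hardy_norm f"
  proof -
    have "(\<Sum>k. norm (l' k)) \<le> (?K + 1) * H" unfolding sum using le by (simp add: algebra_simps)
    then show ?thesis unfolding H(1) using H(2) by (subst ennreal_mult[symmetric]) (auto intro: ennreal_leI)
  qed
  ultimately show "\<exists>(l :: nat \<Rightarrow> complex) (a :: nat \<Rightarrow> real \<Rightarrow> complex) (B :: nat \<Rightarrow> real set).
          (\<forall>k. atom_on (B k) (a k)) \<and>
          summable (\<lambda>k. norm (l k)) \<and>
          (\<lambda>n. \<integral>\<^sup>+x. ennreal (norm (f x - (\<Sum>k<n. l k * a k x))) \<partial>half_line) \<longlonglongrightarrow> 0 \<and>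
          (AE x in half_line. (\<lambda>k. l k * a k x) sums f x) \<and>
          ennreal (inverse (?K + 1)) * hardy_norm f \<le> ennreal (\<Sum>k. norm (l k)) \<and>
          ennreal (\<Sum>k. norm (l k)) \<le> ennreal (?K + 1) * hardy_norm f"
    using sm sums by blast
qed simp

end
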